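(* There is a deterministic algorithm in the Congested Clique model that solves the $(\Delta+1)$-list coloring problem in $O(1)$ rounds: for every $n$-node input graph $G=(V,E)$ with maximum degree $\Delta$ in which every node $v$ is given a palette $\Psi(v)$ of $\Delta+1$ colors, the algorithm computes a proper coloring in which every node $v$ receives a color from $\Psi(v)$.
   Context: Congested Clique model: the $n$ nodes of the input graph are the computing entities; each node initially knows its incident edges (and its own palette). Computation proceeds in synchronous rounds; in each round every node may perform unbounded local computation and then send a (possibly different) message of $O(\log n)$ bits to every other node of the graph (communication is not restricted to graph edges). At the end every node outputs its own color. Colors are represented by $O(\log n)$-bit identifiers. A coloring is proper if no two adjacent nodes receive the same color. *)

theory Defs
  imports Complex_Main "HOL-Library.Log_Nat"
begin

section \<open>Graphs and list colorings\<close>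

definition simple_graph :: "'v set \<Rightarrow> 'v set set \<Rightarrow> bool" where
  "simple_graph V E \<longleftrightarrow> finite V \<and> (\<forall>e\<in>E. e \<subseteq> V \<and> card e = 2)"

definition incident_edges :: "'v set set \<Rightarrow> 'v \<Rightarrow> 'v set set" where
  "incident_edges E v = {e \<in> E. v \<in> e}"

definition degree :: "'v set set \<Rightarrow> 'v \<Rightarrow> nat" where
  "degree E v = card (incident_edges E v)"

text \<open>Only meaningful for finite nonempty \<^term>\<open>V\<close>.\<close>

definition max_degree :: "'v set \<Rightarrow> 'v set set \<Rightarrow> nat" where
  "max_degree V E = Max (degree E ` V)"

definition proper_coloring :: "'v set set \<Rightarrow> ('v \<Rightarrow> 'c) \<Rightarrow> bool" where
  "proper_coloring E f \<longleftrightarrow> (\<forall>u v. {u, v} \<in> E \<and> u \<noteq> v \<longrightarrow> f u \<noteq> f v)"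

definition list_coloring :: "'v set \<Rightarrow> 'v set set \<Rightarrow> ('v \<Rightarrow> 'c set) \<Rightarrow> ('v \<Rightarrow> 'c) \<Rightarrow> bool" where
  "list_coloring V E \<Psi> f \<longleftrightarrow> proper_coloring E f \<and> (\<forall>v\<in>V. f v \<in> \<Psi> v)"

section \<open>The Congested Clique model\<close>

type_synonym message = "bool list"

text \<open>What a node receives in one round, indexed by the sender.\<close>

type_synonym inbox = "nat \<Rightarrow> message"

text \<open>
  The nodes of an \<open>n\<close>-node clique are \<open>0, \<dots>, n - 1\<close>. As local computation is unbounded and
  deterministic, the state of a node may be taken to be everything it has seen so far: the
  number \<open>n\<close>, its identifier, its input (of type \<open>'i\<close>) and the list of inboxes received in the
  past rounds, oldest first. An algorithm maps this local view to the message to be sent to a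
  given target in the next round, and at the end to the output (of type \<open>'o\<close>) of the node.
\<close>

record ('i, 'o) cc_algorithm =
  send_msg :: "nat \<Rightarrow> nat \<Rightarrow> 'i \<Rightarrow> inbox list \<Rightarrow> nat \<Rightarrow> message"
  final_output :: "nat \<Rightarrow> nat \<Rightarrow> 'i \<Rightarrow> inbox list \<Rightarrow> 'o"

text \<open>
  \<open>history A n inp r v\<close> is the list of inboxes received by node \<open>v\<close> in the first \<open>r\<close> rounds.
  Inboxes are empty at indices that are not other nodes of the clique, so that inputs outside
  \<open>{..<n}\<close> cannot leak into the computation.
\<close>

primrec history ::
  "('i, 'o) cc_algorithm \<Rightarrow> nat \<Rightarrow> (nat \<Rightarrow> 'i) \<Rightarrow> nat \<Rightarrow> nat \<Rightarrow> inbox list"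
where
  "history A n inp 0 v = []"
| "history A n inp (Suc r) v = history A n inp r v @
     [\<lambda>u. if u < n \<and> u \<noteq> v then send_msg A n u (inp u) (history A n inp r u) v else []]"

definition cc_result ::
  "('i, 'o) cc_algorithm \<Rightarrow> nat \<Rightarrow> (nat \<Rightarrow> 'i) \<Rightarrow> nat \<Rightarrow> nat \<Rightarrow> 'o"
where
  "cc_result A n inp R v = final_output A n v (inp v) (history A n inp R v)"

text \<open>
  For \<open>n > 0\<close>, \<^term>\<open>floorlog 2 n\<close> is \<open>\<lfloor>log 2 n\<rfloor> + 1\<close>, the number of bits of \<open>n\<close>; it serves as the
  unit in which \<open>O(log n)\<close> bits are measured (and is positive also for \<open>n = 1\<close>).
\<close>

definition respects_bandwidth ::
  "('i, 'o) cc_algorithm \<Rightarrow> nat \<Rightarrow> (nat \<Rightarrow> 'i) \<Rightarrow> nat \<Rightarrow> nat \<Rightarrow> bool"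
where
  "respects_bandwidth A n inp R b \<longleftrightarrow>
     (\<forall>r<R. \<forall>u<n. \<forall>v<n. u \<noteq> v \<longrightarrow>
        length (send_msg A n u (inp u) (history A n inp r u) v) \<le> b * floorlog 2 n)"

section \<open>\<open>(\<Delta> + 1)\<close>-list coloring in the Congested Clique\<close>

text \<open>Colors are natural numbers with at most \<open>c * floorlog 2 n\<close> binary digits.\<close>

definition delta_plus_one_instance ::
  "nat \<Rightarrow> nat \<Rightarrow> nat set set \<Rightarrow> (nat \<Rightarrow> nat set) \<Rightarrow> bool"
where
  "delta_plus_one_instance c n E \<Psi> \<longleftrightarrow>
     simple_graph {..<n} E \<and>
     (\<forall>v<n. card (\<Psi> v) = max_degree {..<n} E + 1 \<and> \<Psi> v \<subseteq> {..<2 ^ (c * floorlog 2 n)})"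

definition node_input ::
  "nat set set \<Rightarrow> (nat \<Rightarrow> nat set) \<Rightarrow> nat \<Rightarrow> nat set set \<times> nat set"
where
  "node_input E \<Psi> v = (incident_edges E v, \<Psi> v)"

end

theory Submission
  imports Defs "HOL-Library.FuncSet"
begin

text \<open>
  Let \<open>m\<close> be the integer part of the sixth root of \<open>\<Delta>\<close>. The nodes that are still to be colored are
  randomly split into \<open>m\<^sup>3\<close> bins and a leftover set that each node joins with probability \<open>1 / m\<close>,
  and the colors are split into \<open>m\<^sup>3\<close> bins as well. A node keeps the colors of its own bin. Since the
  leftover set makes the bins of nodes smaller by the factor \<open>1 - 1 / m\<close>, the number of colors of
  a node still exceeds its degree in its bin, except for a few bad nodes. A bin has about
  \<open>n / m\<^sup>3\<close> nodes of degree at most about \<open>\<Delta> / m\<^sup>3\<close>, so that it has \<open>O(n)\<close> edges and can be collected and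
  colored by a single node. The leftover set has about \<open>n / m\<close> nodes and degrees about \<open>\<Delta> / m\<close>. It
  is treated in the same way with \<open>m\<^sup>2\<close> and then with \<open>m\<close> bins, after which it has \<open>O(n)\<close>
  edges. The bad nodes have \<open>O(n)\<close> incident edges in total and are colored at the very end, as are all
  nodes if \<open>\<Delta>\<close> is bounded.

  As local computation is unbounded, the random choices can be replaced by a search in a family
  of \<open>n\<^sup>4\<close> partitions, whose existence is shown by the probabilistic method: a node is bad
  for few members of the family, whatever its neighborhood and palette are. The best member
  is found by averaging over its four digits in base \<open>n\<close>.
\<close>

section \<open>Computations with a constant number of rounds\<close>

text \<open>The sixth root balances two demands. A bin has O(n) edges only if \<open>m ^ 6\<close>
  is at least of order \<Delta>. But the leftover set gives a bin a surplus of colors that is only a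
  fraction \<open>1 / m\<close> of the expected degree \<open>\<Delta> / m ^ 3\<close>, so
  deviations of order \<open>\<Delta> / m ^ 4\<close> must be excluded. The exponent of their
  Chernoff bound is of order \<open>\<Delta> / m ^ 5\<close>, which is at least \<open>m\<close>
  when \<open>m ^ 6 \<le> \<Delta>\<close>. Hence a node is bad with probability exponentially small
  in \<open>m\<close>, less than \<open>1 / (\<Delta> + 1)\<close> once \<open>m\<close> exceeds a
  constant, and this is what leaves the bad nodes with O(n) edges. Postponing a node does no harm:
  an uncolored neighbor has used up no color, so the residual palette always exceeds the number of
  uncolored neighbors. The obstacle to derandomization is that neighborhoods and palettes are known
  only locally. The family must therefore be fixed from common data and serve all possible pairs of
  a neighborhood and a palette at once. There are \<open>2 ^ O(n log n)\<close> of them, and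
  \<open>n ^ 4\<close> samples are enough for a union bound.\<close>

lemma length_history [simp]: "length (history A n inp r v) = r"
  by (induction r arbitrary: v) auto

lemma injection_into_bitstrings:
  assumes "finite S" "card S \<le> 2 ^ k"
  shows "\<exists>f :: 'a \<Rightarrow> bool list. inj_on f S \<and> (\<forall>x\<in>S. length (f x) = k)"
proof -
  let ?B = "{xs :: bool list. set xs \<subseteq> UNIV \<and> length xs = k}"
  have "card S \<le> card ?B" "finite ?B"
    using assms(2) card_lists_length_eq[of "UNIV :: bool set" k] finite_lists_length_eq[of "UNIV :: bool set" k] by auto
  then obtain f where "f ` S \<subseteq> ?B" "inj_on f S"
    using card_le_inj[of S ?B] assms(1) by blast
  then show ?thesis by (intro exI[of _ f]) auto
qed

lemma two_le_power_floorlog: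
  assumes "n \<ge> 1"
  shows "(2::nat) \<le> 2 ^ floorlog 2 n"
proof -
  have "floorlog 2 n \<noteq> 0" using assms by (simp add: floorlog_eq_zero_iff)
  then show ?thesis using self_le_power[of "2::nat" "floorlog 2 n"] by simp
qed

lemma exists_le_average:
  fixes f :: "'a \<Rightarrow> nat"
  assumes "finite A" "A \<noteq> {}"
  shows "\<exists>i\<in>A. card A * f i \<le> sum f A"
proof -
  obtain i where i: "i \<in> A" "\<And>i'. i' \<in> A \<Longrightarrow> f i \<le> f i'"
    using ex_min_if_finite[of "f ` A"] assms by (auto simp: not_less)
  then have "of_nat (card A) * f i \<le> sum f A" by (intro sum_bounded_below) auto
  then show ?thesis using i by auto
qed

locale cc_problem =
  fixes insts :: "'j set" and size :: "'j \<Rightarrow> nat" and inp :: "'j \<Rightarrow> nat \<Rightarrow> 'i"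
  assumes size_pos: "j \<in> insts \<Longrightarrow> 1 \<le> size j"
begin

text \<open>\<open>R\<close> and \<open>b\<close> are chosen before the instance, so
  \<open>knows\<close> hides both the constant number of rounds and the constant in O(log n) bits.
  It is closed under the operations below, each of which adds only a constant number of
  rounds.\<close>

definition knows :: "('j \<Rightarrow> nat \<Rightarrow> 'x) \<Rightarrow> bool" where
  "knows X \<longleftrightarrow> (\<exists>(A :: ('i, 'x) cc_algorithm) R b. \<forall>j\<in>insts.
     respects_bandwidth A (size j) (inp j) R b \<and>
     (\<forall>v<size j. cc_result A (size j) (inp j) R v = X j v))"

text \<open>As local computation is unbounded, a node can compute everything that is determined by what
  it knows, so locality is a functional dependency across the input instances.\<close>

definition local_from :: "('j \<Rightarrow> nat \<Rightarrow> 'x) \<Rightarrow> ('j \<Rightarrow> nat \<Rightarrow> 'y) \<Rightarrow> bool" where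
  "local_from X Y \<longleftrightarrow> (\<forall>j\<in>insts. \<forall>j'\<in>insts. \<forall>v<size j.
     size j = size j' \<longrightarrow> inp j v = inp j' v \<longrightarrow> X j v = X j' v \<longrightarrow> Y j v = Y j' v)"

lemma local_fromI:
  assumes "\<And>j j' v. j \<in> insts \<Longrightarrow> j' \<in> insts \<Longrightarrow> v < size j \<Longrightarrow> v < size j' \<Longrightarrow> size j = size j' \<Longrightarrow>
     inp j v = inp j' v \<Longrightarrow> X j v = X j' v \<Longrightarrow> Y j v = Y j' v"
  shows "local_from X Y"
  unfolding local_from_def by (intro ballI allI impI assms) simp_all

lemma local_fromD:
  assumes "local_from X Y" "j \<in> insts" "j' \<in> insts" "v < size j" "size j = size j'"
    "inp j v = inp j' v" "X j v = X j' v"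
  shows "Y j v = Y j' v"
  using assms unfolding local_from_def by blast

text \<open>Any instance that agrees with the local view of a node yields the right value, so the
  node may evaluate \<open>Y\<close> at an arbitrary one.\<close>

lemma local_from_function:
  assumes "local_from X Y"
  obtains f where "\<And>j v. j \<in> insts \<Longrightarrow> v < size j \<Longrightarrow> Y j v = f (size j) v (inp j v) (X j v)"
proof -
  define P where "P n v i x j \<longleftrightarrow> j \<in> insts \<and> v < size j \<and> size j = n \<and> inp j v = i \<and> X j v = x"
    for n v i x j
  define f where "f n v i x = Y (SOME j. P n v i x j) v" for n v i x
  have "Y j v = f (size j) v (inp j v) (X j v)" if "j \<in> insts" "v < size j" for j v
  proof -
    define j' where "j' = (SOME j'. P (size j) v (inp j v) (X j v) j')"
    have "P (size j) v (inp j v) (X j v) j" using that by (simp add: P_def)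
    then have "P (size j) v (inp j v) (X j v) j'"
      unfolding j'_def by (rule someI)
    then have "Y j v = Y j' v"
      using that by (intro local_fromD[OF assms]) (auto simp: P_def)
    then show ?thesis by (simp add: f_def j'_def)
  qed
  then show thesis by (rule that)
qed

lemma knows_trivial: "knows (\<lambda>j v. ())"
  unfolding knows_def respects_bandwidth_def by (intro exI[of _ undefined] exI[of _ 0]) simp

lemma knows_local:
  assumes "knows X" "local_from X Y"
  shows "knows Y"
proof -
  obtain f where f: "\<And>j v. j \<in> insts \<Longrightarrow> v < size j \<Longrightarrow> Y j v = f (size j) v (inp j v) (X j v)"
    using local_from_function[OF assms(2)] by blast
  obtain A :: "('i, 'a) cc_algorithm" and R b where A: "\<forall>j\<in>insts.
     respects_bandwidth A (size j) (inp j) R b \<and>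
     (\<forall>v<size j. cc_result A (size j) (inp j) R v = X j v)"
    using assms(1) unfolding knows_def by blast
  define A' where "A' = \<lparr>send_msg = send_msg A,
    final_output = (\<lambda>n v i H. f n v i (final_output A n v i H))\<rparr>"
  have "history A' n i r v = history A n i r v" for n i r v
    by (induction r arbitrary: v) (auto simp: A'_def)
  then have "\<forall>j\<in>insts. respects_bandwidth A' (size j) (inp j) R b \<and>
     (\<forall>v<size j. cc_result A' (size j) (inp j) R v = Y j v)"
    using A f unfolding respects_bandwidth_def cc_result_def by (auto simp: A'_def)
  then show ?thesis unfolding knows_def by blast
qed

lemma knows_localI:
  assumes "knows X"
    and "\<And>j v. j \<in> insts \<Longrightarrow> v < size j \<Longrightarrow> Y j v = f (size j) v (inp j v) (X j v)"
  shows "knows Y"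
  using assms(1) by (rule knows_local) (intro local_fromI, simp add: assms(2))

text \<open>A letter of an alphabet of size polynomial in \<open>n\<close> fits into O(log n) bits;
  one \<open>b\<close> has to serve all \<open>n\<close>.\<close>

definition small_sets :: "(nat \<Rightarrow> 'm set) \<Rightarrow> bool" where
  "small_sets S \<longleftrightarrow> (\<exists>b. \<forall>n\<ge>1. finite (S n) \<and> card (S n) \<le> 2 ^ (b * floorlog 2 n))"

text \<open>Messages are encoded as bit strings and decoded only here; later arguments may send
  elements of any small set. The value \<open>undefined\<close> outside the clique makes the
  received function depend on nothing but the messages.\<close>

lemma knows_round:
  fixes X :: "'j \<Rightarrow> nat \<Rightarrow> 'x" and m :: "'j \<Rightarrow> nat \<Rightarrow> nat \<Rightarrow> 'm"
  assumes X: "knows X" and m: "local_from X m" and S: "small_sets S"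
    and mS: "\<And>j u v. j \<in> insts \<Longrightarrow> u < size j \<Longrightarrow> v < size j \<Longrightarrow> m j u v \<in> S (size j)"
  shows "knows (\<lambda>j v. (X j v, \<lambda>u. if u < size j then m j u v else undefined))"
proof -
  obtain M where M: "\<And>j v. j \<in> insts \<Longrightarrow> v < size j \<Longrightarrow> m j v = M (size j) v (inp j v) (X j v)"
    using local_from_function[OF m] by blast
  obtain A :: "('i, 'x) cc_algorithm" and R b where A: "\<forall>j\<in>insts.
     respects_bandwidth A (size j) (inp j) R b \<and>
     (\<forall>v<size j. cc_result A (size j) (inp j) R v = X j v)"
    using X unfolding knows_def by blast
  obtain b' where b': "\<forall>n\<ge>1. finite (S n) \<and> card (S n) \<le> 2 ^ (b' * floorlog 2 n)"
    using S unfolding small_sets_def by blast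
  have "\<forall>n. \<exists>enc :: 'm \<Rightarrow> bool list. n \<ge> 1 \<longrightarrow>
      inj_on enc (S n) \<and> (\<forall>x\<in>S n. length (enc x) = b' * floorlog 2 n)"
  proof
    fix n
    show "\<exists>enc :: 'm \<Rightarrow> bool list. n \<ge> 1 \<longrightarrow>
      inj_on enc (S n) \<and> (\<forall>x\<in>S n. length (enc x) = b' * floorlog 2 n)"
    proof (cases "n \<ge> 1")
      case True
      then have "finite (S n)" "card (S n) \<le> 2 ^ (b' * floorlog 2 n)" using b' by auto
      from injection_into_bitstrings[OF this] show ?thesis by simp
    qed simp
  qed
  from choice[OF this] obtain enc :: "nat \<Rightarrow> 'm \<Rightarrow> bool list" where
      "\<forall>n. n \<ge> 1 \<longrightarrow> inj_on (enc n) (S n) \<and> (\<forall>x\<in>S n. length (enc n x) = b' * floorlog 2 n)" ..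
  then have enc: "\<And>n. n \<ge> 1 \<Longrightarrow> inj_on (enc n) (S n)"
      "\<And>n x. n \<ge> 1 \<Longrightarrow> x \<in> S n \<Longrightarrow> length (enc n x) = b' * floorlog 2 n"
    by simp_all
  \<comment> \<open>The first \<open>R\<close> rounds are those of \<open>A\<close>; in the last one
    a node has its full history and can compute \<open>X\<close>. The model delivers nothing from a
    node to itself, so in the case \<open>u = v\<close> the own message is recomputed.\<close>
  define A' where "A' = \<lparr>send_msg = (\<lambda>n v i H t. if length H < R then send_msg A n v i H t
        else enc n (M n v i (final_output A n v i H) t)),
    final_output = (\<lambda>n v i H. let x = final_output A n v i (take R H) in
       (x, \<lambda>u. if u < n then (if u = v then M n v i x v else the_inv_into (S n) (enc n) ((H ! R) u))
                else undefined))\<rparr>"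
  have h: "history A' n i r v = history A n i r v" if "r \<le> R" for n i r v
    using that by (induction r arbitrary: v) (auto simp: A'_def)
  have "respects_bandwidth A' (size j) (inp j) (Suc R) (max b b') \<and>
     (\<forall>v<size j. cc_result A' (size j) (inp j) (Suc R) v =
        (X j v, \<lambda>u. if u < size j then m j u v else undefined))" if j: "j \<in> insts" for j
  proof -
    let ?n = "size j"
    have out: "final_output A ?n v (inp j v) (history A ?n (inp j) R v) = X j v" if "v < ?n" for v
      using A j that unfolding cc_result_def by blast
    have last: "send_msg A' ?n u (inp j u) (history A' ?n (inp j) R u) v = enc ?n (m j u v)"
      if "u < ?n" for u v
      using that out[OF that] h[of R ?n "inp j" u] M[OF j that] by (simp add: A'_def)
    have bound: "length (send_msg A' ?n u (inp j u) (history A' ?n (inp j) r u) v) \<le> max b b' * floorlog 2 ?n"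
      if "r < Suc R" "u < ?n" "v < ?n" "u \<noteq> v" for r u v
    proof (cases "r = R")
      case True
      then show ?thesis
        using last[of u v] that enc(2)[of ?n "m j u v"] mS[OF j] by (simp add: mult_right_mono)
    next
      case False
      then have "r < R" using that by simp
      then have "length (send_msg A' ?n u (inp j u) (history A' ?n (inp j) r u) v) \<le> b * floorlog 2 ?n"
        using A j that h[of r ?n "inp j" u] unfolding respects_bandwidth_def by (simp add: A'_def)
      also have "\<dots> \<le> max b b' * floorlog 2 ?n" by (simp add: mult_right_mono)
      finally show ?thesis .
    qed
    have "cc_result A' ?n (inp j) (Suc R) v =
        (X j v, \<lambda>u. if u < ?n then m j u v else undefined)" if v: "v < ?n" for v
    proof -
      define H where "H = history A' ?n (inp j) (Suc R) v"
      have "take R H = history A ?n (inp j) R v"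
        using h[of R ?n "inp j" v] by (simp add: H_def)
      moreover have "(H ! R) u = enc ?n (m j u v)" if "u < ?n" "u \<noteq> v" for u
        using that last[of u v] by (simp add: H_def nth_append)
      moreover have "the_inv_into (S ?n) (enc ?n) (enc ?n (m j u v)) = m j u v" if "u < ?n" for u
        using the_inv_into_f_f[OF enc(1)[of ?n] mS[OF j that v]] v by simp
      ultimately show ?thesis
        using out[OF v] M[OF j v] unfolding cc_result_def H_def[symmetric]
        by (auto simp: A'_def Let_def fun_eq_iff)
    qed
    then show ?thesis using bound unfolding respects_bandwidth_def by blast
  qed
  then show ?thesis unfolding knows_def by blast
qed

section \<open>Alphabets of polynomial size\<close>

lemma small_setsI:
  assumes "\<And>n. n \<ge> 1 \<Longrightarrow> finite (S n)" "\<And>n. n \<ge> 1 \<Longrightarrow> card (S n) \<le> 2 ^ (b * floorlog 2 n)"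
  shows "small_sets S"
  using assms unfolding small_sets_def by blast

lemma small_sets_atMost: "small_sets (\<lambda>n. {..C * n ^ k})"
proof (rule small_setsI)
  fix n :: nat assume n: "n \<ge> 1"
  have "n < 2 ^ floorlog 2 n" using floorlog_bounds[of n 2] n by simp
  then have "n ^ k \<le> 2 ^ (k * floorlog 2 n)"
    by (metis less_imp_le power_mono le0 power_mult mult.commute)
  \<comment> \<open>A constant factor is absorbed into the exponent, because
    \<open>floorlog 2 n\<close> is at least 1 also for \<open>n = 1\<close>.\<close>
  moreover have "Suc C \<le> 2 ^ (C * floorlog 2 n)"
  proof -
    have "Suc C \<le> 2 ^ C" by (simp add: Suc_leI)
    also have "\<dots> \<le> 2 ^ (C * floorlog 2 n)"
      using n floorlog_eq_zero_iff[of 2 n] by (intro power_increasing) (auto simp: Suc_le_eq)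
    finally show ?thesis .
  qed
  moreover have "Suc (C * n ^ k) \<le> Suc C * n ^ k" using n by simp
  ultimately have "Suc (C * n ^ k) \<le> 2 ^ (C * floorlog 2 n) * 2 ^ (k * floorlog 2 n)"
    by (meson le_trans mult_le_mono)
  then show "card {..C * n ^ k} \<le> 2 ^ ((C + k) * floorlog 2 n)"
    by (simp add: power_add algebra_simps)
qed simp

lemma small_sets_subset:
  assumes "small_sets S" "\<And>n. n \<ge> 1 \<Longrightarrow> S' n \<subseteq> S n"
  shows "small_sets S'"
proof -
  obtain b where b: "\<forall>n\<ge>1. finite (S n) \<and> card (S n) \<le> 2 ^ (b * floorlog 2 n)"
    using assms(1) unfolding small_sets_def by blast
  show ?thesis
  proof (rule small_setsI)
    fix n :: nat assume n: "n \<ge> 1"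
    show "finite (S' n)" using b n assms(2) finite_subset by blast
    show "card (S' n) \<le> 2 ^ (b * floorlog 2 n)"
      using b n assms(2) by (meson card_mono le_trans)
  qed
qed

text \<open>A batch of at most \<open>C\<close> words, with \<open>None\<close> for a free slot, is
  still a single message of O(log n) bits. This is the alphabet in which
  \<open>knows_collect\<close> routes.\<close>

lemma small_sets_option_functions:
  assumes "small_sets S"
  shows "small_sets (\<lambda>n. {..<C::nat} \<rightarrow>\<^sub>E insert None (Some ` S n))"
proof -
  obtain b where b: "\<forall>n\<ge>1. finite (S n) \<and> card (S n) \<le> 2 ^ (b * floorlog 2 n)"
    using assms unfolding small_sets_def by blast
  show ?thesis
  proof (rule small_setsI)
    fix n :: nat assume n: "n \<ge> 1"
    then have fin: "finite (S n)" using b by blast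
    then show "finite ({..<C} \<rightarrow>\<^sub>E insert None (Some ` S n))" by (intro finite_PiE) auto
    have "card (insert None (Some ` S n)) = Suc (card (S n))"
      using fin by (subst card_insert_disjoint) (auto simp: card_image)
    also have "\<dots> \<le> 2 ^ (b * floorlog 2 n) + 2 ^ (b * floorlog 2 n)"
      using b n by (metis Suc_eq_plus1 add_mono one_le_numeral one_le_power)
    also have "\<dots> = 2 * 2 ^ (b * floorlog 2 n)" by simp
    also have "\<dots> \<le> 2 ^ floorlog 2 n * 2 ^ (b * floorlog 2 n)"
      using two_le_power_floorlog[OF n] by simp
    also have "\<dots> = 2 ^ ((b + 1) * floorlog 2 n)" by (simp add: power_add)
    finally have "card (insert None (Some ` S n)) ^ C \<le> (2 ^ ((b + 1) * floorlog 2 n)) ^ C"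
      by (rule power_mono) simp
    then show "card ({..<C} \<rightarrow>\<^sub>E insert None (Some ` S n)) \<le> 2 ^ (((b + 1) * C) * floorlog 2 n)"
      by (simp add: card_PiE power_mult[symmetric] algebra_simps)
  qed
qed

lemma small_sets_Plus:
  assumes "small_sets S" "small_sets S'"
  shows "small_sets (\<lambda>n. Inl ` S n \<union> Inr ` S' n)"
proof -
  obtain b where b: "\<forall>n\<ge>1. finite (S n) \<and> card (S n) \<le> 2 ^ (b * floorlog 2 n)"
    using assms unfolding small_sets_def by blast
  obtain b' where b': "\<forall>n\<ge>1. finite (S' n) \<and> card (S' n) \<le> 2 ^ (b' * floorlog 2 n)"
    using assms unfolding small_sets_def by blast
  show ?thesis
  proof (rule small_setsI)
    fix n :: nat assume n: "n \<ge> 1"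
    show "finite (Inl ` S n \<union> Inr ` S' n)" using b b' n by blast
    let ?L = "floorlog 2 n"
    have "card (Inl ` S n \<union> Inr ` S' n) \<le> card (S n) + card (S' n)"
      by (metis Plus_def card_Plus b b' n order_refl)
    also have "\<dots> \<le> 2 ^ (b * ?L) + 2 ^ (b' * ?L)" using b b' n by (intro add_mono) auto
    also have "\<dots> \<le> 2 ^ ((b + b') * ?L) + 2 ^ ((b + b') * ?L)"
      by (intro add_mono power_increasing) auto
    also have "\<dots> = 2 * 2 ^ ((b + b') * ?L)" by simp
    also have "\<dots> \<le> 2 ^ ?L * 2 ^ ((b + b') * ?L)"
      using two_le_power_floorlog[OF n] by simp
    also have "\<dots> = 2 ^ ((b + b' + 1) * ?L)" by (simp add: power_add)
    finally show "card (Inl ` S n \<union> Inr ` S' n) \<le> 2 ^ ((b + b' + 1) * ?L)" .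
  qed
qed

section \<open>Common knowledge and communication through leaders\<close>

abbreviation common :: "('j \<Rightarrow> 'g) \<Rightarrow> bool" where
  "common G \<equiv> knows (\<lambda>j v. G j)"

definition common_from :: "('j \<Rightarrow> 'g) \<Rightarrow> ('j \<Rightarrow> 'h) \<Rightarrow> bool" where
  "common_from G H \<longleftrightarrow>
     (\<forall>j\<in>insts. \<forall>j'\<in>insts. size j = size j' \<longrightarrow> G j = G j' \<longrightarrow> H j = H j')"

lemma common_fromI:
  assumes "\<And>j j'. j \<in> insts \<Longrightarrow> j' \<in> insts \<Longrightarrow> size j = size j' \<Longrightarrow> G j = G j' \<Longrightarrow> H j = H j'"
  shows "common_from G H"
  unfolding common_from_def by (intro ballI impI assms)

lemma common_fromD:
  assumes "common_from G H" "j \<in> insts" "j' \<in> insts" "size j = size j'" "G j = G j'"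
  shows "H j = H j'"
  using assms unfolding common_from_def by blast

lemma common_map:
  assumes "common G" "common_from G H"
  shows "common H"
  using assms(1) by (rule knows_local) (auto intro!: local_fromI intro: common_fromD[OF assms(2)])

lemma knows_broadcast:
  assumes X: "knows X" and x: "local_from X x" and S: "small_sets S"
    and xS: "\<And>j v. j \<in> insts \<Longrightarrow> v < size j \<Longrightarrow> x j v \<in> S (size j)"
  shows "knows (\<lambda>j v. (X j v, restrict (x j) {..<size j}))"
proof -
  have "knows (\<lambda>j v. (X j v, \<lambda>u. if u < size j then x j u else undefined))"
    by (rule knows_round[OF X _ S])
      (auto intro!: local_fromI xS intro: local_fromD[OF x])
  then show ?thesis by (simp add: restrict_def)
qed

text \<open>Two rounds suffice for \<open>size j\<close> sums at once: node \<open>i\<close>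
  receives all summands with index \<open>i\<close>, adds them up and broadcasts the result. The
  polynomial bound keeps summands and sums within O(log n) bits.\<close>

lemma common_sum:
  fixes a :: "'j \<Rightarrow> nat \<Rightarrow> nat \<Rightarrow> nat"
  assumes G: "common G" and a: "local_from (\<lambda>j v. G j) a"
    and bound: "\<And>j v i. j \<in> insts \<Longrightarrow> v < size j \<Longrightarrow> i < size j \<Longrightarrow> a j v i \<le> size j ^ k"
  shows "common (\<lambda>j. (G j, \<lambda>i\<in>{..<size j}. \<Sum>v<size j. a j v i))"
proof -
  have "knows (\<lambda>j v. (G j, \<lambda>u. if u < size j then a j u v else undefined))"
    by (rule knows_round[OF G a small_sets_atMost[of 1 k]]) (simp add: bound)
  then have "knows (\<lambda>j v. ((G j, \<lambda>u. if u < size j then a j u v else undefined),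
      restrict (\<lambda>i. \<Sum>u<size j. a j u i) {..<size j}))"
  proof (rule knows_broadcast[OF _ _ small_sets_atMost[of 1 "Suc k"]])
    show "local_from (\<lambda>j v. (G j, \<lambda>u. if u < size j then a j u v else undefined))
        (\<lambda>j i. \<Sum>u<size j. a j u i)"
    proof (rule local_fromI)
      fix j j' v
      assume *: "size j = size j'" "(G j, \<lambda>u. if u < size j then a j u v else undefined) =
        (G j', \<lambda>u. if u < size j' then a j' u v else undefined)"
      then have "a j u v = a j' u v" if "u < size j'" for u
        using that by (auto dest: fun_cong[of _ _ u])
      then show "(\<Sum>u<size j. a j u v) = (\<Sum>u<size j'. a j' u v)" using *(1) by simp
    qed
    fix j i assume "j \<in> insts" "i < size j"
    then have "(\<Sum>u<size j. a j u i) \<le> of_nat (card {..<size j}) * size j ^ k"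
      by (intro sum_bounded_above) (simp add: bound)
    then show "(\<Sum>u<size j. a j u i) \<in> {..1 * size j ^ Suc k}" by simp
  qed
  then show ?thesis by (rule knows_localI[where f = "\<lambda>n v i x. (fst (fst x), snd x)"]) simp
qed

text \<open>The index is found digit by digit in base \<^term>\<open>size j\<close>: node \<open>i\<close> adds up the costs of all
  indices that continue the current prefix with the digit \<open>i\<close>.\<close>

lemma common_select:
  fixes a :: "'j \<Rightarrow> nat \<Rightarrow> nat \<Rightarrow> nat"
  assumes G: "common G" and a: "local_from (\<lambda>j v. G j) a"
    and bound: "\<And>j v i. j \<in> insts \<Longrightarrow> v < size j \<Longrightarrow> a j v i \<le> 1"
  obtains q where "common (\<lambda>j. (G j, q j))"
    "\<And>j. j \<in> insts \<Longrightarrow> q j < size j ^ k"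
    "\<And>j. j \<in> insts \<Longrightarrow>
       size j ^ k * (\<Sum>v<size j. a j v (q j)) \<le> (\<Sum>r<size j ^ k. \<Sum>v<size j. a j v r)"
proof -
  \<comment> \<open>\<open>p\<close> is the prefix found so far and \<open>k\<close> the number of
    missing digits, so \<open>q\<close> is one of the \<open>size j ^ k\<close> numbers that start
    with \<open>p\<close>. The claim is that \<open>q\<close> costs no more than their
    average.\<close>
  let ?P = "\<lambda>k p q. \<forall>j\<in>insts. p j * size j ^ k \<le> q j \<and> q j < (p j + 1) * size j ^ k \<and>
      size j ^ k * (\<Sum>v<size j. a j v (q j)) \<le>
        (\<Sum>r = p j * size j ^ k..<(p j + 1) * size j ^ k. \<Sum>v<size j. a j v r)"
  have main: "\<exists>q. common (\<lambda>j. (G j, q j)) \<and> ?P k p q" if "common (\<lambda>j. (G j, p j))" for p k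
    using that
  proof (induction k arbitrary: p)
    case 0
    then show ?case by (intro exI[of _ p]) simp
  next
    case (Suc k)
    define s where "s j v i = (\<Sum>r = (p j * size j + i) * size j ^ k..<(p j * size j + i + 1) * size j ^ k.
       a j v r)" for j v i
    have "common (\<lambda>j. ((G j, p j), \<lambda>i\<in>{..<size j}. \<Sum>v<size j. s j v i))"
    proof (rule common_sum[OF Suc.prems, of _ k])
      show "local_from (\<lambda>j v. (G j, p j)) s"
      proof (rule local_fromI)
        fix j j' v
        assume "j \<in> insts" "j' \<in> insts" "v < size j" "size j = size j'" "inp j v = inp j' v"
          "(G j, p j) = (G j', p j')"
        then have "a j v = a j' v" "p j = p j'" "size j = size j'"
          by (auto intro: local_fromD[OF a])
        then show "s j v = s j' v" by (simp add: s_def fun_eq_iff)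
      qed
      fix j v i assume "j \<in> insts" "v < size j" "i < size j"
      then have "s j v i \<le> of_nat (card {(p j * size j + i) * size j ^ k..<(p j * size j + i + 1) * size j ^ k}) * 1"
        unfolding s_def by (intro sum_bounded_above bound)
      then show "s j v i \<le> size j ^ k" by (simp add: algebra_simps)
    qed
    \<comment> \<open>\<open>SOME\<close> is applied to sums known to everybody, hence all nodes
      agree on the next digit.\<close>
    moreover define d where "d j = (SOME i. i < size j \<and>
        size j * (\<lambda>i\<in>{..<size j}. \<Sum>v<size j. s j v i) i \<le>
        sum (\<lambda>i\<in>{..<size j}. \<Sum>v<size j. s j v i) {..<size j})" for j
    ultimately have "common (\<lambda>j. (G j, p j * size j + d j))"
      by (elim common_map) (rule common_fromI, simp add: d_def)
    from Suc.IH[OF this] obtain q where q: "common (\<lambda>j. (G j, q j))"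
      "?P k (\<lambda>j. p j * size j + d j) q" by blast
    have "?P (Suc k) p q"
    proof
      fix j assume j: "j \<in> insts"
      let ?n = "size j"
      have "\<exists>i. i < ?n \<and> ?n * (\<lambda>i\<in>{..<?n}. \<Sum>v<?n. s j v i) i \<le>
          sum (\<lambda>i\<in>{..<?n}. \<Sum>v<?n. s j v i) {..<?n}"
        using exists_le_average[of "{..<?n}" "\<lambda>i\<in>{..<?n}. \<Sum>v<?n. s j v i"] size_pos[OF j]
        by (auto simp: lessThan_empty_iff)
      then have d: "d j < ?n"
        "?n * (\<lambda>i\<in>{..<?n}. \<Sum>v<?n. s j v i) (d j) \<le> sum (\<lambda>i\<in>{..<?n}. \<Sum>v<?n. s j v i) {..<?n}"
        unfolding d_def by (rule someI2_ex, blast)+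
      have qj: "(p j * ?n + d j) * ?n ^ k \<le> q j" "q j < (p j * ?n + d j + 1) * ?n ^ k"
        "?n ^ k * (\<Sum>v<?n. a j v (q j)) \<le> (\<Sum>r = (p j * ?n + d j) * ?n ^ k..<(p j * ?n + d j + 1) * ?n ^ k. \<Sum>v<?n. a j v r)"
        using q(2) j by auto
      have "p j * ?n ^ Suc k \<le> q j"
        using qj(1) by (simp add: algebra_simps)
      moreover have "q j < (p j + 1) * ?n ^ Suc k"
      proof -
        have "(p j * ?n + d j + 1) * ?n ^ k \<le> ((p j + 1) * ?n) * ?n ^ k"
          using d(1) by (intro mult_right_mono) simp_all
        with qj(2) have "q j < ((p j + 1) * ?n) * ?n ^ k" by (rule less_le_trans)
        then show ?thesis by (simp only: power_Suc mult.assoc)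
      qed
      moreover have "?n ^ Suc k * (\<Sum>v<?n. a j v (q j)) \<le>
        (\<Sum>r = p j * ?n ^ Suc k..<(p j + 1) * ?n ^ Suc k. \<Sum>v<?n. a j v r)"
      proof -
        have swap: "(\<Sum>v<?n. s j v i) =
            (\<Sum>r = (p j * ?n + i) * ?n ^ k..<(p j * ?n + i + 1) * ?n ^ k. \<Sum>v<?n. a j v r)" for i
          unfolding s_def by (rule sum.swap)
        have "?n ^ Suc k * (\<Sum>v<?n. a j v (q j)) \<le> ?n * (\<Sum>v<?n. s j v (d j))"
          using mult_le_mono2[OF qj(3), of ?n] unfolding swap by (simp only: power_Suc mult.assoc)
        also have "\<dots> \<le> (\<Sum>i<?n. \<Sum>v<?n. s j v i)"
          using d by simp
        also have "\<dots> = (\<Sum>i<?n. \<Sum>r = i * ?n ^ k..<i * ?n ^ k + ?n ^ k. \<Sum>v<?n. a j v (r + p j * ?n ^ Suc k))"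
        proof (rule sum.cong[OF refl])
          fix i
          have "(\<Sum>v<?n. s j v i) = (\<Sum>r = (p j * ?n + i) * ?n ^ k..<(p j * ?n + i + 1) * ?n ^ k. \<Sum>v<?n. a j v r)"
            by (rule swap)
          also have "\<dots> = (\<Sum>r = i * ?n ^ k + p j * ?n ^ Suc k..<i * ?n ^ k + ?n ^ k + p j * ?n ^ Suc k. \<Sum>v<?n. a j v r)"
            by (simp add: algebra_simps)
          also have "\<dots> = (\<Sum>r = i * ?n ^ k..<i * ?n ^ k + ?n ^ k. \<Sum>v<?n. a j v (r + p j * ?n ^ Suc k))"
            by (rule sum.shift_bounds_nat_ivl)
          finally show "(\<Sum>v<?n. s j v i) = (\<Sum>r = i * ?n ^ k..<i * ?n ^ k + ?n ^ k. \<Sum>v<?n. a j v (r + p j * ?n ^ Suc k))" .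
        qed
        also have "\<dots> = (\<Sum>r<?n * ?n ^ k. \<Sum>v<?n. a j v (r + p j * ?n ^ Suc k))"
          by (rule sum.nat_group)
        also have "\<dots> = (\<Sum>r = 0 + p j * ?n ^ Suc k..<?n ^ Suc k + p j * ?n ^ Suc k. \<Sum>v<?n. a j v r)"
          by (subst sum.shift_bounds_nat_ivl) (simp add: lessThan_atLeast0)
        finally show ?thesis by (simp add: algebra_simps)
      qed
      ultimately show "p j * ?n ^ Suc k \<le> q j \<and> q j < (p j + 1) * ?n ^ Suc k \<and>
        ?n ^ Suc k * (\<Sum>v<?n. a j v (q j)) \<le>
        (\<Sum>r = p j * ?n ^ Suc k..<(p j + 1) * ?n ^ Suc k. \<Sum>v<?n. a j v r)" by blast
    qed
    with q(1) show ?case by blast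
  qed
  have "common (\<lambda>j. (G j, 0::nat))" using G by (rule common_map) (auto intro: common_fromI)
  from main[OF this, of k] obtain q where q: "common (\<lambda>j. (G j, q j))" "?P k (\<lambda>j. 0) q" by (elim exE conjE)
  have "q j < size j ^ k \<and>
       size j ^ k * (\<Sum>v<size j. a j v (q j)) \<le> (\<Sum>r<size j ^ k. \<Sum>v<size j. a j v r)"
    if "j \<in> insts" for j
    using bspec[OF q(2) that] by (simp add: lessThan_atLeast0)
  with q(1) show thesis by (intro that[of q]) simp_all
qed

text \<open>Publishes what the leaders have computed: in one round each leader tells every node its
  value, in the next one each node broadcasts the value received from its own leader.\<close>

lemma common_leader:
  assumes Z: "knows (\<lambda>j i. (G j, Z j i))" and y: "local_from (\<lambda>j i. (G j, Z j i)) y"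
    and S: "small_sets S"
    and yS: "\<And>j i v. j \<in> insts \<Longrightarrow> i < size j \<Longrightarrow> v < size j \<Longrightarrow> y j i v \<in> S (size j)"
    and l: "common_from G l" "\<And>j v. j \<in> insts \<Longrightarrow> v < size j \<Longrightarrow> l j v < size j"
  shows "common (\<lambda>j. (G j, \<lambda>v\<in>{..<size j}. y j (l j v) v))"
proof -
  have "knows (\<lambda>j v. ((G j, Z j v), \<lambda>i. if i < size j then y j i v else undefined))"
    by (rule knows_round[OF Z y S]) (simp add: yS)
  then have "knows (\<lambda>j v. (((G j, Z j v), \<lambda>i. if i < size j then y j i v else undefined),
      restrict (\<lambda>v. y j (l j v) v) {..<size j}))"
  proof (rule knows_broadcast[OF _ _ S])
    show "local_from (\<lambda>j v. ((G j, Z j v), \<lambda>i. if i < size j then y j i v else undefined))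
        (\<lambda>j v. y j (l j v) v)"
    proof (rule local_fromI)
      fix j j' v
      assume *: "j \<in> insts" "j' \<in> insts" "v < size j" "v < size j'" "size j = size j'"
        "((G j, Z j v), \<lambda>i. if i < size j then y j i v else undefined) =
         ((G j', Z j' v), \<lambda>i. if i < size j' then y j' i v else undefined)"
      then have "l j = l j'" by (auto intro: common_fromD[OF l(1)])
      moreover have "y j (l j v) v = y j' (l j v) v"
        using * l(2)[of j v] by (auto dest: fun_cong[of _ _ "l j v"])
      ultimately show "y j (l j v) v = y j' (l j' v) v" by simp
    qed
  qed (simp add: yS l(2))
  then show ?thesis by (rule knows_localI[where f = "\<lambda>n v i x. (fst (fst (fst x)), snd x)"]) simp
qed

text \<open>The words addressed to a leader are numbered consecutively, and the word with number \<open>p\<close>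
  travels through the node \<open>p div C\<close>. So no pair of nodes exchanges more than \<open>C\<close> words in
  either of the two rounds.\<close>

lemma knows_collect:
  fixes d :: "'j \<Rightarrow> nat \<Rightarrow> 'w list"
  assumes G: "common G" and d: "local_from (\<lambda>j v. G j) d" and S: "small_sets S"
    and dS: "\<And>j v. j \<in> insts \<Longrightarrow> v < size j \<Longrightarrow> set (d j v) \<subseteq> S (size j)"
    and l: "common_from G l" "\<And>j v. j \<in> insts \<Longrightarrow> v < size j \<Longrightarrow> l j v < size j"
    and C: "C > 0"
    and bound: "\<And>j i. j \<in> insts \<Longrightarrow> i < size j \<Longrightarrow>
      (\<Sum>v | v < size j \<and> l j v = i. length (d j v)) \<le> C * size j"
  shows "knows (\<lambda>j i. (G j, \<lambda>v. if v < size j \<and> l j v = i then d j v else []))"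
proof -
  define L where "L j = (\<lambda>v\<in>{..<size j}. length (d j v))" for j
  have len: "length (d j v) \<le> C * size j" if "j \<in> insts" "v < size j" for j v
  proof -
    have "(\<Sum>v\<in>{v}. length (d j v)) \<le> (\<Sum>u | u < size j \<and> l j u = l j v. length (d j u))"
      by (rule sum_mono2) (use that in auto)
    then show ?thesis using bound[OF that(1) l(2)[OF that]] by simp
  qed
  have GL: "common (\<lambda>j. (G j, L j))"
    unfolding L_def
  proof (rule knows_broadcast[OF G _ small_sets_atMost[of C 1]])
    show "local_from (\<lambda>j v. G j) (\<lambda>j v. length (d j v))"
      by (rule local_fromI) (metis local_fromD[OF d])
  qed (simp add: len)
  \<comment> \<open>Since all lengths have been broadcast, every node can compute this numbering by
    itself: the words for one leader are ordered by their senders.\<close>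
  define off where "off n l L v = (\<Sum>u | u < v \<and> l u = l v. L u)"
    for n :: nat and l :: "nat \<Rightarrow> nat" and L :: "nat \<Rightarrow> nat" and v
  define o' where "o' j v = off (size j) (l j) (L j) v" for j v
  define slot where "slot j v p = (if o' j v \<le> p \<and> p < o' j v + length (d j v)
    then Some (d j v ! (p - o' j v)) else None)" for j v p
  have o'_eq: "o' j = o' j'" if "j \<in> insts" "j' \<in> insts" "size j = size j'" "G j = G j'" "L j = L j'" for j j'
    unfolding o'_def that(3,5) common_fromD[OF l(1) that(1-4)] ..
  have interval: "o' j v + length (d j v) \<le> (\<Sum>u | u < v' \<and> l j u = l j v. length (d j u))"
    if "j \<in> insts" "v < v'" "v' \<le> size j" for j v v'
  proof -
    have "o' j v = (\<Sum>u | u < v \<and> l j u = l j v. length (d j u))"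
      unfolding o'_def off_def by (intro sum.cong) (use that in \<open>auto simp: L_def\<close>)
    then have "o' j v + length (d j v) =
        (\<Sum>u \<in> insert v {u. u < v \<and> l j u = l j v}. length (d j u))" by simp
    also have "\<dots> \<le> (\<Sum>u | u < v' \<and> l j u = l j v. length (d j u))"
      by (intro sum_mono2) (use that in auto)
    finally show ?thesis .
  qed
  have disjoint: "slot j v p = None" if "slot j u p \<noteq> None" "u < v" "l j u = l j v"
      "j \<in> insts" "v < size j" for j u v p
  proof -
    have "o' j v = (\<Sum>u | u < v \<and> l j u = l j v. length (d j u))"
      unfolding o'_def off_def by (intro sum.cong) (use that in \<open>auto simp: L_def\<close>)
    then have "o' j u + length (d j u) \<le> o' j v"
      using interval[of j u v] that by simp
    then show ?thesis using that(1) by (auto simp: slot_def split: if_splits)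
  qed
  have unique: "u = v" if "slot j u p \<noteq> None" "slot j v p \<noteq> None" "l j u = l j v"
      "j \<in> insts" "u < size j" "v < size j" for j u v p
    using disjoint[of j u p v] disjoint[of j v p u] that by (cases u v rule: linorder_cases) auto
  let ?T = "\<lambda>n. {..<C} \<rightarrow>\<^sub>E insert None (Some ` S n)"
  have T: "small_sets ?T" by (rule small_sets_option_functions[OF S])
  have slotS: "slot j v p \<in> insert None (Some ` S (size j))" if "j \<in> insts" "v < size j" for j v p
  proof (cases "o' j v \<le> p \<and> p < o' j v + length (d j v)")
    case True
    then have "d j v ! (p - o' j v) \<in> S (size j)" using dS[OF that] nth_mem by (metis less_diff_conv2 add.commute subsetD)
    then show ?thesis using True by (simp add: slot_def)
  next
    case False
    then have "slot j v p = None" unfolding slot_def by (rule if_not_P)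
    then show ?thesis by simp
  qed
  \<comment> \<open>A node addresses all its words to its one leader, and \<open>l\<close> is
    common, so the relay \<open>w\<close> needs no label to know where to forward a word.\<close>
  define m1 where "m1 j u w = (\<lambda>s\<in>{..<C}. slot j u (w * C + s))" for j u w
  have K1: "knows (\<lambda>j w. ((G j, L j), \<lambda>u. if u < size j then m1 j u w else undefined))"
  proof (rule knows_round[OF GL _ T])
    show "local_from (\<lambda>j v. (G j, L j)) m1"
    proof (rule local_fromI)
      fix j j' v
      assume *: "j \<in> insts" "j' \<in> insts" "v < size j" "v < size j'" "size j = size j'"
        "inp j v = inp j' v" "(G j, L j) = (G j', L j')"
      then have "o' j = o' j'" "d j v = d j' v" by (auto intro: o'_eq local_fromD[OF d])
      then show "m1 j v = m1 j' v" by (simp add: m1_def slot_def fun_eq_iff)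
    qed
  qed (use slotS in \<open>auto simp: m1_def\<close>)
  \<comment> \<open>By \<open>unique\<close>, at most one of the nodes led by \<open>i\<close>
    occupies the slot, so \<open>SOME\<close> has only one candidate.\<close>
  define m2 where "m2 j w i = (\<lambda>s\<in>{..<C}.
      if \<exists>u<size j. l j u = i \<and> m1 j u w s \<noteq> None
      then m1 j (SOME u. u < size j \<and> l j u = i \<and> m1 j u w s \<noteq> None) w s else None)" for j w i
  have "knows (\<lambda>j i. (((G j, L j), \<lambda>u. if u < size j then m1 j u i else undefined),
      \<lambda>w. if w < size j then m2 j w i else undefined))"
  proof (rule knows_round[OF K1 _ T])
    show "local_from (\<lambda>j w. ((G j, L j), \<lambda>u. if u < size j then m1 j u w else undefined)) m2"
    proof (rule local_fromI)
      fix j j' w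
      assume *: "j \<in> insts" "j' \<in> insts" "size j = size j'"
        "((G j, L j), \<lambda>u. if u < size j then m1 j u w else undefined) =
         ((G j', L j'), \<lambda>u. if u < size j' then m1 j' u w else undefined)"
      then have eq: "l j = l j'" "size j = size j'" by (auto intro: common_fromD[OF l(1)])
      have m: "m1 j u w = m1 j' u w" if "u < size j'" for u
        using * that by (auto dest: fun_cong[of _ _ u])
      have "(\<lambda>u. u < size j \<and> l j u = i \<and> m1 j u w s \<noteq> None) =
         (\<lambda>u. u < size j' \<and> l j' u = i \<and> m1 j' u w s \<noteq> None)" for i s
        using m eq by (auto simp: fun_eq_iff)
      then have some: "(\<exists>u<size j. l j u = i \<and> m1 j u w s \<noteq> None) = (\<exists>u<size j'. l j' u = i \<and> m1 j' u w s \<noteq> None)"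
        "(SOME u. u < size j \<and> l j u = i \<and> m1 j u w s \<noteq> None) =
         (SOME u. u < size j' \<and> l j' u = i \<and> m1 j' u w s \<noteq> None)" for i s
        by metis+
      show "m2 j w = m2 j' w"
      proof (intro ext)
        fix i s
        show "m2 j w i s = m2 j' w i s"
        proof (cases "s < C \<and> (\<exists>u<size j'. l j' u = i \<and> m1 j' u w s \<noteq> None)")
          case True
          then have "(SOME u. u < size j' \<and> l j' u = i \<and> m1 j' u w s \<noteq> None) < size j'"
            by (metis (mono_tags, lifting) someI_ex)
          with True show ?thesis unfolding m2_def some using m by simp
        next
          case False
          then show ?thesis unfolding m2_def some by auto
        qed
      qed
    qed
    fix j w i assume j: "j \<in> insts"
    have "m2 j w i s \<in> insert None (Some ` S (size j))" if "s < C" for s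
    proof (cases "\<exists>u<size j. l j u = i \<and> m1 j u w s \<noteq> None")
      case True
      then have "(SOME u. u < size j \<and> l j u = i \<and> m1 j u w s \<noteq> None) < size j"
        by (metis (mono_tags, lifting) someI_ex)
      then show ?thesis using True that slotS[OF j] by (simp add: m2_def m1_def del: insert_iff)
    next
      case False
      then have "m2 j w i s = None" using that by (simp only: m2_def restrict_apply lessThan_iff if_False if_True)
      then show ?thesis by simp
    qed
    then show "m2 j w i \<in> ?T (size j)" by (auto simp: PiE_iff m2_def extensional_def)
  qed
  then show ?thesis
  proof (rule knows_local, intro local_fromI)
    fix j j' i
    assume *: "j \<in> insts" "j' \<in> insts" "i < size j" "size j = size j'"
      "(((G j, L j), \<lambda>u. if u < size j then m1 j u i else undefined),
          \<lambda>w. if w < size j then m2 j w i else undefined) =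
       (((G j', L j'), \<lambda>u. if u < size j' then m1 j' u i else undefined),
          \<lambda>w. if w < size j' then m2 j' w i else undefined)"
    then have l_eq: "l j = l j'" and o_eq: "o' j = o' j'"
      by (auto intro: common_fromD[OF l(1)] o'_eq)
    have m: "m2 j w i = m2 j' w i" if "w < size j" for w
      using * that by (auto dest: fun_cong[of _ _ w])
    have L: "length (d k v) = L k v" if "v < size k" for k v
      using that by (simp add: L_def)
    have word: "m2 k ((o' k v + r) div C) i ((o' k v + r) mod C) = Some (d k v ! r)"
      and less: "(o' k v + r) div C < size k"
      if "k \<in> insts" "v < size k" "l k v = i" "r < length (d k v)" for k v r
    proof -
      let ?p = "o' k v + r"
      have "o' k v + length (d k v) \<le> (\<Sum>u | u < size k \<and> l k u = l k v. length (d k u))"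
        using interval[of k v "size k"] that by simp
      \<comment> \<open>The bound on the load of a leader is what keeps the number of the relay
        below \<open>size k\<close>.\<close>
      then have "?p < size k * C"
        using that bound[OF that(1) l(2)[OF that(1,2)]] by (simp add: mult.commute)
      then show "?p div C < size k" by (rule less_mult_imp_div_less)
      have m1: "m1 k u (?p div C) (?p mod C) = slot k u ?p" for u
        using C by (simp add: m1_def)
      have slot: "slot k v ?p = Some (d k v ! r)" using that by (simp add: slot_def)
      have "(SOME u. u < size k \<and> l k u = i \<and> slot k u ?p \<noteq> None) = v"
        by (rule some_equality) (use that slot unique[of k _ ?p v] in auto)
      then show "m2 k (?p div C) i (?p mod C) = Some (d k v ! r)"
        using slot that C m1 by (auto simp: m2_def)
    qed
    have "d j v = d j' v" if v: "v < size j" "l j v = i" for v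
    proof (rule nth_equalityI)
      show len: "length (d j v) = length (d j' v)" using L[of v j] L[of v j'] v * by simp
      fix r assume r: "r < length (d j v)"
      show "d j v ! r = d j' v ! r"
        using word[of j v r] word[of j' v r] less[of j v r] m[of "(o' j v + r) div C"]
          v r * len l_eq o_eq by simp
    qed
    then show "(G j, \<lambda>v. if v < size j \<and> l j v = i then d j v else []) =
         (G j', \<lambda>v. if v < size j' \<and> l j' v = i then d j' v else [])"
      using * l_eq by (auto simp: fun_eq_iff)
  qed
qed

end

section \<open>Hash functions\<close>

text \<open>Draw the \<open>T\<close> members independently and let \<open>q = T / K\<close>. For a
  test that holds on at most a fraction \<open>1 / (4 * K)\<close> of \<Omega>, the expectation of 2
  to the number of hits is at most \<open>(1 + 1 / (4 * K)) ^ T \<le> exp (q / 4)\<close>. By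
  Markov's inequality more than \<open>q\<close> hits occur with probability at most
  \<open>exp (q / 4) / 2 powr q\<close>, which is at most \<open>2 powr (- q / 2)\<close> and so at
  most \<open>1 / 2 ^ \<tau>\<close>. A union bound over the fewer than \<open>2 ^ \<tau>\<close>
  tests leaves a good family.\<close>

lemma sparse_family:
  fixes \<Omega> :: "'o set" and \<T> :: "('o \<Rightarrow> bool) set"
  assumes \<Omega>: "finite \<Omega>" "\<Omega> \<noteq> {}" and \<T>: "finite \<T>" "card \<T> < 2 ^ \<tau>"
    and bad: "\<And>t. t \<in> \<T> \<Longrightarrow> 4 * K * card {\<omega>\<in>\<Omega>. t \<omega>} \<le> card \<Omega>"
    and K: "K > 0" and T: "2 * K * \<tau> \<le> T"
  shows "\<exists>F. (\<forall>r<T. F r \<in> \<Omega>) \<and> (\<forall>t\<in>\<T>. K * card {r. r < T \<and> t (F r)} \<le> T)"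
proof -
  let ?\<F> = "{..<T} \<rightarrow>\<^sub>E \<Omega>"
  have fin: "finite ?\<F>" using \<Omega> by (intro finite_PiE) auto
  define B where "B t = {F\<in>?\<F>. T < K * card {r. r < T \<and> t (F r)}}" for t
  have B: "real (card (B t)) * 2 ^ \<tau> \<le> real (card \<Omega>) ^ T" if t: "t \<in> \<T>" for t
  proof -
    define q where "q = real T / real K"
    have "real (card (B t)) * 2 powr q = (\<Sum>F\<in>B t. 2 powr q)" by simp
    also have "\<dots> \<le> (\<Sum>F\<in>B t. 2 ^ card {r. r < T \<and> t (F r)})"
    proof (rule sum_mono)
      fix F assume "F \<in> B t"
      then have "real T < real K * real (card {r. r < T \<and> t (F r)})"
        unfolding B_def by (metis (mono_tags, lifting) mem_Collect_eq of_nat_less_iff of_nat_mult)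
      then have "q \<le> real (card {r. r < T \<and> t (F r)})"
        using K by (simp add: q_def field_simps)
      then have "2 powr q \<le> (2::real) powr real (card {r. r < T \<and> t (F r)})"
        by simp
      then show "2 powr q \<le> (2::real) ^ card {r. r < T \<and> t (F r)}"
        by (simp add: powr_realpow)
    qed
    also have "\<dots> \<le> (\<Sum>F\<in>?\<F>. 2 ^ card {r. r < T \<and> t (F r)})"
      by (rule sum_mono2[OF fin]) (auto simp: B_def)
    also have "\<dots> = (\<Sum>F\<in>?\<F>. \<Prod>r<T. if t (F r) then 2 else (1::real))"
    proof (rule sum.cong[OF refl])
      fix F
      have "{r. r < T \<and> t (F r)} = {..<T} \<inter> {r. t (F r)}" by auto
      then show "(2::real) ^ card {r. r < T \<and> t (F r)} = (\<Prod>r<T. if t (F r) then 2 else 1)"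
        by (simp add: prod.If_cases)
    qed
    also have "\<dots> = (\<Prod>r<T. \<Sum>\<omega>\<in>\<Omega>. if t \<omega> then 2 else (1::real))"
      by (rule prod_sum_PiE[symmetric]) (use \<Omega> in auto)
    also have "\<dots> = (\<Sum>\<omega>\<in>\<Omega>. if t \<omega> then 2 else (1::real)) ^ T" by simp
    also have "(\<Sum>\<omega>\<in>\<Omega>. if t \<omega> then 2 else (1::real)) = card \<Omega> + card {\<omega>\<in>\<Omega>. t \<omega>}"
    proof -
      have "(\<Sum>\<omega>\<in>\<Omega>. if t \<omega> then 2 else (1::real)) = (\<Sum>\<omega>\<in>\<Omega>. 1 + (if t \<omega> then 1 else 0))"
        by (intro sum.cong) auto
      also have "\<dots> = card \<Omega> + card {\<omega>\<in>\<Omega>. t \<omega>}"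
        using \<Omega>(1) by (simp add: sum.distrib sum.If_cases Int_def)
      finally show ?thesis .
    qed
    also have "real (card \<Omega> + card {\<omega>\<in>\<Omega>. t \<omega>}) ^ T \<le> (card \<Omega> * exp (1 / (4 * real K))) ^ T"
    proof (rule power_mono)
      have "real (4 * K * card {\<omega>\<in>\<Omega>. t \<omega>}) \<le> card \<Omega>"
        using bad[OF t] of_nat_le_iff by blast
      then have "card {\<omega>\<in>\<Omega>. t \<omega>} \<le> card \<Omega> * (1 / (4 * real K))"
        using K by (simp add: field_simps)
      then have "card \<Omega> + card {\<omega>\<in>\<Omega>. t \<omega>} \<le> card \<Omega> * (1 + 1 / (4 * real K))"
        by (simp add: algebra_simps)
      also have "\<dots> \<le> card \<Omega> * exp (1 / (4 * real K))"
        using exp_ge_add_one_self[of "1 / (4 * real K)"] by (intro mult_left_mono) auto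
      finally show "real (card \<Omega> + card {\<omega>\<in>\<Omega>. t \<omega>}) \<le> card \<Omega> * exp (1 / (4 * real K))" .
    qed simp
    also have "\<dots> = real (card \<Omega>) ^ T * exp (q / 4)"
      by (simp add: power_mult_distrib exp_of_nat_mult[symmetric] q_def)
    also have "\<dots> \<le> real (card \<Omega>) ^ T * 2 powr (q / 2)"
    proof (intro mult_left_mono)
      have "1 / 2 \<le> ln (2::real)" using ln_le_minus_one[of "1 / 2 :: real"] by (simp add: ln_div)
      then have "q / 4 \<le> q / 2 * ln 2"
        using mult_left_mono[of "1 / 2" "ln 2" "q / 2"] by (simp add: q_def)
      then show "exp (q / 4) \<le> 2 powr (q / 2)" by (simp add: powr_def)
    qed simp
    finally have "card (B t) * 2 powr q \<le> real (card \<Omega>) ^ T * 2 powr (q / 2)" .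
    then have "card (B t) * 2 powr (q / 2) * 2 powr (q / 2) \<le> real (card \<Omega>) ^ T * 2 powr (q / 2)"
      by (simp add: mult.assoc powr_add[symmetric])
    then have "card (B t) * 2 powr (q / 2) \<le> real (card \<Omega>) ^ T" by simp
    moreover have "2 ^ \<tau> \<le> (2::real) powr (q / 2)"
    proof -
      have "real (2 * K * \<tau>) \<le> real T" using T of_nat_le_iff by blast
      then have "real \<tau> \<le> q / 2" using K by (simp add: q_def field_simps)
      then have "(2::real) powr real \<tau> \<le> 2 powr (q / 2)" by simp
      then show ?thesis by (simp add: powr_realpow)
    qed
    then have "real (card (B t)) * 2 ^ \<tau> \<le> card (B t) * (2::real) powr (q / 2)"
      by (intro mult_left_mono) auto
    ultimately show ?thesis by simp
  qed
  have "real (card (\<Union>t\<in>\<T>. B t)) * 2 ^ \<tau> \<le> (\<Sum>t\<in>\<T>. real (card (B t))) * 2 ^ \<tau>"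
    using card_UN_le[OF \<T>(1), of B] by (intro mult_right_mono) (simp_all flip: of_nat_sum)
  also have "\<dots> \<le> (\<Sum>t\<in>\<T>. real (card \<Omega>) ^ T)"
    unfolding sum_distrib_right by (rule sum_mono) (use B in auto)
  also have "\<dots> = card \<T> * real (card \<Omega>) ^ T" by simp
  also have "\<dots> < 2 ^ \<tau> * real (card \<Omega>) ^ T"
  proof (rule mult_strict_right_mono)
    show "real (card \<T>) < 2 ^ \<tau>" using \<T>(2) by (metis of_nat_less_iff of_nat_numeral of_nat_power)
    show "0 < real (card \<Omega>) ^ T" using \<Omega> by (simp add: card_gt_0_iff)
  qed
  finally have "card (\<Union>t\<in>\<T>. B t) < card \<Omega> ^ T"
    by (simp add: mult.commute flip: of_nat_power)
  then have "card (\<Union>t\<in>\<T>. B t) < card ?\<F>" by (simp add: card_PiE)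
  moreover have "finite (\<Union>t\<in>\<T>. B t)"
    by (rule finite_subset[OF _ fin]) (auto simp: B_def)
  ultimately have "\<not> ?\<F> \<subseteq> (\<Union>t\<in>\<T>. B t)" using card_mono not_le by blast
  then obtain F where "F \<in> ?\<F>" "\<forall>t\<in>\<T>. F \<notin> B t" by blast
  then show ?thesis by (intro exI[of _ F]) (auto simp: B_def not_less simp del: Pi_I)
qed

section \<open>Chernoff bound for random functions\<close>

lemma exp_le_quadratic:
  fixes x :: real
  assumes "\<bar>x\<bar> \<le> 1"
  shows "exp x \<le> 1 + x + x\<^sup>2"
proof (cases "x \<ge> 0")
  case True
  then show ?thesis using exp_bound[of x] assms by simp
next
  case False
  \<comment> \<open>For negative \<open>x\<close> the estimate \<open>exp (- x) \<ge> 1 - x\<close>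
    reduces the claim to \<open>1 - x ^ 3 \<ge> 1\<close>.\<close>
  have "1 \<le> (1 + x + x\<^sup>2) * (1 - x)"
  proof -
    have "(1 + x + x\<^sup>2) * (1 - x) = 1 - x * x\<^sup>2" by (simp add: algebra_simps power2_eq_square)
    then show ?thesis using False by (simp add: mult_nonpos_nonneg)
  qed
  also have "\<dots> \<le> (1 + x + x\<^sup>2) * exp (- x)"
    using exp_ge_add_one_self[of "-x"] assms False
    by (intro mult_left_mono) (auto simp: abs_if)
  finally have "1 * exp x \<le> (1 + x + x\<^sup>2) * exp (- x) * exp x"
    by (intro mult_right_mono) auto
  then show ?thesis by (simp add: mult.assoc flip: exp_add)
qed

text \<open>The moment generating function of a binomial distribution, scaled by the number of
  functions: the values of a uniformly random function are independent and hit \<open>A\<close> with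
  probability \<open>card A / card W\<close>, so the sum of products factorizes.\<close>

lemma hash_moment:
  fixes x :: real
  assumes "finite D" "S \<subseteq> D" "finite W" "W \<noteq> {}" "A \<subseteq> W"
  shows "(\<Sum>h\<in>D \<rightarrow>\<^sub>E W. x ^ card {u\<in>S. h u \<in> A}) =
    real (card W) ^ card D * (1 + card A / card W * (x - 1)) ^ card S"
proof -
  have fin: "finite S" "finite A" using assms finite_subset by auto
  have "(\<Sum>h\<in>D \<rightarrow>\<^sub>E W. x ^ card {u\<in>S. h u \<in> A}) =
    (\<Sum>h\<in>D \<rightarrow>\<^sub>E W. \<Prod>u\<in>D. if u \<in> S \<and> h u \<in> A then x else 1)"
  proof (rule sum.cong[OF refl])
    fix h
    have "D \<inter> {u. u \<in> S \<and> h u \<in> A} = {u\<in>S. h u \<in> A}" using assms(2) by auto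
    then show "x ^ card {u\<in>S. h u \<in> A} = (\<Prod>u\<in>D. if u \<in> S \<and> h u \<in> A then x else 1)"
      using assms(1) by (simp add: prod.If_cases)
  qed
  also have "\<dots> = (\<Prod>u\<in>D. \<Sum>w\<in>W. if u \<in> S \<and> w \<in> A then x else 1)"
    by (rule prod_sum_PiE[symmetric]) (use assms in auto)
  also have "\<dots> = (\<Prod>u\<in>D. if u \<in> S then real (card W) + card A * (x - 1) else real (card W))"
  proof (rule prod.cong[OF refl])
    fix u
    have "(\<Sum>w\<in>W. if w \<in> A then x else 1) = (\<Sum>w\<in>W. 1 + (if w \<in> A then x - 1 else 0))"
      by (intro sum.cong) auto
    also have "\<dots> = card W + card A * (x - 1)"
      using assms(3,5) by (simp add: sum.distrib sum.If_cases Int_absorb1)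
    finally show "(\<Sum>w\<in>W. if u \<in> S \<and> w \<in> A then x else 1) =
        (if u \<in> S then real (card W) + card A * (x - 1) else real (card W))" by simp
  qed
  also have "\<dots> = (real (card W) + card A * (x - 1)) ^ card S * real (card W) ^ card (D - S)"
    using assms(1,2) by (simp add: prod.If_cases Int_absorb1 Diff_eq)
  also have "real (card W) + card A * (x - 1) = real (card W) * (1 + card A / card W * (x - 1))"
    using assms(3,4) by (simp add: field_simps)
  also have "(\<dots>) ^ card S * real (card W) ^ card (D - S) =
      real (card W) ^ card D * (1 + card A / card W * (x - 1)) ^ card S"
  proof -
    have "card D = card S + card (D - S)"
      using assms(1,2) by (metis card_Diff_subset card_mono fin(1) le_add_diff_inverse)
    then show ?thesis by (simp add: power_mult_distrib power_add)
  qed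
  finally show ?thesis .
qed

text \<open>Chernoff's bound for both tails; \<sigma> is the sign of the deviation. Only an upper
  bound \<open>M\<close> on the mean is asked for, since the sizes of neighborhoods and palettes are
  known only up to such bounds.\<close>

lemma hash_discrepancy:
  fixes t M \<mu> :: real
  assumes D: "finite D" "S \<subseteq> D" and W: "finite W" "W \<noteq> {}" "A \<subseteq> W"
    and \<mu>: "\<mu> = card S * (card A / card W)" "\<mu> \<le> M" and t: "0 < t" "t \<le> 2 * M"
  shows "card {h\<in>D \<rightarrow>\<^sub>E W. t \<le> \<bar>card {u\<in>S. h u \<in> A} - \<mu>\<bar>} \<le> 2 * exp (- t\<^sup>2 / (4 * M)) * card (D \<rightarrow>\<^sub>E W)"
proof -
  let ?H = "D \<rightarrow>\<^sub>E W" and ?X = "\<lambda>h. card {u\<in>S. h u \<in> A}"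
  have fin: "finite ?H" using D W by (intro finite_PiE) auto
  have cardH: "card ?H = card W ^ card D" using D by (simp add: card_PiE)
  have M: "M > 0" using t by linarith
  \<comment> \<open>This \<open>s\<close> minimizes \<open>M * s\<^sup>2 - s * t\<close>, with the
    value \<open>- t\<^sup>2 / (4 * M)\<close>. The hypothesis \<open>t \<le> 2 * M\<close> gives
    \<open>s \<le> 1\<close>, as \<open>exp_le_quadratic\<close> requires.\<close>
  define s where "s = t / (2 * M)"
  have s: "0 < s" "s \<le> 1" using M t by (auto simp: s_def)
  have tail: "card {h\<in>?H. t \<le> \<sigma> * (?X h - \<mu>)} \<le> exp (- t\<^sup>2 / (4 * M)) * card ?H"
    if \<sigma>: "\<bar>\<sigma>\<bar> = 1" for \<sigma> :: real
  proof -
    have p: "0 \<le> real (card A) / card W" "real (card A) / card W \<le> 1"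
      using card_mono[OF W(1,3)] W(1,2) by (auto simp: divide_le_eq_1)
    have "card {h\<in>?H. t \<le> \<sigma> * (?X h - \<mu>)} * exp (s * t) =
        (\<Sum>h\<in>{h\<in>?H. t \<le> \<sigma> * (?X h - \<mu>)}. exp (s * t))" by simp
    also have "\<dots> \<le> (\<Sum>h\<in>{h\<in>?H. t \<le> \<sigma> * (?X h - \<mu>)}. exp (\<sigma> * s) ^ ?X h * exp (- \<sigma> * s * \<mu>))"
    proof (rule sum_mono)
      fix h assume "h \<in> {h\<in>?H. t \<le> \<sigma> * (?X h - \<mu>)}"
      then have "s * t \<le> s * (\<sigma> * (?X h - \<mu>))" using s by (intro mult_left_mono) auto
      then have "exp (s * t) \<le> exp (?X h * (\<sigma> * s) + - \<sigma> * s * \<mu>)"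
        by (simp add: algebra_simps)
      then show "exp (s * t) \<le> exp (\<sigma> * s) ^ ?X h * exp (- \<sigma> * s * \<mu>)"
        by (simp only: exp_of_nat_mult exp_add)
    qed
    also have "\<dots> \<le> (\<Sum>h\<in>?H. exp (\<sigma> * s) ^ ?X h * exp (- \<sigma> * s * \<mu>))"
      by (rule sum_mono2[OF fin]) auto
    also have "\<dots> = card ?H * (1 + card A / card W * (exp (\<sigma> * s) - 1)) ^ card S * exp (- \<sigma> * s * \<mu>)"
      unfolding sum_distrib_right[symmetric] hash_moment[OF D W] cardH by simp
    also have "(1 + card A / card W * (exp (\<sigma> * s) - 1)) ^ card S \<le>
        exp (card A / card W * (\<sigma> * s + s\<^sup>2)) ^ card S"
    proof (rule power_mono)
      have "exp (\<sigma> * s) \<le> 1 + \<sigma> * s + (\<sigma> * s)\<^sup>2"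
        using \<sigma> s by (intro exp_le_quadratic) (simp add: abs_mult)
      moreover have "(\<sigma> * s)\<^sup>2 = s\<^sup>2"
        using \<sigma> by (metis power2_abs abs_mult mult_1)
      ultimately have "card A / card W * (exp (\<sigma> * s) - 1) \<le> card A / card W * (\<sigma> * s + s\<^sup>2)"
        using p by (intro mult_left_mono) auto
      then show "1 + card A / card W * (exp (\<sigma> * s) - 1) \<le> exp (card A / card W * (\<sigma> * s + s\<^sup>2))"
        using exp_ge_add_one_self[of "card A / card W * (\<sigma> * s + s\<^sup>2)"] by linarith
      have "0 \<le> card A / card W * exp (\<sigma> * s)" using p by (intro mult_nonneg_nonneg) auto
      then show "0 \<le> 1 + card A / card W * (exp (\<sigma> * s) - 1)" using p(2)
        unfolding right_diff_distrib by linarith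
    qed
    also have "exp (card A / card W * (\<sigma> * s + s\<^sup>2)) ^ card S = exp (\<mu> * (\<sigma> * s + s\<^sup>2))"
      by (simp add: exp_of_nat_mult[symmetric] \<mu>(1) mult.assoc)
    finally have "card {h\<in>?H. t \<le> \<sigma> * (?X h - \<mu>)} * exp (s * t) \<le>
        card ?H * exp (\<mu> * (\<sigma> * s + s\<^sup>2)) * exp (- \<sigma> * s * \<mu>)"
      by (simp add: mult_left_mono mult_right_mono)
    also have "\<dots> = card ?H * exp (\<mu> * s\<^sup>2)"
      by (simp add: mult.assoc exp_add[symmetric] algebra_simps)
    also have "\<dots> \<le> card ?H * exp (M * s\<^sup>2)"
      using \<mu>(2) by (intro mult_left_mono) (auto intro: mult_right_mono)
    finally have "card {h\<in>?H. t \<le> \<sigma> * (?X h - \<mu>)} \<le> card ?H * exp (M * s\<^sup>2) * exp (- (s * t))"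
      by (simp add: exp_minus field_simps)
    also have "\<dots> = card ?H * exp (- t\<^sup>2 / (4 * M))"
      using M by (simp add: mult.assoc exp_add[symmetric] s_def field_simps power2_eq_square)
    finally show ?thesis by (simp add: mult.commute)
  qed
  have "{h\<in>?H. t \<le> \<bar>?X h - \<mu>\<bar>} \<subseteq> {h\<in>?H. t \<le> 1 * (?X h - \<mu>)} \<union> {h\<in>?H. t \<le> - 1 * (?X h - \<mu>)}"
    by (auto simp: abs_if split: if_splits)
  then have "card {h\<in>?H. t \<le> \<bar>?X h - \<mu>\<bar>} \<le>
      card {h\<in>?H. t \<le> 1 * (?X h - \<mu>)} + card {h\<in>?H. t \<le> - 1 * (?X h - \<mu>)}"
    using fin by (intro order_trans[OF card_mono card_Un_le]) auto
  then show ?thesis using tail[of 1] tail[of "- 1"]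
    by (simp only: abs_one abs_minus_cancel) linarith
qed

section \<open>List coloring instances\<close>

lemma greedy_list_coloring:
  assumes "finite Y" "\<And>u v. u \<in> Y \<Longrightarrow> v \<in> Y \<Longrightarrow> u \<in> N v \<Longrightarrow> v \<in> N u" "\<And>v. v \<in> Y \<Longrightarrow> v \<notin> N v"
    "\<And>v. v \<in> Y \<Longrightarrow> card {u\<in>Y. u \<in> N v} < card (Q v)"
  shows "\<exists>f. \<forall>v\<in>Y. f v \<in> Q v \<and> (\<forall>u\<in>Y. u \<in> N v \<longrightarrow> f u \<noteq> f v)"
  using assms
proof (induction Y rule: finite_induct)
  case (insert x Y)
  have "\<exists>f. \<forall>v\<in>Y. f v \<in> Q v \<and> (\<forall>u\<in>Y. u \<in> N v \<longrightarrow> f u \<noteq> f v)"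
  proof (rule insert.IH)
    fix v assume "v \<in> Y"
    have "card {u\<in>Y. u \<in> N v} \<le> card {u\<in>insert x Y. u \<in> N v}"
      using insert.hyps(1) by (intro card_mono) auto
    then show "card {u\<in>Y. u \<in> N v} < card (Q v)"
      using insert.prems(3)[of v] \<open>v \<in> Y\<close> by simp
  qed (use insert.prems in auto)
  then obtain f where f: "\<forall>v\<in>Y. f v \<in> Q v \<and> (\<forall>u\<in>Y. u \<in> N v \<longrightarrow> f u \<noteq> f v)" ..
  let ?B = "{u\<in>Y. u \<in> N x}"
  have "{u\<in>insert x Y. u \<in> N x} = ?B" using insert.prems(2)[of x] by auto
  then have "card (f ` ?B) < card (Q x)"
    using insert.prems(3)[of x] card_image_le[of ?B f] insert.hyps(1) by simp
  then have "\<not> Q x \<subseteq> f ` ?B"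
    using card_mono[of "f ` ?B" "Q x"] insert.hyps(1) by auto
  then obtain a where a: "a \<in> Q x" "a \<notin> f ` ?B" by blast
  show ?case
  proof (intro exI[of _ "f(x := a)"] ballI conjI impI)
    fix v assume v: "v \<in> insert x Y"
    then show "(f(x := a)) v \<in> Q v" using f a by auto
    fix u assume u: "u \<in> insert x Y" "u \<in> N v"
    then have "v \<in> N u" "u \<noteq> v" using insert.prems(1,2) v by blast+
    then show "(f(x := a)) u \<noteq> (f(x := a)) v" using f a u v by auto
  qed
qed simp

text \<open>Serves two purposes: a leader needs only one color more than a node has neighbors in the
  bin, which bounds the number of words sent, and the random partition needs palettes that are not
  too large. The choice is made from \<open>s\<close> and \<open>P\<close> alone, so it is
  local.\<close>

definition trim :: "nat \<Rightarrow> 'a set \<Rightarrow> 'a set" where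
  "trim s P = (SOME P'. P' \<subseteq> P \<and> card P' = min s (card P))"

lemma trim: "trim s P \<subseteq> P" "card (trim s P) = min s (card P)"
proof -
  have "\<exists>P'. P' \<subseteq> P \<and> card P' = min s (card P)"
    using obtain_subset_with_card_n[of "min s (card P)" P] by auto
  then have "trim s P \<subseteq> P \<and> card (trim s P) = min s (card P)"
    unfolding trim_def by (rule someI_ex)
  then show "trim s P \<subseteq> P" "card (trim s P) = min s (card P)" by auto
qed

type_synonym coloring_instance = "nat \<times> nat set set \<times> (nat \<Rightarrow> nat set)"

locale list_coloring_problem =
  fixes c :: nat
begin

definition instances :: "coloring_instance set" where
  "instances = {(n, E, \<Psi>). 1 \<le> n \<and> delta_plus_one_instance c n E \<Psi>}"

definition nodes :: "coloring_instance \<Rightarrow> nat" where "nodes j = fst j"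
definition edges :: "coloring_instance \<Rightarrow> nat set set" where "edges j = fst (snd j)"
definition palette :: "coloring_instance \<Rightarrow> nat \<Rightarrow> nat set" where "palette j = snd (snd j)"
definition input :: "coloring_instance \<Rightarrow> nat \<Rightarrow> nat set set \<times> nat set" where
  "input j = node_input (edges j) (palette j)"
definition nbrs :: "coloring_instance \<Rightarrow> nat \<Rightarrow> nat set" where "nbrs j v = {u. {u, v} \<in> edges j}"
definition \<Delta> :: "coloring_instance \<Rightarrow> nat" where "\<Delta> j = max_degree {..<nodes j} (edges j)"
definition colors :: "nat \<Rightarrow> nat set" where "colors n = {..<2 ^ (c * floorlog 2 n)}"

sublocale cc_problem instances nodes input
  by unfold_locales (auto simp: instances_def nodes_def)

lemma instanceD:
  assumes "j \<in> instances"
  shows "1 \<le> nodes j" "delta_plus_one_instance c (nodes j) (edges j) (palette j)"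
    "simple_graph {..<nodes j} (edges j)"
  using assms unfolding instances_def nodes_def edges_def palette_def
  by (auto simp del: One_nat_def) (simp add: delta_plus_one_instance_def)

lemma palette:
  assumes "j \<in> instances" "v < nodes j"
  shows "card (palette j v) = \<Delta> j + 1" "palette j v \<subseteq> colors (nodes j)" "finite (palette j v)"
proof -
  have "\<forall>v<nodes j. card (palette j v) = \<Delta> j + 1 \<and> palette j v \<subseteq> colors (nodes j)"
    using instanceD(2)[OF assms(1)] unfolding delta_plus_one_instance_def \<Delta>_def colors_def by blast
  then show "card (palette j v) = \<Delta> j + 1" "palette j v \<subseteq> colors (nodes j)" using assms(2) by blast+
  then show "finite (palette j v)" by (intro card_ge_0_finite) simp
qed

lemma nbrs_commute: "u \<in> nbrs j v \<longleftrightarrow> v \<in> nbrs j u"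
  by (simp add: nbrs_def insert_commute)

lemma nbrs_subset: "nbrs j v \<subseteq> {..<nodes j} - {v}" if "j \<in> instances"
proof
  fix u assume "u \<in> nbrs j v"
  then have "{u, v} \<subseteq> {..<nodes j}" "card {u, v} = 2"
    using instanceD(3)[OF that] by (auto simp: simple_graph_def nbrs_def)
  then show "u \<in> {..<nodes j} - {v}" by (auto simp: card_insert_if split: if_splits)
qed

lemma nbrs_irrefl: "j \<in> instances \<Longrightarrow> v \<notin> nbrs j v"
  using nbrs_subset by blast

lemma finite_nbrs [intro]: "j \<in> instances \<Longrightarrow> finite (nbrs j v)"
  using nbrs_subset finite_subset by blast

lemma degree_eq: "degree (edges j) v = card (nbrs j v)" if j: "j \<in> instances"
proof -
  have "incident_edges (edges j) v = (\<lambda>u. {u, v}) ` nbrs j v"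
  proof
    show "incident_edges (edges j) v \<subseteq> (\<lambda>u. {u, v}) ` nbrs j v"
    proof
      fix e assume e: "e \<in> incident_edges (edges j) v"
      then have "card e = 2" "v \<in> e" "e \<in> edges j"
        using instanceD(3)[OF j] by (auto simp: incident_edges_def simple_graph_def)
      then obtain u where "e = {u, v}" by (auto simp: card_2_iff)
      then show "e \<in> (\<lambda>u. {u, v}) ` nbrs j v" using \<open>e \<in> edges j\<close> by (auto simp: nbrs_def)
    qed
  qed (auto simp: incident_edges_def nbrs_def)
  moreover have "inj_on (\<lambda>u. {u, v}) (nbrs j v)" by (auto simp: inj_on_def doubleton_eq_iff)
  ultimately show ?thesis by (simp add: degree_def card_image)
qed

lemma card_nbrs_le: "j \<in> instances \<Longrightarrow> v < nodes j \<Longrightarrow> card (nbrs j v) \<le> \<Delta> j"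
  unfolding \<Delta>_def max_degree_def by (subst degree_eq[symmetric]) auto

lemma \<Delta>_less: "\<Delta> j < nodes j" if j: "j \<in> instances"
proof -
  have "\<Delta> j \<in> degree (edges j) ` {..<nodes j}"
    unfolding \<Delta>_def max_degree_def using instanceD(1)[OF j] by (intro Max_in) (auto simp: lessThan_empty_iff)
  then obtain v where v: "v < nodes j" "\<Delta> j = card (nbrs j v)" using degree_eq[OF j] by auto
  have "card (nbrs j v) \<le> card ({..<nodes j} - {v})" using nbrs_subset[OF j] by (intro card_mono) auto
  then show ?thesis using v by simp
qed

lemma input_eqD:
  assumes "input j v = input j' v"
  shows "nbrs j v = nbrs j' v" "palette j v = palette j' v"
proof -
  have "nbrs j v = {u. {u, v} \<in> fst (input j v)}" for j
    by (auto simp: nbrs_def input_def node_input_def incident_edges_def)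
  then show "nbrs j v = nbrs j' v" using assms by simp
  have "palette j v = snd (input j v)" for j
    by (simp add: input_def node_input_def)
  then show "palette j v = palette j' v" using assms by simp
qed

lemma common_\<Delta>: "common \<Delta>"
  using knows_trivial
proof (rule knows_local, intro local_fromI)
  fix j j' v
  assume *: "j \<in> instances" "j' \<in> instances" "v < nodes j" "v < nodes j'" "input j v = input j' v"
  show "\<Delta> j = \<Delta> j'"
    using palette(1)[OF *(1,3)] palette(1)[OF *(2,4)] input_eqD(2)[OF *(5)] by simp
qed

lemma small_sets_colors: "small_sets colors"
  by (rule small_setsI[of _ c]) (auto simp: colors_def)

text \<open>All bins are colored in parallel; \<open>l\<close> maps a node to the leader of its bin.
  A node sends its leader its neighbors in the bin and one color more than their number, which gives
  the summand in \<open>bound\<close>. The greedy coloring of the leader settles conflicts within a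
  bin only; those between bins are left to the choice of \<open>P\<close>.\<close>

lemma color_step:
  assumes G: "common G" and X: "common_from G X" "\<And>j. j \<in> instances \<Longrightarrow> X j \<subseteq> {..<nodes j}"
    and l: "common_from G l" "\<And>j v. j \<in> instances \<Longrightarrow> v < nodes j \<Longrightarrow> l j v < nodes j"
    and P: "local_from (\<lambda>j v. G j) P" "\<And>j v. j \<in> instances \<Longrightarrow> v \<in> X j \<Longrightarrow> P j v \<subseteq> palette j v"
    and slack: "\<And>j v. j \<in> instances \<Longrightarrow> v \<in> X j \<Longrightarrow>
      card {u \<in> X j. u \<in> nbrs j v \<and> l j u = l j v} < card (P j v)"
    and C: "C > 0" and bound: "\<And>j i. j \<in> instances \<Longrightarrow> i < nodes j \<Longrightarrow>
      (\<Sum>v | v \<in> X j \<and> l j v = i. 2 * card {u \<in> X j. u \<in> nbrs j v \<and> l j u = l j v} + 1) \<le> C * nodes j"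
  obtains f where "common (\<lambda>j. (G j, f j))"
    "\<And>j v. j \<in> instances \<Longrightarrow> v \<in> X j \<Longrightarrow> f j v \<in> P j v"
    "\<And>j u v. j \<in> instances \<Longrightarrow> u \<in> X j \<Longrightarrow> v \<in> X j \<Longrightarrow> u \<in> nbrs j v \<Longrightarrow> l j u = l j v \<Longrightarrow> f j u \<noteq> f j v"
proof -
  define N where "N j v = {u \<in> X j. u \<in> nbrs j v \<and> l j u = l j v}" for j v
  define Q where "Q j v = trim (card (N j v) + 1) (P j v)" for j v
  have Q: "Q j v \<subseteq> P j v" "card (Q j v) = card (N j v) + 1" "finite (Q j v)"
    if "j \<in> instances" "v \<in> X j" for j v
  proof -
    show "Q j v \<subseteq> P j v" unfolding Q_def by (rule trim)
    show *: "card (Q j v) = card (N j v) + 1"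
      using slack[OF that] trim(2)[of "card (N j v) + 1" "P j v"] by (simp add: Q_def N_def)
    show "finite (Q j v)" using * by (intro card_ge_0_finite) simp
  qed
  have finN: "finite (N j v)" if "j \<in> instances" for j v
    using that by (auto simp: N_def intro: finite_subset[OF _ finite_nbrs])
  define d where "d j v = (if v \<in> X j then map Inl (sorted_list_of_set (N j v)) @
     map Inr (sorted_list_of_set (Q j v)) else [])" for j v
  have d_length: "length (d j v) = (if v \<in> X j then 2 * card (N j v) + 1 else 0)"
    if "j \<in> instances" for j v
    using Q[OF that] by (simp add: d_def)
  let ?S = "\<lambda>n. Inl ` {..<n} \<union> Inr ` colors n"
  define D where "D j i = (\<lambda>v. if v < nodes j \<and> l j v = i then d j v else [])" for j i
  have "knows (\<lambda>j i. (G j, D j i))"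
    unfolding D_def
  proof (rule knows_collect[OF G _ _ _ l C])
    show "local_from (\<lambda>j v. G j) d"
    proof (rule local_fromI)
      fix j j' v
      assume *: "j \<in> instances" "j' \<in> instances" "v < nodes j" "nodes j = nodes j'"
        "input j v = input j' v" "G j = G j'"
      have "X j = X j'" "l j = l j'"
        using common_fromD[OF X(1) *(1,2,4,6)] common_fromD[OF l(1) *(1,2,4,6)] by blast+
      moreover from this have "N j v = N j' v" using input_eqD(1)[OF *(5)] by (simp add: N_def)
      moreover have "P j v = P j' v" using * by (intro local_fromD[OF P(1)]) auto
      ultimately show "d j v = d j' v" by (simp add: d_def Q_def)
    qed
    show "small_sets ?S"
      by (intro small_sets_Plus small_sets_colors small_sets_subset[OF small_sets_atMost[of 1 1]]) auto
    fix j v assume j: "j \<in> instances"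
    show "set (d j v) \<subseteq> ?S (nodes j)" if "v < nodes j"
    proof (cases "v \<in> X j")
      case True
      have "N j v \<subseteq> {..<nodes j}" using X(2)[OF j] by (auto simp: N_def)
      moreover have "Q j v \<subseteq> colors (nodes j)"
        using Q(1)[OF j True] P(2)[OF j True] palette(2)[OF j that] by blast
      ultimately show ?thesis using finN[OF j, of v] Q(3)[OF j True] by (auto simp: d_def)
    qed (simp add: d_def)
    fix i assume i: "i < nodes j"
    have "(\<Sum>v | v < nodes j \<and> l j v = i. length (d j v)) =
        (\<Sum>v | v \<in> X j \<and> l j v = i. 2 * card {u \<in> X j. u \<in> nbrs j v \<and> l j u = l j v} + 1)"
      using X(2)[OF j] by (intro sum.mono_neutral_cong_right) (auto simp: d_length[OF j] N_def)
    then show "(\<Sum>v | v < nodes j \<and> l j v = i. length (d j v)) \<le> C * nodes j"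
      using bound[OF j i] by simp
  qed
  \<comment> \<open>Expressed through the words \<open>D\<close> that the leader has received, so
    that the leader can search for \<open>f\<close> without knowing the graph.\<close>
  define ok where "ok X l i D f \<longleftrightarrow> (\<forall>v\<in>X. l v = i \<longrightarrow> Inr (f v) \<in> set (D v) \<and>
      (\<forall>u. Inl u \<in> set (D v) \<longrightarrow> f u \<noteq> f v))"
    for X :: "nat set" and l :: "nat \<Rightarrow> nat" and i and D :: "nat \<Rightarrow> (nat + nat) list" and f
  \<comment> \<open>0 lies in \<open>colors n\<close> for every \<open>n\<close>, so the messages to
    nodes outside the bin are legal too.\<close>
  define y where "y j i = (\<lambda>v. if v \<in> X j \<and> l j v = i then (SOME f. ok (X j) (l j) i (D j i) f) v else 0)" for j i
  have y: "y j i v \<in> Q j v" "\<And>u. u \<in> N j v \<Longrightarrow> y j i u \<noteq> y j i v"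
    if j: "j \<in> instances" and v: "v \<in> X j" "l j v = i" for j i v
  proof -
    have D: "Inr a \<in> set (D j i v) \<longleftrightarrow> a \<in> Q j v" "Inl u \<in> set (D j i v) \<longleftrightarrow> u \<in> N j v"
      if "v \<in> X j" "l j v = i" for a u v
      using that X(2)[OF j] finN[OF j, of v] Q(3)[OF j, of v] by (auto simp: D_def d_def)
    have "\<exists>f. \<forall>v\<in>{v \<in> X j. l j v = i}. f v \<in> Q j v \<and> (\<forall>u\<in>{v \<in> X j. l j v = i}. u \<in> nbrs j v \<longrightarrow> f u \<noteq> f v)"
    proof (rule greedy_list_coloring)
      show "finite {v \<in> X j. l j v = i}" using X(2)[OF j] by (intro finite_subset[OF _ finite_lessThan[of "nodes j"]]) auto
      fix v assume v: "v \<in> {v \<in> X j. l j v = i}"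
      then have "{u \<in> {v \<in> X j. l j v = i}. u \<in> nbrs j v} = N j v" by (auto simp: N_def)
      then show "card {u \<in> {v \<in> X j. l j v = i}. u \<in> nbrs j v} < card (Q j v)"
        using Q(2)[OF j] v by simp
    qed (use nbrs_irrefl[OF j] nbrs_commute in auto)
    then obtain f where "\<forall>v\<in>{v \<in> X j. l j v = i}. f v \<in> Q j v \<and>
        (\<forall>u\<in>{v \<in> X j. l j v = i}. u \<in> nbrs j v \<longrightarrow> f u \<noteq> f v)" ..
    then have "ok (X j) (l j) i (D j i) f" by (auto simp: ok_def D) (auto simp: N_def)
    moreover define g where "g = (SOME f. ok (X j) (l j) i (D j i) f)"
    ultimately have "ok (X j) (l j) i (D j i) g"
      using someI[of "ok (X j) (l j) i (D j i)"] by simp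
    then have g: "Inr (g v) \<in> set (D j i v)" "\<And>u. Inl u \<in> set (D j i v) \<Longrightarrow> g u \<noteq> g v"
      using v unfolding ok_def by blast+
    have y: "y j i u = g u" if "u \<in> X j" "l j u = i" for u
      using that by (simp add: y_def g_def)
    show "y j i v \<in> Q j v" using g(1) D(1)[OF v] y[OF v] by simp
    fix u assume u: "u \<in> N j v"
    then have "y j i u = g u" using v by (intro y) (auto simp: N_def)
    then show "y j i u \<noteq> y j i v" using g(2)[of u] u D(2)[OF v] y[OF v] by simp
  qed
  have "common (\<lambda>j. (G j, \<lambda>v\<in>{..<nodes j}. y j (l j v) v))"
  proof (rule common_leader[OF \<open>knows (\<lambda>j i. (G j, D j i))\<close> _ small_sets_colors _ l])
    show "local_from (\<lambda>j i. (G j, D j i)) y"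
    proof (rule local_fromI)
      fix j j' i
      assume *: "j \<in> instances" "j' \<in> instances" "nodes j = nodes j'" "(G j, D j i) = (G j', D j' i)"
      then have "G j = G j'" by simp
      then have "X j = X j'" "l j = l j'" "D j i = D j' i"
        using common_fromD[OF X(1) *(1-3)] common_fromD[OF l(1) *(1-3)] *(4) by blast+
      then show "y j i = y j' i" by (simp only: y_def)
    qed
    fix j i v assume j: "j \<in> instances" "v < nodes j"
    show "y j i v \<in> colors (nodes j)"
    proof (cases "v \<in> X j \<and> l j v = i")
      case True
      then show ?thesis using y(1)[OF j(1), of v i] Q(1)[OF j(1), of v] P(2)[OF j(1), of v] palette(2)[OF j] by blast
    qed (auto simp: y_def colors_def)
  qed
  then show thesis
  proof (rule that)
    fix j v assume j: "j \<in> instances" "v \<in> X j"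
    then show "(\<lambda>v\<in>{..<nodes j}. y j (l j v) v) v \<in> P j v"
      using y(1)[OF j refl] Q(1)[OF j] X(2)[OF j(1)] by auto
    fix u assume "u \<in> X j" "u \<in> nbrs j v" "l j u = l j v"
    then show "(\<lambda>v\<in>{..<nodes j}. y j (l j v) v) u \<noteq> (\<lambda>v\<in>{..<nodes j}. y j (l j v) v) v"
      using y(2)[OF j refl, of u] X(2)[OF j(1)] j(2) by (auto simp: N_def)
  qed
qed

end

section \<open>Random partitions of nodes and colors\<close>

definition deviates :: "(nat \<Rightarrow> nat \<times> nat) \<Rightarrow> nat \<Rightarrow> nat set \<times> (nat \<times> nat) set \<times> real \<Rightarrow> bool" where
  "deviates h w = (\<lambda>(S, A, t). t \<le> \<bar>real (card {u \<in> S. h u \<in> A}) - card S * (card A / w)\<bar>)"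

text \<open>Used with \<open>d = n + q\<close>: the nodes are the numbers below \<open>n\<close>,
  and color \<open>x\<close> is represented by \<open>n + x\<close>. For a node the first component
  0, of probability \<open>1 / m\<close>, means leftover, and otherwise the second component is the
  bin. For a color only the second component counts.\<close>

definition hash_space :: "nat \<Rightarrow> nat \<Rightarrow> nat \<Rightarrow> (nat \<Rightarrow> nat \<times> nat) set" where
  "hash_space d m k = {..<d} \<rightarrow>\<^sub>E {..<m} \<times> {..<k}"

lemma finite_hash_space: "finite (hash_space d m k)"
  unfolding hash_space_def by (intro finite_PiE) auto

lemma deviates_rare:
  fixes \<kappa> M t :: real
  assumes "S \<subseteq> {..<d}" "A \<subseteq> {..<m} \<times> {..<k}" "m > 0" "k > 0"
    and "card S * (card A / (m * k)) \<le> M" "0 < t" "t \<le> 2 * M" "4 * M * \<kappa> \<le> t\<^sup>2"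
  shows "card {h \<in> hash_space d m k. deviates h (m * k) (S, A, t)} \<le> 2 * exp (- \<kappa>) * card (hash_space d m k)"
proof -
  let ?H = "hash_space d m k"
  have M: "M > 0" using assms by linarith
  have "card {h \<in> ?H. deviates h (m * k) (S, A, t)} \<le> 2 * exp (- t\<^sup>2 / (4 * M)) * card ?H"
    using hash_discrepancy[of "{..<d}" S "{..<m} \<times> {..<k}" A _ M t] assms
    by (simp add: hash_space_def deviates_def lessThan_empty_iff)
  also have "\<dots> \<le> 2 * exp (- \<kappa>) * card ?H"
    using M assms(8) by (intro mult_right_mono mult_left_mono) (auto simp: field_simps)
  finally show ?thesis .
qed

definition node_events :: "nat \<Rightarrow> nat \<Rightarrow> real \<Rightarrow> real \<Rightarrow> nat set \<Rightarrow> (nat set \<times> (nat \<times> nat) set \<times> real) set" where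
  "node_events m k t t' S = insert (S, {0} \<times> {..<k}, t) ((\<lambda>b. (S, {1..<m} \<times> {b}, t')) ` {..<k})"

definition color_events :: "nat \<Rightarrow> nat \<Rightarrow> nat \<Rightarrow> real \<Rightarrow> nat set \<Rightarrow> (nat set \<times> (nat \<times> nat) set \<times> real) set" where
  "color_events n m k t P = (\<lambda>b. ((+) n ` P, {..<m} \<times> {b}, t)) ` {..<k}"

text \<open>The tolerances for \<open>N\<close> and \<open>P\<close> are tuned to the lower bound
  \<open>d / (2 * m) ^ i\<close> that the stages maintain. The leftover part may lose half of its
  guaranteed share \<open>d / (2 ^ i * m ^ (i + 1))\<close>. A bin has an expected surplus of at
  least \<open>d / (2 ^ i * m ^ 4)\<close> colors, of which degrees and colors may each consume a
  quarter. For \<open>U\<close> the tolerance equals the bound on the mean, so sizes at most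
  double.\<close>

definition stage_events ::
  "nat \<Rightarrow> nat \<Rightarrow> nat \<Rightarrow> nat \<Rightarrow> nat set \<Rightarrow> nat set \<Rightarrow> nat set \<Rightarrow> (nat set \<times> (nat \<times> nat) set \<times> real) set"
where
  "stage_events i n d m U N P =
     node_events m (m ^ (3 - i)) (real d / (2 * 2 ^ i * real m ^ (i + 1))) (real d / (4 * 2 ^ i * real m ^ 4)) N
     \<union> color_events n m (m ^ (3 - i)) (real d / (4 * 2 ^ i * real m ^ 4)) P
     \<union> node_events m (m ^ (3 - i)) (2 ^ i * real n / real m ^ (i + 1)) (2 ^ i * real n / real m ^ 3) U"

definition irregular ::
  "nat \<Rightarrow> nat \<Rightarrow> nat \<Rightarrow> nat \<Rightarrow> nat set \<Rightarrow> nat set \<Rightarrow> nat set \<Rightarrow> (nat \<Rightarrow> nat \<times> nat) \<Rightarrow> bool"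
where
  "irregular i n d m U N P h \<longleftrightarrow>
     (\<exists>e \<in> stage_events i n d m U N P. deviates h (m * m ^ (3 - i)) e)"

text \<open>A union bound over at most \<open>2 + 3 * m ^ (3 - i)\<close> events. The constant 8192
  comes from the tightest ones, those for the bins: with \<open>C = 2 ^ i\<close> and
  \<open>x = d / m ^ 3\<close> the mean is at most \<open>M = 2 * C * x\<close> and the tolerance is
  \<open>t = x / (4 * C * m)\<close>, so \<open>t\<^sup>2 / (4 * M)\<close> is
  \<open>x / (128 * C ^ 3 * m\<^sup>2)\<close>. Now \<open>x \<ge> m ^ 3\<close> because
  \<open>m ^ 6 \<le> d\<close>, and \<open>C ^ 3 \<le> 64\<close>.\<close>

lemma irregular_rare:
  assumes i: "i \<le> 2" and m: "m \<ge> 1" "m ^ 6 \<le> d" "d \<le> n"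
    and S: "U \<subseteq> {..<n}" "N \<subseteq> {..<n}" "P \<subseteq> {..<q}"
    and U: "card U * m ^ i \<le> 2 ^ i * n" and N: "card N * m ^ i \<le> 2 ^ i * d"
    and P: "card P * m ^ i \<le> 2 * 2 ^ i * d"
  shows "card {h \<in> hash_space (n + q) m (m ^ (3 - i)). irregular i n d m U N P h} \<le>
    (2 + 3 * real m ^ 3) * (2 * exp (- (m / 8192))) * card (hash_space (n + q) m (m ^ (3 - i)))"
proof -
  define k where "k = m ^ (3 - i)"
  have mk: "m ^ i * k = m ^ 3" "k > 0" using i m by (auto simp: k_def simp flip: power_add)
  then have mk': "real m ^ i * real k = real m ^ 3" by (metis of_nat_mult of_nat_power)
  have m': "real m \<ge> 1" "real m ^ 6 \<le> real d" "real d \<le> real n"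
    using m by (auto simp flip: of_nat_power)
  let ?H = "hash_space (n + q) m k" and ?\<epsilon> = "2 * exp (- (m / 8192))"
  let ?t1 = "real d / (2 * 2 ^ i * real m ^ (i + 1))" and ?t2 = "real d / (4 * 2 ^ i * real m ^ 4)"
  let ?t3 = "2 ^ i * real n / real m ^ (i + 1)" and ?t4 = "2 ^ i * real n / real m ^ 3"
  have i_cases: "i = 0 \<or> i = 1 \<or> i = 2" using i by linarith
  have m_pow: "real m \<le> real m ^ 3" using m'(1) by (intro self_le_power) auto
  have m_pow2: "real m ^ (i + 1) \<le> real m ^ 3" using m'(1) i by (intro power_increasing) auto
  have d3: "real m ^ 3 \<le> d / real m ^ 3" "real m ^ 3 \<le> d / real m ^ (i + 1)" "real m ^ 3 \<le> n / real m ^ (i + 1)"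
     "real m ^ 3 \<le> n / real m ^ 3"
  proof -
    have "real m ^ 3 * real m ^ 3 = real m ^ 6" by (simp flip: power_add)
    moreover have "real m ^ 3 * real m ^ (i + 1) \<le> real m ^ 3 * real m ^ 3"
      using m_pow2 by (intro mult_left_mono) auto
    ultimately have "real m ^ 3 * real m ^ 3 \<le> real d" "real m ^ 3 * real m ^ 3 \<le> real n"
      "real m ^ 3 * real m ^ (i + 1) \<le> real d" "real m ^ 3 * real m ^ (i + 1) \<le> real n"
      using m'(2,3) by linarith+
    moreover have "real m ^ 3 > 0" "real m ^ (i + 1) > 0" using m'(1) by (auto simp del: power_Suc)
    ultimately show "real m ^ 3 \<le> d / real m ^ 3" "real m ^ 3 \<le> d / real m ^ (i + 1)"
        "real m ^ 3 \<le> n / real m ^ (i + 1)" "real m ^ 3 \<le> n / real m ^ 3"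
      by (simp_all only: pos_le_divide_eq)
  qed
  have sizes: "real (card U) \<le> 2 ^ i * real n / real m ^ i" "real (card N) \<le> 2 ^ i * real d / real m ^ i"
    "real (card P) \<le> 2 * 2 ^ i * real d / real m ^ i"
    using of_nat_mono[OF U, where 'a = real] of_nat_mono[OF N, where 'a = real]
      of_nat_mono[OF P, where 'a = real] m'(1)
    by (simp_all add: pos_le_divide_eq)
  have event: "card {h \<in> ?H. deviates h (m * k) (S, A, t)} \<le> ?\<epsilon> * card ?H"
    if ev: "(S, A, t) \<in> node_events m k ?t1 ?t2 N \<union> color_events n m k ?t2 P \<union> node_events m k ?t3 ?t4 U"
    for S A t
  proof -
    define C :: real where "C = 2 ^ i"
    define x where "x = real d / real m ^ 3"
    define y where "y = real d / real m ^ (i + 1)"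
    have C: "1 \<le> C" "C ^ 3 \<le> 64" "C > 0" using i_cases by (auto simp: C_def)
    have xy: "real m ^ 3 \<le> x" "real m ^ 3 \<le> y" "real m \<le> y"
      using d3(1,2) m_pow unfolding x_def y_def by linarith+
    then have pos: "0 < x" "0 < y" "0 < real m" using m' by (auto intro: less_le_trans[of _ "real m ^ 3"])
    have C3: "C ^ 3 * z \<le> 64 * z" if "z \<ge> 0" for z using C(2) that by (rule mult_right_mono)
    have t: "?t1 = y / (2 * C)" "?t2 = x / (4 * C * m)" "C * real d / real m ^ (i + 1) = C * y"
      using pos by (simp_all add: x_def y_def C_def field_simps eval_nat_numeral)
    have left: "card S * (card ({0 :: nat} \<times> {..<k}) / (m * k)) \<le> z / real m ^ (i + 1)"
      if "real (card S) \<le> z / real m ^ i" for S :: "nat set" and z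
      using that mk(2) pos by (simp add: field_simps)
    have bin: "card S * (card ({r..<m} \<times> {b :: nat}) / (m * k)) \<le> z / real m ^ 3"
      if "real (card S) \<le> z / real m ^ i" "z \<ge> 0" for S :: "nat set" and z r b
    proof -
      have "real (card S) * (card ({r..<m} \<times> {b}) / (m * k)) \<le> z / real m ^ i * (1 / k)"
        using that mk(2) pos by (intro mult_mono) (auto simp: field_simps)
      then show ?thesis using mk' by simp
    qed
    have t1: "4 * (C * y) * (m / 8192) \<le> (y / (2 * C))\<^sup>2" "y / (2 * C) \<le> 2 * (C * y)"
    proof -
      have "4 * (C * y) * (m / 8192) * (4 * C\<^sup>2) = C ^ 3 * (m * y) / 512"
        by (simp add: power2_eq_square power3_eq_cube)
      also have "\<dots> \<le> y\<^sup>2"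
      proof -
        have "0 \<le> m * y" "m * y \<le> y\<^sup>2"
          using mult_right_mono[OF xy(3), of y] pos by (auto simp: power2_eq_square)
        then show ?thesis using C3[of "m * y"] by linarith
      qed
      finally show "4 * (C * y) * (m / 8192) \<le> (y / (2 * C))\<^sup>2"
        using C by (simp add: power_divide power_mult_distrib pos_le_divide_eq)
      have "y / (2 * C) \<le> y" using C pos by (simp add: divide_le_eq)
      also have "y \<le> 2 * (C * y)" using C mult_right_mono[of 1 C y] pos by simp
      finally show "y / (2 * C) \<le> 2 * (C * y)" .
    qed
    have t2: "4 * (2 * C * x) * (m / 8192) \<le> (x / (4 * C * m))\<^sup>2" "x / (4 * C * m) \<le> 2 * (2 * C * x)"
    proof -
      have "4 * (2 * C * x) * (m / 8192) * (16 * C\<^sup>2 * m\<^sup>2) = C ^ 3 * (real m ^ 3 * x) / 64"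
        by (simp add: power2_eq_square power3_eq_cube)
      also have "\<dots> \<le> x\<^sup>2"
      proof -
        have "0 \<le> real m ^ 3 * x" "real m ^ 3 * x \<le> x\<^sup>2"
          using mult_right_mono[OF xy(1), of x] pos by (auto simp: power2_eq_square)
        then show ?thesis using C3[of "real m ^ 3 * x"] by linarith
      qed
      finally show "4 * (2 * C * x) * (m / 8192) \<le> (x / (4 * C * m))\<^sup>2"
        using C pos by (simp add: power_divide power_mult_distrib pos_le_divide_eq)
      have "1 * 1 \<le> C * m" using C(1) m'(1) by (intro mult_mono) auto
      then have "x / (4 * C * m) \<le> x" using C pos by (simp add: divide_le_eq)
      also have "x \<le> 2 * (2 * C * x)" using C mult_right_mono[of 1 C x] pos by simp
      finally show "x / (4 * C * m) \<le> 2 * (2 * C * x)" .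
    qed
    have t3: "4 * z * (m / 8192) \<le> z\<^sup>2" "0 < z" if "real m \<le> z" for z :: real
      using that pos mult_right_mono[OF that, of z] by (auto simp: power2_eq_square)
    have rare: "card {h \<in> ?H. deviates h (m * k) (S, A, t)} \<le> ?\<epsilon> * card ?H"
      if "S \<subseteq> {..<n + q}" "A \<subseteq> {..<m} \<times> {..<k}" "card S * (card A / (m * k)) \<le> M" "0 < t"
        "t \<le> 2 * M" "4 * M * (m / 8192) \<le> t\<^sup>2" for S A and M t :: real
      by (rule deviates_rare[where M = M]) (use that m(1) mk(2) in simp_all)
    consider (N1) "(S, A, t) = (N, {0} \<times> {..<k}, ?t1)"
      | (N2) b where "b < k" "(S, A, t) = (N, {1..<m} \<times> {b}, ?t2)"
      | (P) b where "b < k" "(S, A, t) = ((+) n ` P, {..<m} \<times> {b}, ?t2)"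
      | (U1) "(S, A, t) = (U, {0} \<times> {..<k}, ?t3)"
      | (U2) b where "b < k" "(S, A, t) = (U, {1..<m} \<times> {b}, ?t4)"
      using ev by (auto simp: node_events_def color_events_def)
    then show ?thesis
    proof cases
      case N1
      have "card N * (card ({0 :: nat} \<times> {..<k}) / (m * k)) \<le> C * y"
        using left[OF sizes(2)] t(3) by (simp add: C_def)
      moreover have "0 < ?t1" unfolding t(1) using pos C(3) by simp
      ultimately show ?thesis
        using N1 S(2) m(1) t1 unfolding t(1)
        by (intro rare[of S A "C * y" t]) auto
    next
      case N2
      have "card N * (card ({1..<m} \<times> {b}) / (m * k)) \<le> 2 ^ i * real d / real m ^ 3"
        by (rule bin[OF sizes(2)]) auto
      also have "\<dots> = C * x" by (simp add: C_def x_def)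
      also have "C * x \<le> 2 * C * x" using pos C(3) by simp
      finally have "card N * (card ({1..<m} \<times> {b}) / (m * k)) \<le> 2 * C * x" .
      moreover have "0 < ?t2" unfolding t(2) using pos C(3) by simp
      ultimately show ?thesis
        using N2 S(2) t2 unfolding t(2)
        by (intro rare[of S A "2 * C * x" t]) auto
    next
      case P
      have "card ((+) n ` P) = card P" by (simp add: card_image)
      then have "card ((+) n ` P) * (card ({..<m} \<times> {b}) / (m * k)) \<le> 2 * 2 ^ i * real d / real m ^ 3"
        using bin[OF sizes(3), of 0 b] by (simp add: lessThan_atLeast0)
      also have "\<dots> = 2 * C * x" by (simp add: C_def x_def)
      finally have "card ((+) n ` P) * (card ({..<m} \<times> {b}) / (m * k)) \<le> 2 * C * x" .
      moreover have "0 < ?t2" unfolding t(2) using pos C(3) by simp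
      ultimately show ?thesis
        using P S(3) t2 unfolding t(2)
        by (intro rare[of S A "2 * C * x" t]) auto
    next
      case U1
      have "card U * (card ({0 :: nat} \<times> {..<k}) / (m * k)) \<le> ?t3" by (rule left[OF sizes(1)])
      moreover have "real m \<le> ?t3"
      proof -
        have "1 * (real n / real m ^ (i + 1)) \<le> 2 ^ i * (real n / real m ^ (i + 1))"
          by (intro mult_right_mono) auto
        then have "real n / real m ^ (i + 1) \<le> ?t3" by (simp del: power_Suc)
        then show ?thesis using d3(3) m_pow by linarith
      qed
      ultimately show ?thesis
      proof -
        define z :: real where "z = ?t3"
        assume "card U * (card ({0 :: nat} \<times> {..<k}) / (m * k)) \<le> ?t3" "real m \<le> ?t3"
        then show ?thesis
          using U1 S(1) m(1) t3[of z] unfolding z_def[symmetric] by (intro rare[of S A z t]) auto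
      qed
    next
      case U2
      have "card U * (card ({1..<m} \<times> {b}) / (m * k)) \<le> ?t4" by (rule bin[OF sizes(1)]) auto
      moreover have "real m \<le> ?t4"
      proof -
        have "1 * (real n / real m ^ 3) \<le> 2 ^ i * (real n / real m ^ 3)"
          by (intro mult_right_mono) auto
        then have "real n / real m ^ 3 \<le> ?t4" by (simp del: power_Suc)
        then show ?thesis using d3(4) m_pow by linarith
      qed
      ultimately show ?thesis
      proof -
        define z :: real where "z = ?t4"
        assume "card U * (card ({1..<m} \<times> {b}) / (m * k)) \<le> ?t4" "real m \<le> ?t4"
        then show ?thesis
          using U2 S(1) t3[of z] unfolding z_def[symmetric] by (intro rare[of S A z t]) auto
      qed
    qed
  qed
  let ?E = "node_events m k ?t1 ?t2 N \<union> color_events n m k ?t2 P \<union> node_events m k ?t3 ?t4 U"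
  have fin: "finite ?E" by (simp add: node_events_def color_events_def)
  have "card ?E \<le> (Suc k + k) + Suc k"
  proof -
    have node: "card (node_events m k t t' S) \<le> Suc k" for t t' S
      unfolding node_events_def
      by (rule order_trans[OF card_insert_le_m1]) (auto intro: order_trans[OF card_image_le])
    have "card (color_events n m k ?t2 P) \<le> k"
      unfolding color_events_def by (rule order_trans[OF card_image_le]) auto
    then show ?thesis using node
      by (intro order_trans[OF card_Un_le] add_mono) auto
  qed
  then have "real (card ?E) \<le> 2 + 3 * real k" by linarith
  also have "real k \<le> real m ^ 3" using m by (simp add: k_def power_increasing)
  finally have cardE: "real (card ?E) \<le> 2 + 3 * real m ^ 3" by simp
  have "{h \<in> ?H. irregular i n d m U N P h} = (\<Union>e\<in>?E. {h \<in> ?H. deviates h (m * k) e})"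
    by (auto simp: irregular_def stage_events_def k_def)
  then have "real (card {h \<in> ?H. irregular i n d m U N P h}) \<le> (\<Sum>e\<in>?E. real (card {h \<in> ?H. deviates h (m * k) e}))"
    using card_UN_le[OF fin, of "\<lambda>e. {h \<in> ?H. deviates h (m * k) e}"] by (simp flip: of_nat_sum)
  also have "\<dots> \<le> (\<Sum>e\<in>?E. ?\<epsilon> * card ?H)"
    using event by (intro sum_mono) auto
  also have "\<dots> = card ?E * (?\<epsilon> * card ?H)" by simp
  also have "\<dots> \<le> (2 + 3 * real m ^ 3) * (?\<epsilon> * card ?H)"
    using cardE by (intro mult_right_mono) auto
  finally show ?thesis by (simp add: k_def mult.assoc)
qed

text \<open>The polynomial has degree 6 + 3 = 9, so the tenth power in
  \<open>exp x \<ge> (1 + x / 10) ^ 10\<close> wins; with \<open>x = m / 8192\<close> its base is at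
  least \<open>m / 81920\<close>. The factor 2560 is \<open>8 * 2 ^ 6 * 5\<close>.\<close>

lemma exp_beats_polynomial:
  assumes "2560 * 81920 ^ 10 \<le> m"
  shows "8 * (real m + 1) ^ 6 * ((2 + 3 * real m ^ 3) * exp (- (m / 8192))) \<le> 1"
proof -
  have m: "2560 * 81920 ^ 10 \<le> real m" using of_nat_mono[OF assms, where 'a = real] by simp
  then have m1: "1 \<le> real m" by simp
  have "(2 * real m) ^ 6 = 64 * real m ^ 6" by (simp add: power_mult_distrib)
  have "8 * (real m + 1) ^ 6 * (2 + 3 * real m ^ 3) \<le> 8 * (2 * real m) ^ 6 * (5 * real m ^ 3)"
  proof (intro mult_mono)
    show "(real m + 1) ^ 6 \<le> (2 * real m) ^ 6" using m by (intro power_mono) auto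
    have "1 \<le> real m ^ 3" using m1 by (rule one_le_power)
    then show "2 + 3 * real m ^ 3 \<le> 5 * real m ^ 3" by simp
  qed auto
  also have "\<dots> = 2560 * real m ^ 9" by (simp add: power_mult_distrib flip: power_add)
  also have "\<dots> \<le> (m / 81920) ^ 10"
  proof -
    have "2560 * 81920 ^ 10 * real m ^ 9 \<le> real m * real m ^ 9" using m by (intro mult_right_mono) auto
    then show ?thesis by (simp add: power_divide pos_le_divide_eq flip: power_Suc)
  qed
  also have "\<dots> \<le> (1 + (m / 8192) / real 10) ^ 10"
    by (rule power_mono) auto
  also have "\<dots> \<le> exp (m / 8192)"
    by (rule exp_ge_one_plus_x_over_n_power_n) auto
  finally show ?thesis by (simp add: exp_minus field_simps)
qed

text \<open>Both sides of the deviation are kept only for the leftover neighbors: the upper one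
  bounds the degrees of the next stage, the lower one its residual palettes from below.\<close>

lemma regular_counts:
  assumes h: "h \<in> hash_space (n + q) m (m ^ (3 - i))" and reg: "\<not> irregular i n d m U N P h"
    and S: "U \<subseteq> {..<n}" "N \<subseteq> {..<n}" "P \<subseteq> {..<q}" and m: "m \<ge> 1" and b: "b < m ^ (3 - i)"
  shows "\<bar>real (card {u \<in> N. fst (h u) = 0}) - card N / m\<bar> < real d / (2 * 2 ^ i * real m ^ (i + 1))"
    and "real (card {u \<in> N. fst (h u) \<noteq> 0 \<and> snd (h u) = b}) <
      card N * (real m - 1) / (real m * real m ^ (3 - i)) + real d / (4 * 2 ^ i * real m ^ 4)"
    and "card P / real m ^ (3 - i) - real d / (4 * 2 ^ i * real m ^ 4) < real (card {c \<in> P. snd (h (n + c)) = b})"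
    and "real (card {u \<in> U. fst (h u) = 0}) < card U / m + 2 ^ i * real n / real m ^ (i + 1)"
    and "real (card {u \<in> U. fst (h u) \<noteq> 0 \<and> snd (h u) = b}) <
      card U * (real m - 1) / (real m * real m ^ (3 - i)) + 2 ^ i * real n / real m ^ 3"
proof -
  define k where "k = m ^ (3 - i)"
  have k: "k > 0" using m by (simp add: k_def)
  have hW: "fst (h u) < m" "snd (h u) < k" if "u < n + q" for u
  proof -
    have "h u \<in> {..<m} \<times> {..<k}" 
      using PiE_mem[of h "{..<n + q}" "\<lambda>_. {..<m} \<times> {..<k}" u] h that by (simp add: hash_space_def k_def)
    then show "fst (h u) < m" "snd (h u) < k" by (simp_all add: mem_Times_iff)
  qed
  have nodes: "{u \<in> S. h u \<in> {0} \<times> {..<k}} = {u \<in> S. fst (h u) = 0}"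
     "{u \<in> S. h u \<in> {1..<m} \<times> {b}} = {u \<in> S. fst (h u) \<noteq> 0 \<and> snd (h u) = b}"
    if S: "S \<subseteq> {..<n}" for S
  proof -
    have "fst (h u) < m" "snd (h u) < k" if "u \<in> S" for u
      using hW[of u] S that by auto
    then show "{u \<in> S. h u \<in> {0} \<times> {..<k}} = {u \<in> S. fst (h u) = 0}"
      "{u \<in> S. h u \<in> {1..<m} \<times> {b}} = {u \<in> S. fst (h u) \<noteq> 0 \<and> snd (h u) = b}"
      by (auto simp: mem_Times_iff Suc_le_eq)
  qed
  have colors: "card {u \<in> (+) n ` P. h u \<in> {..<m} \<times> {b}} = card {c \<in> P. snd (h (n + c)) = b}"
  proof -
    have "fst (h (n + c)) < m" if "c \<in> P" for c
      using hW(1)[of "n + c"] S(3) that by auto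
    then have "{u \<in> (+) n ` P. h u \<in> {..<m} \<times> {b}} = (+) n ` {c \<in> P. snd (h (n + c)) = b}"
      by (auto simp: mem_Times_iff)
    then show ?thesis by (simp add: card_image)
  qed
  have ratios: "card ({0 :: nat} \<times> {..<k}) / (m * k) = 1 / m"
    "card ({1..<m} \<times> {b}) / (m * k) = (real m - 1) / (real m * k)"
    "card ({..<m} \<times> {b}) / (m * k) = 1 / k"
    using m k by (auto simp: of_nat_diff)
  have "card ((+) n ` P) = card P" by (simp add: card_image)
  note eqs = nodes[OF S(1)] nodes[OF S(2)] colors ratios this
  have b': "b \<in> {..<m ^ (3 - i)}" using b by simp
  have ev: "\<bar>real (card {u \<in> S. h u \<in> A}) - card S * (card A / (m * k))\<bar> < t"
    if "(S, A, t) \<in> stage_events i n d m U N P" for S A t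
  proof -
    have "\<not> deviates h (m * k) (S, A, t)" using reg that unfolding irregular_def k_def by blast
    then show ?thesis by (simp add: deviates_def)
  qed
  have "(N, {0} \<times> {..<k}, real d / (2 * 2 ^ i * real m ^ (i + 1))) \<in> stage_events i n d m U N P"
    by (simp add: stage_events_def node_events_def k_def)
  from ev[OF this] show "\<bar>real (card {u \<in> N. fst (h u) = 0}) - card N / m\<bar> < real d / (2 * 2 ^ i * real m ^ (i + 1))"
    unfolding eqs by simp
  have "(N, {1..<m} \<times> {b}, real d / (4 * 2 ^ i * real m ^ 4)) \<in> stage_events i n d m U N P"
    using b' unfolding stage_events_def node_events_def k_def by blast
  from ev[OF this] show "real (card {u \<in> N. fst (h u) \<noteq> 0 \<and> snd (h u) = b}) <
      card N * (real m - 1) / (real m * real m ^ (3 - i)) + real d / (4 * 2 ^ i * real m ^ 4)"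
    unfolding eqs abs_less_iff by (simp add: k_def)
  have "((+) n ` P, {..<m} \<times> {b}, real d / (4 * 2 ^ i * real m ^ 4)) \<in> stage_events i n d m U N P"
    using b' unfolding stage_events_def color_events_def k_def by blast
  from ev[OF this] show "card P / real m ^ (3 - i) - real d / (4 * 2 ^ i * real m ^ 4) < real (card {c \<in> P. snd (h (n + c)) = b})"
    unfolding eqs abs_less_iff by (simp add: k_def)
  have "(U, {0} \<times> {..<k}, 2 ^ i * real n / real m ^ (i + 1)) \<in> stage_events i n d m U N P"
    by (simp add: stage_events_def node_events_def k_def)
  from ev[OF this] show "real (card {u \<in> U. fst (h u) = 0}) < card U / m + 2 ^ i * real n / real m ^ (i + 1)"
    unfolding eqs abs_less_iff by simp
  have "(U, {1..<m} \<times> {b}, 2 ^ i * real n / real m ^ 3) \<in> stage_events i n d m U N P"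
    using b' unfolding stage_events_def node_events_def k_def by blast
  from ev[OF this] show "real (card {u \<in> U. fst (h u) \<noteq> 0 \<and> snd (h u) = b}) <
      card U * (real m - 1) / (real m * real m ^ (3 - i)) + 2 ^ i * real n / real m ^ 3"
    unfolding eqs abs_less_iff by (simp add: k_def)
qed

text \<open>Every estimate adds a tolerance to a mean or subtracts it. The number \<open>a\<close>
  in the fifth claim stands for what is kept outside \<open>N\<close>: the amount by which the
  degree falls short of \<Delta>, and the uncolored bad neighbors.\<close>

lemma regular_stage:
  fixes i n d m :: nat and h
  defines "left \<equiv> \<lambda>S. {u \<in> S. fst (h u) = 0}" and "bin \<equiv> \<lambda>b S. {u \<in> S. fst (h u) \<noteq> 0 \<and> snd (h u) = b}"
  assumes h: "h \<in> hash_space (n + q) m (m ^ (3 - i))" and reg: "\<not> irregular i n d m U N P h"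
    and S: "U \<subseteq> {..<n}" "N \<subseteq> {..<n}" "P \<subseteq> {..<q}" and i: "i \<le> 2" and m: "m \<ge> 1" "m ^ 6 \<le> d"
    and b: "b < m ^ (3 - i)"
    and U: "card U * m ^ i \<le> 2 ^ i * n" and N: "card N * m ^ i \<le> 2 ^ i * d"
  shows "card (left U) * m ^ (i + 1) \<le> 2 ^ (i + 1) * n"
    and "card (bin b U) * m ^ 3 \<le> 8 * n"
    and "card (left N) * m ^ (i + 1) \<le> 2 ^ (i + 1) * d"
    and "card (bin b N) * m ^ 3 \<le> 5 * d"
    and "d \<le> (2 * m) ^ i * (a + card N) \<Longrightarrow> d \<le> (2 * m) ^ (i + 1) * (a + card (left N))"
    and "card N \<le> card P \<Longrightarrow> d \<le> (2 * m) ^ i * card P \<Longrightarrow>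
      card (bin b N) < card {c \<in> P. snd (h (n + c)) = b}"
proof -
  note counts = regular_counts[OF h reg S m(1) b]
  define M I C :: real where "M = real m" and "I = real m ^ i" and "C = 2 ^ i"
  define k where "k = real m ^ (3 - i)"
  have pos: "M \<ge> 1" "I > 0" "k > 0" "C \<ge> 1" using m by (simp_all add: M_def I_def k_def C_def)
  have C4: "C \<le> 4" using power_increasing[of i 2 "2 :: real"] i by (simp add: C_def)
  have Ik: "I * k = M ^ 3" using i by (simp add: I_def k_def M_def flip: power_add)
  have U': "card U \<le> C * n / I" and N': "card N \<le> C * d / I"
    using of_nat_mono[OF U, where 'a = real] of_nat_mono[OF N, where 'a = real] pos
    by (simp_all add: C_def I_def pos_le_divide_eq)
  have d: "real d > 0" using m by (metis gr0I le_zero_eq not_one_le_zero of_nat_0_less_iff power_eq_0_iff)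
  have t: "real d / (2 * 2 ^ i * real m ^ (i + 1)) = d / (2 * C * (M * I))"
    "real d / (4 * 2 ^ i * real m ^ 4) = d / (4 * C * (M * (I * k)))"
    "2 ^ i * real n / real m ^ (i + 1) = C * n / (M * I)"
    "2 ^ i * real n / real m ^ 3 = C * n / (I * k)"
    unfolding Ik by (simp_all add: C_def M_def I_def eval_nat_numeral)
  have L: "\<bar>card (left N) - card N / M\<bar> < d / (2 * C * (M * I))"
    using counts(1) unfolding t M_def left_def .
  have B: "card (bin b N) < card N * (M - 1) / (M * k) + d / (4 * C * (M * (I * k)))"
    using counts(2) unfolding t M_def k_def bin_def .
  have Pb: "card P / k - d / (4 * C * (M * (I * k))) < card {c \<in> P. snd (h (n + c)) = b}"
    using counts(3) unfolding t k_def .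
  have LU: "card (left U) < card U / M + C * n / (M * I)"
    using counts(4) unfolding t M_def left_def .
  have BU: "card (bin b U) < card U * (M - 1) / (M * k) + C * n / (I * k)"
    using counts(5) unfolding t M_def k_def bin_def .
  have bin_le: "x * (M - 1) / (M * k) \<le> x / k" if "x \<ge> 0" for x
  proof -
    have "x * (M - 1) / (M * k) \<le> x * M / (M * k)"
      using that pos by (intro divide_right_mono mult_left_mono) auto
    then show ?thesis using pos by simp
  qed
  have double: "x \<le> 2 * z" if "x < y + z" "y \<le> z" for x y z :: real
    using that by linarith
  show "card (left U) * m ^ (i + 1) \<le> 2 ^ (i + 1) * n"
  proof -
    have "card U / M \<le> C * n / (M * I)"
      using divide_right_mono[OF U', of M] pos by (simp add: mult.commute)
    with LU have "card (left U) \<le> 2 * (C * n / (M * I))" by (rule double)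
    also have "\<dots> = 2 * C * n / (M * I)" by simp
    finally have "card (left U) \<le> 2 * C * n / (M * I)" .
    then have "card (left U) * (M * I) \<le> 2 * C * n" using pos by (simp add: pos_le_divide_eq)
    then have "real (card (left U) * m ^ (i + 1)) \<le> real (2 ^ (i + 1) * n)"
      by (simp add: M_def I_def C_def)
    then show ?thesis by (simp only: of_nat_le_iff)
  qed
  show "card (bin b U) * m ^ 3 \<le> 8 * n"
  proof -
    have "card U / k \<le> C * n / (I * k)"
      using divide_right_mono[OF U', of k] pos by simp
    then have "card (bin b U) \<le> 2 * (C * n / (I * k))" using BU bin_le[of "card U"] by linarith
    also have "\<dots> = 2 * C * n / (I * k)" by simp
    finally have "card (bin b U) \<le> 2 * C * n / (I * k)" .
    then have "card (bin b U) * (I * k) \<le> 2 * C * n" using pos by (simp add: pos_le_divide_eq)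
    also have "\<dots> \<le> 8 * real n" using C4 by (intro mult_right_mono) auto
    finally have "real (card (bin b U) * m ^ 3) \<le> real (8 * n)" unfolding Ik by (simp add: M_def)
    then show ?thesis by (simp only: of_nat_le_iff)
  qed
  have CC: "d / (x * C * y) \<le> C * d / y" if "y > 0" "x \<ge> 1" for x y
  proof -
    have "1 \<le> x * C" using pos(4) that(2) mult_mono[of 1 x 1 C] by simp
    then have "d / (x * C * y) \<le> d / y" using that by (intro divide_left_mono) (auto simp: mult_le_cancel_right1)
    also have "d / y \<le> C * d / y" using that pos(4) by (intro divide_right_mono) (auto simp: mult_le_cancel_right1)
    finally show ?thesis .
  qed
  show "card (left N) * m ^ (i + 1) \<le> 2 ^ (i + 1) * d"
  proof -
    have "card N / M \<le> C * d / (M * I)"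
      using divide_right_mono[OF N', of M] pos by (simp add: mult.commute)
    moreover have "d / (2 * C * (M * I)) \<le> C * d / (M * I)" using pos by (intro CC) auto
    ultimately have "card (left N) \<le> 2 * (C * d / (M * I))"
      using L by (intro double[of "card (left N)" "card N / M"]) linarith+
    also have "\<dots> = 2 * C * d / (M * I)" by simp
    finally have "card (left N) \<le> 2 * C * d / (M * I)" .
    then have "card (left N) * (M * I) \<le> 2 * C * d" using pos by (simp add: pos_le_divide_eq)
    then have "real (card (left N) * m ^ (i + 1)) \<le> real (2 ^ (i + 1) * d)"
      by (simp add: M_def I_def C_def)
    then show ?thesis by (simp only: of_nat_le_iff)
  qed
  show "card (bin b N) * m ^ 3 \<le> 5 * d"
  proof -
    have "card N / k \<le> C * d / (I * k)"
      using divide_right_mono[OF N', of k] pos by simp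
    also have "\<dots> \<le> 4 * real d / (I * k)" using C4 pos by (intro divide_right_mono mult_right_mono) auto
    also have "\<dots> = 4 * (d / (I * k))" by simp
    finally have 1: "card N / k \<le> 4 * (d / (I * k))" .
    have "1 * 1 * (I * k) \<le> (4 * C) * M * (I * k)"
      using pos by (intro mult_mono mult_nonneg_nonneg) auto
    then have "d / (4 * C * (M * (I * k))) \<le> d / (I * k)"
      using pos by (intro divide_left_mono) (auto simp: mult_ac)
    with 1 have "card (bin b N) \<le> 5 * (d / (I * k))" using B bin_le[of "card N"] by linarith
    also have "\<dots> = 5 * d / (I * k)" by simp
    finally have "card (bin b N) \<le> 5 * d / (I * k)" .
    then have "card (bin b N) * (I * k) \<le> 5 * d" using pos by (simp add: pos_le_divide_eq)
    then have "real (card (bin b N) * m ^ 3) \<le> real (5 * d)" unfolding Ik by (simp add: M_def)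
    then show ?thesis by (simp only: of_nat_le_iff)
  qed
  have lower: "d / (C * I) \<le> x" if "d \<le> (2 * m) ^ i * x" for x :: nat
  proof -
    have "real d \<le> C * I * x" using of_nat_mono[OF that, where 'a = real]
      by (simp add: C_def I_def power_mult_distrib)
    then show ?thesis using pos by (simp add: pos_divide_le_eq mult.commute)
  qed
  \<comment> \<open>As \<open>a \<ge> a / M\<close>, passing to the leftover part costs a factor
    \<open>M\<close> at most in the mean. The tolerance takes half of what is then guaranteed, hence
    the factor \<open>2 * m\<close> per stage.\<close>
  show "d \<le> (2 * m) ^ (i + 1) * (a + card (left N))" if "d \<le> (2 * m) ^ i * (a + card N)"
  proof -
    have "d / (C * I) / M \<le> (a + card N) / M"
      using lower[OF that] pos by (intro divide_right_mono) auto
    also have "\<dots> \<le> a + card N / M"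
      using pos by (simp add: add_divide_distrib divide_le_eq mult_le_cancel_left1)
    also have "\<dots> \<le> a + card (left N) + d / (2 * C * (M * I))" using L by linarith
    finally have "d / (C * I) / M \<le> a + card (left N) + d / (2 * C * (M * I))" .
    then have "d / (2 * C * (M * I)) \<le> a + card (left N)" by (simp add: field_simps)
    then have "d \<le> (2 * C * (M * I)) * (a + card (left N))" using pos by (simp add: pos_divide_le_eq mult.commute)
    then have "real d \<le> real ((2 * m) ^ (i + 1) * (a + card (left N)))"
      by (simp add: M_def I_def C_def power_mult_distrib mult_ac)
    then show ?thesis by (simp only: of_nat_le_iff)
  qed
  show "card (bin b N) < card {c \<in> P. snd (h (n + c)) = b}"
    if P: "card N \<le> card P" "d \<le> (2 * m) ^ i * card P"
  proof -
    \<comment> \<open>The means of degree and colors differ by at least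
      \<open>card P / (M * k)\<close>, because a bin receives only the fraction
      \<open>1 - 1 / M\<close> of its nodes but all of its colors. This is at least
      \<open>4 * ?t\<close>, and the two deviations use up less than \<open>2 * ?t\<close>.\<close>
    let ?t = "d / (4 * C * (M * (I * k)))"
    have "card N * (M - 1) / (M * k) \<le> card P * (M - 1) / (M * k)"
      using P(1) pos by (intro divide_right_mono mult_right_mono) auto
    also have "\<dots> = card P / k - card P / (M * k)" using pos by (simp add: field_simps)
    finally have 1: "card N * (M - 1) / (M * k) \<le> card P / k - card P / (M * k)" .
    have "4 * ?t = d / (C * I) / (M * k)" using pos by (simp add: field_simps)
    also have "\<dots> \<le> card P / (M * k)" using lower[OF P(2)] pos by (intro divide_right_mono) auto
    finally have "4 * ?t \<le> card P / (M * k)" .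
    moreover have "?t > 0" using d pos by (intro divide_pos_pos mult_pos_pos) auto
    ultimately have "real (card (bin b N)) < real (card {c \<in> P. snd (h (n + c)) = b})"
      using B Pb 1 by linarith
    then show ?thesis by simp
  qed
qed

section \<open>Families of partitions\<close>

lemma card_bounded_subsets:
  assumes "finite A"
  shows "finite {P. P \<subseteq> A \<and> card P \<le> n}" "card {P. P \<subseteq> A \<and> card P \<le> n} \<le> (card A + 1) ^ n"
proof -
  show "finite {P. P \<subseteq> A \<and> card P \<le> n}" using assms by simp
  \<comment> \<open>A set with at most \<open>n\<close> elements is read off a list of length
    exactly \<open>n\<close> that is padded with \<open>None\<close>.\<close>
  let ?L = "{xs. set xs \<subseteq> insert None (Some ` A) \<and> length xs = n}"
  have "{P. P \<subseteq> A \<and> card P \<le> n} \<subseteq> (\<lambda>xs. {a. Some a \<in> set xs}) ` ?L"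
  proof
    fix P assume "P \<in> {P. P \<subseteq> A \<and> card P \<le> n}"
    then have P: "P \<subseteq> A" "card P \<le> n" by auto
    obtain xs where xs: "set xs = P" "distinct xs"
      using finite_distinct_list finite_subset[OF P(1) assms] by blast
    have "length xs \<le> n" using xs P(2) distinct_card by fastforce
    then show "P \<in> (\<lambda>xs. {a. Some a \<in> set xs}) ` ?L"
      using xs P(1) by (intro image_eqI[of _ _ "map Some xs @ replicate (n - length xs) None"]) auto
  qed
  moreover have "finite ?L" using assms by (intro finite_lists_length_eq) auto
  ultimately have "card {P. P \<subseteq> A \<and> card P \<le> n} \<le> card ?L"
    by (meson card_image_le card_mono finite_imageI le_trans)
  also have "card ?L = card (insert None (Some ` A)) ^ n"
    using assms by (intro card_lists_length_eq) auto
  also have "card (insert None (Some ` A)) = card A + 1"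
    using assms by (subst card_insert_disjoint) (auto simp: card_image)
  finally show "card {P. P \<subseteq> A \<and> card P \<le> n} \<le> (card A + 1) ^ n" .
qed

text \<open>One family has to serve all \<open>N\<close> and \<open>P\<close>: it is determined by
  data known to all nodes, while \<open>N\<close> and \<open>P\<close> belong to single nodes. The
  fraction \<open>1 / (d + 1)\<close> makes the bad nodes few enough to be collected with all their
  edges.\<close>

definition regular_family ::
  "nat \<Rightarrow> nat \<Rightarrow> nat \<Rightarrow> nat \<Rightarrow> nat \<Rightarrow> nat set \<Rightarrow> (nat \<Rightarrow> nat \<Rightarrow> nat \<times> nat) \<Rightarrow> bool"
where
  "regular_family i n q d m U F \<longleftrightarrow> (\<forall>r<n ^ 4. F r \<in> hash_space (n + q) m (m ^ (3 - i))) \<and>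
     (\<forall>N P. N \<subseteq> {..<n} \<longrightarrow> P \<subseteq> {..<q} \<longrightarrow> card P \<le> n \<longrightarrow> card N * m ^ i \<le> 2 ^ i * d \<longrightarrow>
        card P * m ^ i \<le> 2 * 2 ^ i * d \<longrightarrow>
        (d + 1) * card {r. r < n ^ 4 \<and> irregular i n d m U N P (F r)} \<le> n ^ 4)"

text \<open>\<open>sparse_family\<close> with \<open>K = d + 1\<close> and the pairs
  \<open>(N, P)\<close> as tests, fewer than \<open>2 ^ \<tau>\<close> in number. As \<tau> is at
  most \<open>(c + 3) * n\<^sup>2\<close> and \<open>d + 1 \<le> n\<close>, no more than
  \<open>(2 * c + 6) * n ^ 3\<close> members are required. This explains \<open>n ^ 4\<close> and
  the summand \<open>2 * c + 6\<close> in the bound on \<open>m\<close>; the other large summand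
  makes each test rare by \<open>exp_beats_polynomial\<close>.\<close>

lemma regular_family_exists:
  assumes i: "i \<le> 2" and m: "2560 * 81920 ^ 10 + 2 * c + 6 \<le> m" "m ^ 6 \<le> d" "d < (m + 1) ^ 6" "d < n"
    and U: "U \<subseteq> {..<n}" "card U * m ^ i \<le> 2 ^ i * n" and q: "q = 2 ^ (c * floorlog 2 n)"
  shows "\<exists>F. regular_family i n q d m U F"
proof -
  define k where "k = m ^ (3 - i)"
  let ?\<Omega> = "hash_space (n + q) m k"
  define A where "A = Pow {..<n} \<times> {P. P \<subseteq> {..<q} \<and> card P \<le> n}"
  define \<T> where "\<T> = (\<lambda>(N, P). irregular i n d m U N P) `
    {x \<in> A. card (fst x) * m ^ i \<le> 2 ^ i * d \<and> card (snd x) * m ^ i \<le> 2 * 2 ^ i * d}"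
  let ?L = "floorlog 2 n"
  define \<tau> where "\<tau> = n * (c * ?L + 2) + 1"
  have m1: "m \<ge> 1" using m(1) by linarith
  have finA: "finite A" unfolding A_def using card_bounded_subsets(1)[of "{..<q}" n] by simp
  have n: "2 * c + 6 \<le> n"
  proof -
    have "m \<le> m ^ 6" using m1 by (intro self_le_power) auto
    then show ?thesis using m by linarith
  qed
  have "card \<T> \<le> card A"
    unfolding \<T>_def using finA by (intro order_trans[OF card_image_le card_mono]) auto
  also have "\<dots> \<le> 2 ^ n * (q + 1) ^ n"
    using card_bounded_subsets(2)[of "{..<q}" n] by (simp add: A_def card_cartesian_product card_Pow)
  also have "\<dots> \<le> 2 ^ n * (2 ^ (c * ?L + 1)) ^ n"
    unfolding q by (intro mult_left_mono power_mono) auto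
  also have "\<dots> = 2 ^ (n * (c * ?L + 2))"
    by (simp add: algebra_simps flip: power_mult power_add)
  also have "\<dots> < 2 ^ \<tau>" unfolding \<tau>_def by (rule power_strict_increasing) auto
  finally have card\<T>: "card \<T> < 2 ^ \<tau>" .
  have \<tau>: "2 * (d + 1) * \<tau> \<le> n ^ 4"
  proof -
    have "?L \<le> n" using less_exp[of n] by (simp add: floorlog_le_iff)
    then have "n * (c * ?L + 2) + 1 \<le> n * (c * n + 2 * n) + n * n"
      using n by (intro add_mono mult_left_mono) auto
    then have "\<tau> \<le> (c + 3) * (n * n)" by (simp add: \<tau>_def algebra_simps)
    then have "2 * (d + 1) * \<tau> \<le> 2 * n * ((c + 3) * (n * n))"
      using m(4) by (intro mult_mono) auto
    also have "\<dots> = (2 * c + 6) * (n * n * n)" by (simp add: algebra_simps)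
    also have "\<dots> \<le> n * (n * n * n)" using n by (intro mult_right_mono) auto
    finally show ?thesis by (simp add: eval_nat_numeral)
  qed
  have rare: "4 * (d + 1) * card {h \<in> ?\<Omega>. t h} \<le> card ?\<Omega>" if "t \<in> \<T>" for t
  proof -
    obtain x where x: "t = (\<lambda>(N, P). irregular i n d m U N P) x" "x \<in> A"
      "card (fst x) * m ^ i \<le> 2 ^ i * d" "card (snd x) * m ^ i \<le> 2 * 2 ^ i * d"
      using \<open>t \<in> \<T>\<close> unfolding \<T>_def by blast
    obtain N P where t: "t = irregular i n d m U N P" "N \<subseteq> {..<n}" "P \<subseteq> {..<q}"
      "card N * m ^ i \<le> 2 ^ i * d" "card P * m ^ i \<le> 2 * 2 ^ i * d"
      using x by (cases x) (simp add: A_def)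
    have "real (card {h \<in> ?\<Omega>. t h}) \<le> (2 + 3 * real m ^ 3) * (2 * exp (- (m / 8192))) * card ?\<Omega>"
      unfolding t(1) k_def using m(4) by (intro irregular_rare i m1 m(2) U t) simp
    then have "4 * (real d + 1) * card {h \<in> ?\<Omega>. t h} \<le>
        4 * (real d + 1) * ((2 + 3 * real m ^ 3) * (2 * exp (- (m / 8192))) * card ?\<Omega>)"
      by (intro mult_left_mono) auto
    also have "\<dots> = (real d + 1) * (8 * ((2 + 3 * real m ^ 3) * exp (- (m / 8192))) * card ?\<Omega>)"
      by (simp add: algebra_simps)
    also have "\<dots> \<le> (real m + 1) ^ 6 * (8 * ((2 + 3 * real m ^ 3) * exp (- (m / 8192))) * card ?\<Omega>)"
    proof (rule mult_right_mono)
      have "d + 1 \<le> (m + 1) ^ 6" using m(3) by simp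
      then have "real (d + 1) \<le> real ((m + 1) ^ 6)" by (rule of_nat_mono)
      then show "real d + 1 \<le> (real m + 1) ^ 6" by (simp add: add.commute)
    qed auto
    also have "\<dots> = 8 * (real m + 1) ^ 6 * ((2 + 3 * real m ^ 3) * exp (- (m / 8192))) * card ?\<Omega>"
      by (simp add: algebra_simps)
    also have "\<dots> \<le> 1 * real (card ?\<Omega>)"
      using m(1) by (intro mult_right_mono exp_beats_polynomial) linarith+
    finally have "real (4 * (d + 1) * card {h \<in> ?\<Omega>. t h}) \<le> real (card ?\<Omega>)" by (simp add: add.commute)
    then show ?thesis by (simp only: of_nat_le_iff)
  qed
  have "?\<Omega> \<noteq> {}"
    using m1 by (auto simp: hash_space_def PiE_eq_empty_iff k_def lessThan_empty_iff)
  moreover have "finite \<T>" unfolding \<T>_def by (intro finite_imageI finite_subset[OF _ finA]) auto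
  ultimately obtain F where F: "\<forall>r<n ^ 4. F r \<in> ?\<Omega>" "\<forall>t\<in>\<T>. (d + 1) * card {r. r < n ^ 4 \<and> t (F r)} \<le> n ^ 4"
    using sparse_family[OF finite_hash_space _ _ card\<T> rare _ \<tau>] by auto
  have "(d + 1) * card {r. r < n ^ 4 \<and> irregular i n d m U N P (F r)} \<le> n ^ 4"
    if "N \<subseteq> {..<n}" "P \<subseteq> {..<q}" "card P \<le> n" "card N * m ^ i \<le> 2 ^ i * d" "card P * m ^ i \<le> 2 * 2 ^ i * d"
    for N P
  proof -
    have "irregular i n d m U N P \<in> \<T>"
      unfolding \<T>_def by (rule image_eqI[of _ _ "(N, P)"]) (use that in \<open>auto simp: A_def\<close>)
    then show ?thesis using F(2) by blast
  qed
  then show ?thesis using F(1) unfolding regular_family_def k_def by blast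
qed

definition root6 :: "nat \<Rightarrow> nat" where
  "root6 d = (LEAST m. d < (m + 1) ^ 6)"

lemma root6: "root6 d ^ 6 \<le> d" "d < (root6 d + 1) ^ 6"
proof -
  have "d < (d + 1) ^ 6" using self_le_power[of "d + 1" 6] by simp
  then show "d < (root6 d + 1) ^ 6" unfolding root6_def by (rule LeastI)
  show "root6 d ^ 6 \<le> d"
  proof (cases "root6 d")
    case (Suc m)
    then have "\<not> d < (m + 1) ^ 6" using not_less_Least[of m "\<lambda>m. d < (m + 1) ^ 6"] by (simp add: root6_def)
    then show ?thesis using Suc by simp
  qed simp
qed

section \<open>The coloring algorithm\<close>

lemma sum_of_bool_eq_card:
  "(\<Sum>v<(n::nat). of_bool (P v) :: nat) = card {v. v < n \<and> P v}"
  by (simp add: of_bool_def sum.If_cases lessThan_def Int_def)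

text \<open>The product of the number of nodes and of their degrees within a bin, counted in units of
  \<open>n / m\<^sup>3\<close> and \<open>\<Delta> / m\<^sup>3\<close>, is linear because \<open>\<Delta> < (m + 1)\<^sup>6\<close>.\<close>

lemma bin_words_bound:
  fixes f :: "nat \<Rightarrow> nat"
  assumes "finite X" and m: "m \<ge> 1" "m ^ 6 \<le> d" "d < (m + 1) ^ 6"
    and X: "card X * m ^ 3 \<le> 8 * n" and f: "\<And>v. v \<in> X \<Longrightarrow> f v * m ^ 3 \<le> 8 * d"
  shows "(\<Sum>v\<in>X. 2 * f v + 1) \<le> 8704 * n"
proof -
  have "m ^ 3 \<le> m ^ 6" using m(1) by (intro power_increasing) auto
  then have "m ^ 3 \<le> d" using m(2) by linarith
  have "(\<Sum>v\<in>X. 2 * f v + 1) * m ^ 3 = (\<Sum>v\<in>X. (2 * f v + 1) * m ^ 3)"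
    by (rule sum_distrib_right)
  \<comment> \<open>The summand 1 costs \<open>m ^ 3 \<le> d\<close>, so a node accounts for at most
    \<open>16 * d + d\<close>. With \<open>d \<le> 64 * m ^ 6\<close> the constant becomes
    \<open>8 * 17 * 64 = 8704\<close>.\<close>
  also have "\<dots> \<le> of_nat (card X) * (17 * d)"
  proof (rule sum_bounded_above)
    fix v assume "v \<in> X"
    from f[OF this] \<open>m ^ 3 \<le> d\<close> show "(2 * f v + 1) * m ^ 3 \<le> 17 * d"
      by (simp add: add_mult_distrib)
  qed
  finally have "(\<Sum>v\<in>X. 2 * f v + 1) * m ^ 3 * m ^ 3 \<le> card X * (17 * d) * m ^ 3"
    by (intro mult_right_mono) auto
  also have "\<dots> = card X * m ^ 3 * (17 * d)" by simp
  also have "\<dots> \<le> 8 * n * (17 * d)" using X by (rule mult_right_mono) simp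
  also have "\<dots> \<le> 8 * n * (17 * (64 * m ^ 6))"
  proof (intro mult_left_mono)
    have "(m + 1) ^ 6 \<le> (2 * m) ^ 6" using m(1) by (intro power_mono) auto
    then show "d \<le> 64 * m ^ 6" using m(3) by (simp add: power_mult_distrib)
  qed auto
  finally have "(\<Sum>v\<in>X. 2 * f v + 1) * m ^ 6 \<le> 8704 * n * m ^ 6"
    by (simp add: mult.assoc flip: power_add)
  then show ?thesis using m(1) by simp
qed

context list_coloring_problem
begin

lemma common_with_\<Delta>:
  assumes "common G"
  shows "common (\<lambda>j. (\<Delta> j, G j))"
  using assms
proof (rule knows_local, intro local_fromI)
  fix j j' v
  assume *: "j \<in> instances" "j' \<in> instances" "v < nodes j" "v < nodes j'" "input j v = input j' v" "G j = G j'"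
  show "(\<Delta> j, G j) = (\<Delta> j', G j')"
    using palette(1)[OF *(1,3)] palette(1)[OF *(2,4)] input_eqD(2)[OF *(5)] *(6) by simp
qed

section \<open>Residual palettes and partial colorings\<close>

definition residual :: "coloring_instance \<Rightarrow> (nat \<Rightarrow> nat) \<Rightarrow> nat set \<Rightarrow> nat \<Rightarrow> nat set" where
  "residual j \<phi> R v = palette j v - \<phi> ` (nbrs j v - R)"

definition partial_coloring :: "coloring_instance \<Rightarrow> (nat \<Rightarrow> nat) \<Rightarrow> nat set \<Rightarrow> bool" where
  "partial_coloring j \<phi> R \<longleftrightarrow> R \<subseteq> {..<nodes j} \<and> (\<forall>v<nodes j. v \<notin> R \<longrightarrow> \<phi> v \<in> palette j v \<and>
     (\<forall>u<nodes j. u \<notin> R \<longrightarrow> u \<in> nbrs j v \<longrightarrow> \<phi> u \<noteq> \<phi> v))"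

lemma residual_le:
  assumes "j \<in> instances" "v < nodes j"
  shows "finite (residual j \<phi> R v)" "card (residual j \<phi> R v) \<le> nodes j"
    "\<Delta> j + 1 \<le> card (residual j \<phi> R v) + card (nbrs j v - R)"
proof -
  have p: "finite (palette j v)" "card (palette j v) = \<Delta> j + 1" using palette[OF assms] by auto
  show "finite (residual j \<phi> R v)" using p by (simp add: residual_def)
  have "card (residual j \<phi> R v) \<le> \<Delta> j + 1"
    unfolding residual_def p(2)[symmetric] using p(1) by (intro card_mono) auto
  then show "card (residual j \<phi> R v) \<le> nodes j" using \<Delta>_less[OF assms(1)] by linarith
  have fin: "finite (nbrs j v - R)" using finite_nbrs[OF assms(1)] by blast
  have "card (palette j v) \<le> card (residual j \<phi> R v) + card (\<phi> ` (nbrs j v - R))"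
    unfolding residual_def using fin diff_card_le_card_Diff[of "\<phi> ` (nbrs j v - R)" "palette j v"] by simp
  then show "\<Delta> j + 1 \<le> card (residual j \<phi> R v) + card (nbrs j v - R)"
    using p(2) card_image_le[OF fin, of \<phi>] by linarith
qed

text \<open>\<open>R\<close> is the set of uncolored nodes. Each colored neighbor removes at most
  one color, so the surplus over the uncolored neighbors stays positive whatever has been colored
  before.\<close>

lemma residual_ge:
  assumes "j \<in> instances" "v < nodes j"
  shows "\<Delta> j + 1 - card (nbrs j v) + card (nbrs j v \<inter> R) \<le> card (residual j \<phi> R v)"
proof -
  have "card (nbrs j v) = card (nbrs j v \<inter> R) + card (nbrs j v - R)"
    using finite_nbrs[OF assms(1), of v] card_Int_Diff by blast
  then show ?thesis using residual_le(3)[OF assms, of \<phi> R] card_nbrs_le[OF assms] by linarith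
qed

lemma partial_coloring_extend:
  assumes \<phi>: "partial_coloring j \<phi> R" and X: "X \<subseteq> R"
    and f: "\<And>v. v \<in> X \<Longrightarrow> f v \<in> residual j \<phi> R v"
    "\<And>u v. u \<in> X \<Longrightarrow> v \<in> X \<Longrightarrow> u \<in> nbrs j v \<Longrightarrow> f u \<noteq> f v"
  shows "partial_coloring j (\<lambda>v. if v \<in> X then f v else \<phi> v) (R - X)"
proof -
  have old: "f v \<noteq> \<phi> u" if "v \<in> X" "u \<notin> R" "u \<in> nbrs j v" for u v
    using f(1)[OF that(1)] that by (auto simp: residual_def)
  have old': "f v \<noteq> \<phi> u" if "v \<in> X" "u \<notin> R" "v \<in> nbrs j u" for u v
    using old[OF that(1,2)] that(3) nbrs_commute by blast
  have pal: "f v \<in> palette j v" if "v \<in> X" for v using f(1)[OF that] by (simp add: residual_def)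
  show ?thesis
    unfolding partial_coloring_def
  proof (intro conjI allI impI)
    show "R - X \<subseteq> {..<nodes j}" using \<phi> by (auto simp: partial_coloring_def)
    fix v assume v: "v < nodes j" "v \<notin> R - X"
    show "(if v \<in> X then f v else \<phi> v) \<in> palette j v"
      using v pal \<phi> by (auto simp: partial_coloring_def)
    fix u assume u: "u < nodes j" "u \<notin> R - X" "u \<in> nbrs j v"
    show "(if u \<in> X then f u else \<phi> u) \<noteq> (if v \<in> X then f v else \<phi> v)"
    proof (cases "u \<in> X"; cases "v \<in> X")
      assume "u \<in> X" "v \<in> X"
      then show ?thesis using f(2) u(3) by simp
    next
      assume "u \<in> X" "v \<notin> X"
      then show ?thesis using old'[of u v] u v by auto
    next
      assume "u \<notin> X" "v \<in> X"
      then show ?thesis using old[of v u] u v by fastforce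
    next
      assume "u \<notin> X" "v \<notin> X"
      then show ?thesis using u v \<phi> by (auto simp: partial_coloring_def)
    qed
  qed
qed

text \<open>Neighbors in the same bin are separated by \<open>color_step\<close>, neighbors in
  different bins by the disjointness of their palettes, and colored neighbors by the residual
  palettes.\<close>

lemma extend_coloring:
  assumes G: "common G" "common_from G X" "common_from G l" "local_from (\<lambda>j v. G j) P"
    and \<phi>: "\<And>j. j \<in> instances \<Longrightarrow> partial_coloring j (\<phi> j) (R j)"
    and X: "\<And>j. j \<in> instances \<Longrightarrow> X j \<subseteq> R j"
    and l: "\<And>j v. j \<in> instances \<Longrightarrow> v < nodes j \<Longrightarrow> l j v < nodes j"
    and P: "\<And>j v. j \<in> instances \<Longrightarrow> v \<in> X j \<Longrightarrow> P j v \<subseteq> residual j (\<phi> j) (R j) v"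
    and bins: "\<And>j u v. j \<in> instances \<Longrightarrow> u \<in> X j \<Longrightarrow> v \<in> X j \<Longrightarrow> l j u \<noteq> l j v \<Longrightarrow> P j u \<inter> P j v = {}"
    and slack: "\<And>j v. j \<in> instances \<Longrightarrow> v \<in> X j \<Longrightarrow>
      card {u \<in> X j. u \<in> nbrs j v \<and> l j u = l j v} < card (P j v)"
    and C: "C > 0" and bound: "\<And>j i. j \<in> instances \<Longrightarrow> i < nodes j \<Longrightarrow>
      (\<Sum>v | v \<in> X j \<and> l j v = i. 2 * card {u \<in> X j. u \<in> nbrs j v \<and> l j u = l j v} + 1) \<le> C * nodes j"
  obtains f where "common (\<lambda>j. (G j, f j))"
    "\<And>j. j \<in> instances \<Longrightarrow> partial_coloring j (\<lambda>v. if v \<in> X j then f j v else \<phi> j v) (R j - X j)"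
proof -
  have sub: "X j \<subseteq> {..<nodes j}" if "j \<in> instances" for j
    using \<phi>[OF that] X[OF that] by (auto simp: partial_coloring_def)
  have pal: "P j v \<subseteq> palette j v" if "j \<in> instances" "v \<in> X j" for j v
    using P[OF that] by (auto simp: residual_def)
  obtain f where f: "common (\<lambda>j. (G j, f j))"
    "\<And>j v. j \<in> instances \<Longrightarrow> v \<in> X j \<Longrightarrow> f j v \<in> P j v"
    "\<And>j u v. j \<in> instances \<Longrightarrow> u \<in> X j \<Longrightarrow> v \<in> X j \<Longrightarrow> u \<in> nbrs j v \<Longrightarrow> l j u = l j v \<Longrightarrow> f j u \<noteq> f j v"
    using color_step[OF G(1,2) sub G(3) l G(4) pal slack C bound] by blast
  show thesis
  proof (rule that[OF f(1)])
    fix j assume j: "j \<in> instances"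
    show "partial_coloring j (\<lambda>v. if v \<in> X j then f j v else \<phi> j v) (R j - X j)"
    proof (rule partial_coloring_extend[OF \<phi>[OF j] X[OF j]])
      show "f j v \<in> residual j (\<phi> j) (R j) v" if "v \<in> X j" for v
        using f(2)[OF j that] P[OF j that] by blast
      show "f j u \<noteq> f j v" if "u \<in> X j" "v \<in> X j" "u \<in> nbrs j v" for u v
      proof (cases "l j u = l j v")
        case True
        then show ?thesis using f(3)[OF j that] by simp
      next
        case False
        then show ?thesis using bins[OF j that(1,2)] f(2)[OF j that(1)] f(2)[OF j that(2)] by auto
      qed
    qed
  qed
qed

lemma local_residual:
  assumes "input j v = input j' v" "\<phi> j = \<phi> j'" "R j = R j'"
  shows "residual j (\<phi> j) (R j) v = residual j' (\<phi> j') (R j') v"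
  using input_eqD[OF assms(1)] assms(2,3) by (simp add: residual_def)

text \<open>A single bin with leader 0. The colors are not partitioned, so
  \<open>residual_ge\<close> provides enough of them for any set \<open>X\<close> of uncolored
  nodes, and only the number of words matters.\<close>

lemma extend_coloring_at_leader:
  assumes G: "common G" "common_from G X" "common_from G \<phi>" "common_from G R"
    and \<phi>: "\<And>j. j \<in> instances \<Longrightarrow> partial_coloring j (\<phi> j) (R j)"
    and X: "\<And>j. j \<in> instances \<Longrightarrow> X j \<subseteq> R j"
    and C: "C > 0" and bound: "\<And>j. j \<in> instances \<Longrightarrow>
      (\<Sum>v\<in>X j. 2 * card (nbrs j v \<inter> X j) + 1) \<le> C * nodes j"
  obtains f where "common (\<lambda>j. (G j, f j))"
    "\<And>j. j \<in> instances \<Longrightarrow> partial_coloring j (\<lambda>v. if v \<in> X j then f j v else \<phi> j v) (R j - X j)"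
proof (rule extend_coloring[OF G(1,2) _ _ \<phi> X, where l = "\<lambda>j v. 0" and C = C
    and P = "\<lambda>j v. residual j (\<phi> j) (R j) v"])
  show "common_from G (\<lambda>j v. 0)" by (rule common_fromI) simp
  show "local_from (\<lambda>j v. G j) (\<lambda>j. residual j (\<phi> j) (R j))"
  proof (rule local_fromI)
    fix j j' v
    assume *: "j \<in> instances" "j' \<in> instances" "nodes j = nodes j'" "input j v = input j' v" "G j = G j'"
    show "residual j (\<phi> j) (R j) v = residual j' (\<phi> j') (R j') v"
      by (rule local_residual[OF *(4) common_fromD[OF G(3) *(1-3,5)] common_fromD[OF G(4) *(1-3,5)]])
  qed
  show "0 < nodes j" if "j \<in> instances" for j using size_pos[OF that] by simp
  have int: "{u \<in> X j. u \<in> nbrs j v \<and> (0::nat) = 0} = nbrs j v \<inter> X j" for j v by auto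
  show "card {u \<in> X j. u \<in> nbrs j v \<and> (0::nat) = 0} < card (residual j (\<phi> j) (R j) v)"
    if j: "j \<in> instances" and v: "v \<in> X j" for j v
  proof -
    have "v < nodes j" using \<phi>[OF j] X[OF j] v by (auto simp: partial_coloring_def)
    then have "card (nbrs j v \<inter> R j) < card (residual j (\<phi> j) (R j) v)"
      using residual_ge[OF j, of v "R j" "\<phi> j"] card_nbrs_le[OF j, of v] by linarith
    moreover have "card (nbrs j v \<inter> X j) \<le> card (nbrs j v \<inter> R j)"
      using X[OF j] finite_nbrs[OF j, of v] by (intro card_mono) auto
    ultimately show ?thesis unfolding int by linarith
  qed
  show "(\<Sum>v | v \<in> X j \<and> 0 = i. 2 * card {u \<in> X j. u \<in> nbrs j v \<and> (0::nat) = 0} + 1) \<le> C * nodes j"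
    if "j \<in> instances" for j i
    using bound[OF that] unfolding int by (cases "i = 0") auto
qed (use C that in auto)

text \<open>The threshold required by \<open>regular_family_exists\<close>. Below it \<Delta> is
  bounded by a constant that depends only on \<open>c\<close>.\<close>

definition large_root :: nat where "large_root = 2560 * 81920 ^ 10 + 2 * c + 6"

text \<open>\<open>U\<close> holds the nodes still in play and \<open>B\<close> those postponed to
  the end. If the root is small, \<open>B\<close> starts with all nodes, and \<Delta> + 1 is at most
  \<open>large_root ^ 6\<close>; each stage then adds at most \<open>n / (\<Delta> + 1)\<close>
  nodes, whence \<open>large_root ^ 6 + i\<close>. The last conjunct bounds the residual palettes
  from below via \<open>residual_ge\<close>. It counts the neighbors in \<open>B\<close> as well,
  since these have used up no color, and it differs from the bound on the degrees by the factor
  \<open>4 ^ i\<close> only, so that the surplus of a bin remains of the right order.\<close>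

definition stage_invariant :: "nat \<Rightarrow> coloring_instance \<Rightarrow> (nat \<Rightarrow> nat) \<Rightarrow> nat set \<Rightarrow> nat set \<Rightarrow> bool" where
  "stage_invariant i j \<phi> U B \<longleftrightarrow> (let m = root6 (\<Delta> j) in
     partial_coloring j \<phi> (U \<union> B) \<and> U \<inter> B = {} \<and>
     card B * (\<Delta> j + 1) \<le> (large_root ^ 6 + i) * nodes j \<and>
     (m < large_root \<longrightarrow> U = {}) \<and>
     card U * m ^ i \<le> 2 ^ i * nodes j \<and>
     (\<forall>v\<in>U. card (nbrs j v \<inter> U) * m ^ i \<le> 2 ^ i * \<Delta> j \<and>
        \<Delta> j \<le> (2 * m) ^ i * (\<Delta> j - card (nbrs j v) + card (nbrs j v \<inter> (U \<union> B)))))"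

text \<open>A residual palette may be far larger than the degree bound of the stage, and its
  expected share in a bin would then be too large for the tolerance. One color more than the degree
  bound is enough.\<close>

definition stage_palette :: "nat \<Rightarrow> coloring_instance \<Rightarrow> (nat \<Rightarrow> nat) \<Rightarrow> nat set \<Rightarrow> nat set \<Rightarrow> nat \<Rightarrow> nat set" where
  "stage_palette i j \<phi> U B v =
     trim (2 ^ i * \<Delta> j div root6 (\<Delta> j) ^ i + 1) (residual j \<phi> (U \<union> B) v)"

lemma stage_palette:
  assumes j: "j \<in> instances" and inv: "stage_invariant i j \<phi> U B" and v: "v \<in> U" and i: "i \<le> 2"
  defines "m \<equiv> root6 (\<Delta> j)" and "P \<equiv> stage_palette i j \<phi> U B v"
  shows "P \<subseteq> residual j \<phi> (U \<union> B) v" "P \<subseteq> colors (nodes j)" "card P \<le> nodes j"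
    "card (nbrs j v \<inter> U) < card P" "\<Delta> j \<le> (2 * m) ^ i * card P" "card P * m ^ i \<le> 2 * 2 ^ i * \<Delta> j"
proof -
  let ?R = "residual j \<phi> (U \<union> B) v" and ?s = "2 ^ i * \<Delta> j div m ^ i + 1"
  have vn: "v < nodes j" using inv v by (auto simp: stage_invariant_def Let_def partial_coloring_def)
  have I: "card (nbrs j v \<inter> U) * m ^ i \<le> 2 ^ i * \<Delta> j"
    "\<Delta> j \<le> (2 * m) ^ i * (\<Delta> j - card (nbrs j v) + card (nbrs j v \<inter> (U \<union> B)))"
    "large_root \<le> m"
    using inv v by (auto simp: stage_invariant_def Let_def m_def not_less)
  have m: "m \<ge> 1" using I(3) by (simp add: large_root_def)
  then have mi: "m ^ i > 0" by simp
  have cardP: "card P = min ?s (card ?R)" and sub: "P \<subseteq> ?R"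
    unfolding P_def stage_palette_def m_def by (simp_all add: trim)
  show "P \<subseteq> ?R" by (rule sub)
  then show "P \<subseteq> colors (nodes j)" using palette(2)[OF j vn] by (auto simp: residual_def)
  show "card P \<le> nodes j" using cardP residual_le(2)[OF j vn, of \<phi> "U \<union> B"] by simp
  have R: "\<Delta> j + 1 - card (nbrs j v) + card (nbrs j v \<inter> (U \<union> B)) \<le> card ?R" by (rule residual_ge[OF j vn])
  have "card (nbrs j v \<inter> U) \<le> 2 ^ i * \<Delta> j div m ^ i"
    using I(1) mi by (simp add: less_eq_div_iff_mult_less_eq)
  moreover have "card (nbrs j v \<inter> U) \<le> card (nbrs j v \<inter> (U \<union> B))"
    using finite_nbrs[OF j, of v] by (intro card_mono) auto
  ultimately show "card (nbrs j v \<inter> U) < card P"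
    using cardP R card_nbrs_le[OF j vn] by linarith
  show "\<Delta> j \<le> (2 * m) ^ i * card P"
  \<comment> \<open>Either the palette has the full size \<open>?s\<close>, more than
    \<open>2 ^ i * \<Delta> / m ^ i\<close>, or it is the whole residual palette and the invariant
    applies.\<close>
  proof (cases "?s \<le> card ?R")
    case True
    have "1 * \<Delta> j \<le> 2 ^ i * \<Delta> j" by (intro mult_right_mono) auto
    also have "\<dots> \<le> m ^ i * ?s"
      using dividend_less_times_div[OF mi, of "2 ^ i * \<Delta> j"] by simp
    also have "\<dots> \<le> (2 * m) ^ i * ?s"
      by (intro mult_right_mono power_mono) auto
    finally show ?thesis using True cardP by simp
  next
    case False
    have "(2 * m) ^ i * (\<Delta> j - card (nbrs j v) + card (nbrs j v \<inter> (U \<union> B))) \<le> (2 * m) ^ i * card P"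
      using R False cardP by (intro mult_left_mono) auto
    then show ?thesis using I(2) by linarith
  qed
  show "card P * m ^ i \<le> 2 * 2 ^ i * \<Delta> j"
  proof -
    have "card P * m ^ i \<le> ?s * m ^ i" unfolding cardP by (intro mult_right_mono) auto
    also have "\<dots> \<le> 2 ^ i * \<Delta> j + m ^ i" by (simp add: add_mult_distrib div_times_less_eq_dividend)
    also have "m ^ i \<le> 2 ^ i * \<Delta> j"
    proof -
      have "m ^ i \<le> m ^ 6" using m i by (intro power_increasing) auto
      also have "\<dots> \<le> 1 * \<Delta> j" using root6(1) by (simp add: m_def)
      also have "\<dots> \<le> 2 ^ i * \<Delta> j" by (intro mult_right_mono) auto
      finally show ?thesis .
    qed
    finally show ?thesis by simp
  qed
qed

text \<open>A node is irregular for at most a fraction \<open>1 / (\<Delta> + 1)\<close> of the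
  family. By double counting, a member that costs no more than the average has at most
  \<open>n / (\<Delta> + 1)\<close> bad nodes, and these form \<open>Z\<close>.\<close>

lemma stage_hash:
  assumes i: "i \<le> 2" and G: "common (\<lambda>j. (\<phi> j, U j, B j))"
    and inv: "\<And>j. j \<in> instances \<Longrightarrow> stage_invariant i j (\<phi> j) (U j) (B j)"
  obtains h Z where "common (\<lambda>j. (\<Delta> j, \<phi> j, U j, B j, h j, Z j))"
    "\<And>j. j \<in> instances \<Longrightarrow> (\<Delta> j + 1) * card (Z j) \<le> nodes j"
    "\<And>j. j \<in> instances \<Longrightarrow> Z j \<subseteq> U j"
    "\<And>j. j \<in> instances \<Longrightarrow> U j \<noteq> {} \<Longrightarrow>
       h j \<in> hash_space (nodes j + 2 ^ (c * floorlog 2 (nodes j))) (root6 (\<Delta> j)) (root6 (\<Delta> j) ^ (3 - i))"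
    "\<And>j v. j \<in> instances \<Longrightarrow> v \<in> U j - Z j \<Longrightarrow>
       \<not> irregular i (nodes j) (\<Delta> j) (root6 (\<Delta> j)) (U j) (nbrs j v \<inter> U j)
            (stage_palette i j (\<phi> j) (U j) (B j) v) (h j)"
proof -
  define q where "q j = (2::nat) ^ (c * floorlog 2 (nodes j))" for j :: coloring_instance
  define m where "m j = root6 (\<Delta> j)" for j
  \<comment> \<open>\<open>SOME\<close> sees only \<Delta>, \<open>U\<close> and the number of
    nodes, so all nodes pick the same family without communication.\<close>
  define F where "F j = (SOME F. regular_family i (nodes j) (q j) (\<Delta> j) (m j) (U j) F)" for j
  define bad where "bad j v h \<longleftrightarrow> v \<in> U j \<and> irregular i (nodes j) (\<Delta> j) (m j) (U j)
      (nbrs j v \<inter> U j) (stage_palette i j (\<phi> j) (U j) (B j) v) h" for j v h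
  have G1: "common (\<lambda>j. (\<Delta> j, \<phi> j, U j, B j))" by (rule common_with_\<Delta>[OF G])
  have F_eq: "F j = F j'" if "nodes j = nodes j'" "\<Delta> j = \<Delta> j'" "U j = U j'" for j j'
    unfolding F_def m_def q_def that ..
  have bad_eq: "bad j v = bad j' v" if "nodes j = nodes j'" "input j v = input j' v"
    "\<Delta> j = \<Delta> j'" "\<phi> j = \<phi> j'" "U j = U j'" "B j = B j'" for j j' v
    unfolding bad_def fun_eq_iff m_def stage_palette_def residual_def that(1,3-6) input_eqD[OF that(2)] by simp
  define a where "a j v r = (of_bool (bad j v (F j r)) :: nat)" for j v r
  obtain r where r: "common (\<lambda>j. ((\<Delta> j, \<phi> j, U j, B j), r j))"
    "\<And>j. j \<in> instances \<Longrightarrow> r j < nodes j ^ 4"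
    "\<And>j. j \<in> instances \<Longrightarrow>
       nodes j ^ 4 * (\<Sum>v<nodes j. a j v (r j)) \<le> (\<Sum>r<nodes j ^ 4. \<Sum>v<nodes j. a j v r)"
  proof (rule common_select[OF G1, of a 4])
    show "local_from (\<lambda>j v. (\<Delta> j, \<phi> j, U j, B j)) a"
    proof (rule local_fromI)
      fix j j' v
      assume "nodes j = nodes j'" "input j v = input j' v" "(\<Delta> j, \<phi> j, U j, B j) = (\<Delta> j', \<phi> j', U j', B j')"
      then have "bad j v = bad j' v" "F j = F j'" by (auto intro: bad_eq F_eq)
      then show "a j v = a j' v" by (intro ext) (simp only: a_def)
    qed
  qed (auto simp: a_def)
  define h where "h j = F j (r j)" for j
  define Z where "Z j = {v. v < nodes j \<and> bad j v (h j)}" for j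
  have "knows (\<lambda>j v. (((\<Delta> j, \<phi> j, U j, B j), r j), restrict (\<lambda>v. bad j v (h j)) {..<nodes j}))"
  proof (rule knows_broadcast[OF r(1)])
    show "local_from (\<lambda>j v. ((\<Delta> j, \<phi> j, U j, B j), r j)) (\<lambda>j v. bad j v (h j))"
    proof (rule local_fromI)
      fix j j' v
      assume "nodes j = nodes j'" "input j v = input j' v"
        "((\<Delta> j, \<phi> j, U j, B j), r j) = ((\<Delta> j', \<phi> j', U j', B j'), r j')"
      then have "bad j v = bad j' v" "F j = F j'" "r j = r j'" by (auto intro: bad_eq F_eq)
      then show "bad j v (h j) = bad j' v (h j')" by (simp only: h_def)
    qed
    show "small_sets (\<lambda>n. UNIV :: bool set)"
      using two_le_power_floorlog by (intro small_setsI[of _ 1]) auto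
  qed simp
  then have common: "common (\<lambda>j. (\<Delta> j, \<phi> j, U j, B j, h j, Z j))"
  proof (rule common_map, intro common_fromI)
    fix j j'
    assume n: "nodes j = nodes j'" and *: "(((\<Delta> j, \<phi> j, U j, B j), r j), restrict (\<lambda>v. bad j v (h j)) {..<nodes j}) =
      (((\<Delta> j', \<phi> j', U j', B j'), r j'), restrict (\<lambda>v. bad j' v (h j')) {..<nodes j'})"
    then have "bad j v (h j) = bad j' v (h j')" if "v < nodes j'" for v
      using that by (auto dest: fun_cong[of _ _ v])
    then have "Z j = Z j'" using n by (auto simp: Z_def)
    moreover have "F j = F j'" "r j = r j'" using n * by (auto intro: F_eq)
    ultimately show "(\<Delta> j, \<phi> j, U j, B j, h j, Z j) = (\<Delta> j', \<phi> j', U j', B j', h j', Z j')"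
      using * by (simp add: h_def)
  qed
  have family: "regular_family i (nodes j) (q j) (\<Delta> j) (m j) (U j) (F j)" if j: "j \<in> instances" and ne: "U j \<noteq> {}" for j
  proof -
    have "large_root \<le> m j" "U j \<subseteq> {..<nodes j}" "card (U j) * m j ^ i \<le> 2 ^ i * nodes j"
      using inv[OF j] ne by (auto simp: stage_invariant_def Let_def m_def partial_coloring_def not_less)
    then have "\<exists>F. regular_family i (nodes j) (q j) (\<Delta> j) (m j) (U j) F"
      by (intro regular_family_exists[where c = c] i root6[of "\<Delta> j", folded m_def] \<Delta>_less[OF j])
        (simp_all only: large_root_def q_def)
    then show ?thesis unfolding F_def by (rule someI_ex)
  qed
  show thesis
  proof (rule that[OF common])
    fix j assume j: "j \<in> instances"
    show "Z j \<subseteq> U j" by (auto simp: Z_def bad_def)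
    have n4: "nodes j ^ 4 > 0" using size_pos[OF j] by simp
    show "(\<Delta> j + 1) * card (Z j) \<le> nodes j"
    proof (cases "U j = {}")
      case False
      let ?n = "nodes j"
      have node: "(\<Delta> j + 1) * (\<Sum>r<?n ^ 4. a j v r) \<le> ?n ^ 4" for v
      proof (cases "v \<in> U j")
        case True
        note P = stage_palette[OF j inv[OF j] True i]
        have "card (nbrs j v \<inter> U j) * m j ^ i \<le> 2 ^ i * \<Delta> j"
          using inv[OF j] True by (auto simp: stage_invariant_def Let_def m_def)
        moreover have "nbrs j v \<inter> U j \<subseteq> {..<?n}" using nbrs_subset[OF j] by blast
        moreover have "stage_palette i j (\<phi> j) (U j) (B j) v \<subseteq> {..<q j}"
          using P(2) by (simp add: colors_def q_def)
        ultimately have "(\<Delta> j + 1) * card {r. r < ?n ^ 4 \<and> irregular i ?n (\<Delta> j) (m j) (U j)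
            (nbrs j v \<inter> U j) (stage_palette i j (\<phi> j) (U j) (B j) v) (F j r)} \<le> ?n ^ 4"
          using family[OF j False] P(3,6) unfolding regular_family_def m_def by blast
        then show ?thesis unfolding a_def sum_of_bool_eq_card using True by (simp add: bad_def)
      qed (simp add: a_def bad_def)
      have "?n ^ 4 * ((\<Delta> j + 1) * card (Z j)) = (\<Delta> j + 1) * (?n ^ 4 * (\<Sum>v<?n. a j v (r j)))"
        unfolding a_def sum_of_bool_eq_card Z_def h_def by (simp only: mult.left_commute)
      also have "\<dots> \<le> (\<Delta> j + 1) * (\<Sum>r<?n ^ 4. \<Sum>v<?n. a j v r)"
        using r(3)[OF j] by (rule mult_le_mono2)
      also have "\<dots> = (\<Sum>v<?n. (\<Delta> j + 1) * (\<Sum>r<?n ^ 4. a j v r))"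
        by (subst sum.swap) (simp only: sum_distrib_left)
      also have "\<dots> \<le> of_nat (card {..<?n}) * ?n ^ 4"
        using node by (intro sum_bounded_above) auto
      also have "\<dots> = ?n ^ 4 * ?n" by simp
      finally show ?thesis using n4 by (simp only: mult_le_cancel1)
    qed (simp add: Z_def bad_def)
    show "h j \<in> hash_space (nodes j + 2 ^ (c * floorlog 2 (nodes j))) (root6 (\<Delta> j)) (root6 (\<Delta> j) ^ (3 - i))"
      if "U j \<noteq> {}"
      using family[OF j that] r(2)[OF j] by (simp add: regular_family_def h_def m_def q_def)
    show "\<not> irregular i (nodes j) (\<Delta> j) (root6 (\<Delta> j)) (U j) (nbrs j v \<inter> U j)
            (stage_palette i j (\<phi> j) (U j) (B j) v) (h j)" if v: "v \<in> U j - Z j" for v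
    proof -
      have "v < nodes j" using v inv[OF j] by (auto simp: stage_invariant_def Let_def partial_coloring_def)
      then show ?thesis using v by (auto simp: Z_def bad_def m_def)
    qed
  qed
qed

text \<open>The nodes of the bins are colored unless they are bad, leftover nodes remain in
  \<open>U'\<close>, and bad nodes of either kind move to \<open>B'\<close>. Taking bad nodes out of
  a bin only lowers the degrees there.\<close>

lemma stage:
  assumes i: "i \<le> 2" and G: "common (\<lambda>j. (\<phi> j, U j, B j))"
    and inv: "\<And>j. j \<in> instances \<Longrightarrow> stage_invariant i j (\<phi> j) (U j) (B j)"
  obtains \<phi>' U' B' where "common (\<lambda>j. (\<phi>' j, U' j, B' j))"
    "\<And>j. j \<in> instances \<Longrightarrow> stage_invariant (i + 1) j (\<phi>' j) (U' j) (B' j)"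
proof -
  define m where "m j = root6 (\<Delta> j)" for j
  obtain h Z where hZ: "common (\<lambda>j. (\<Delta> j, \<phi> j, U j, B j, h j, Z j))"
    "\<And>j. j \<in> instances \<Longrightarrow> (\<Delta> j + 1) * card (Z j) \<le> nodes j"
    "\<And>j. j \<in> instances \<Longrightarrow> Z j \<subseteq> U j"
    "\<And>j. j \<in> instances \<Longrightarrow> U j \<noteq> {} \<Longrightarrow>
       h j \<in> hash_space (nodes j + 2 ^ (c * floorlog 2 (nodes j))) (root6 (\<Delta> j)) (root6 (\<Delta> j) ^ (3 - i))"
    "\<And>j v. j \<in> instances \<Longrightarrow> v \<in> U j - Z j \<Longrightarrow>
       \<not> irregular i (nodes j) (\<Delta> j) (root6 (\<Delta> j)) (U j) (nbrs j v \<inter> U j)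
            (stage_palette i j (\<phi> j) (U j) (B j) v) (h j)"
    by (rule stage_hash[OF i G inv], assumption) (rule that; assumption)
  note hZ = hZ[folded m_def]
  define G where "G j = (\<Delta> j, \<phi> j, U j, B j, h j, Z j)" for j
  define X where "X j = {v \<in> U j. fst (h j v) \<noteq> 0 \<and> v \<notin> Z j}" for j
  \<comment> \<open>Node \<open>b\<close> leads bin \<open>b\<close>, which is possible because
    \<open>m ^ (3 - i) \<le> m ^ 6 \<le> \<Delta> < n\<close>. Nodes outside \<open>X\<close> get
    the default 0.\<close>
  define l where "l j v = (if v \<in> X j then snd (h j v) else 0)" for j v
  define SP where "SP j v = stage_palette i j (\<phi> j) (U j) (B j) v" for j v
  \<comment> \<open>Each color is hashed to a single bin, so the palettes of different bins are
    disjoint.\<close>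
  define P where "P j v = {x \<in> SP j v. snd (h j (nodes j + x)) = l j v}" for j v
  define bin where "bin j b S = {u \<in> S. fst (h j u) \<noteq> 0 \<and> snd (h j u) = b}" for j b and S :: "nat set"
  have I: "partial_coloring j (\<phi> j) (U j \<union> B j)" "U j \<inter> B j = {}"
    "card (B j) * (\<Delta> j + 1) \<le> (large_root ^ 6 + i) * nodes j"
    "m j < large_root \<Longrightarrow> U j = {}" "card (U j) * m j ^ i \<le> 2 ^ i * nodes j"
    "\<And>v. v \<in> U j \<Longrightarrow> card (nbrs j v \<inter> U j) * m j ^ i \<le> 2 ^ i * \<Delta> j"
    "\<And>v. v \<in> U j \<Longrightarrow> \<Delta> j \<le> (2 * m j) ^ i * (\<Delta> j - card (nbrs j v) + card (nbrs j v \<inter> (U j \<union> B j)))"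
    if "j \<in> instances" for j
    using inv[OF that] unfolding stage_invariant_def Let_def m_def by blast+
  have U_sub: "U j \<subseteq> {..<nodes j}" if "j \<in> instances" for j
    using I(1)[OF that] by (auto simp: partial_coloring_def)
  have m6: "m j ^ 6 \<le> \<Delta> j" "\<Delta> j < (m j + 1) ^ 6" for j unfolding m_def by (rule root6)+
  have m1: "m j \<ge> 1" if "j \<in> instances" "U j \<noteq> {}" for j
    using I(4)[OF that(1)] that(2) by (cases "m j") (auto simp: large_root_def)
  have regular: "card {u \<in> U j. fst (h j u) = 0} * m j ^ (i + 1) \<le> 2 ^ (i + 1) * nodes j"
    "card (bin j b (U j)) * m j ^ 3 \<le> 8 * nodes j"
    "card {u \<in> nbrs j v \<inter> U j. fst (h j u) = 0} * m j ^ (i + 1) \<le> 2 ^ (i + 1) * \<Delta> j"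
    "card (bin j b (nbrs j v \<inter> U j)) * m j ^ 3 \<le> 5 * \<Delta> j"
    "\<And>a. \<Delta> j \<le> (2 * m j) ^ i * (a + card (nbrs j v \<inter> U j)) \<Longrightarrow>
      \<Delta> j \<le> (2 * m j) ^ (i + 1) * (a + card {u \<in> nbrs j v \<inter> U j. fst (h j u) = 0})"
    "card (bin j b (nbrs j v \<inter> U j)) < card {x \<in> SP j v. snd (h j (nodes j + x)) = b}"
    if j: "j \<in> instances" and v: "v \<in> U j - Z j" and b: "b < m j ^ (3 - i)" for j v b
  proof -
    have ne: "U j \<noteq> {}" using v by blast
    have vU: "v \<in> U j" using v by blast
    note SP = stage_palette[OF j inv[OF j] vU i, folded SP_def m_def]
    have SPc: "SP j v \<subseteq> {..<2 ^ (c * floorlog 2 (nodes j))}" using SP(2) by (simp add: colors_def)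
    have N: "nbrs j v \<inter> U j \<subseteq> {..<nodes j}" using U_sub[OF j] by blast
    note rs = regular_stage[OF hZ(4)[OF j ne] hZ(5)[OF j v, folded SP_def] U_sub[OF j] N SPc i m1[OF j ne]
      m6(1) b I(5)[OF j] I(6)[OF j vU]]
    show "card {u \<in> U j. fst (h j u) = 0} * m j ^ (i + 1) \<le> 2 ^ (i + 1) * nodes j"
      "card (bin j b (U j)) * m j ^ 3 \<le> 8 * nodes j"
      "card {u \<in> nbrs j v \<inter> U j. fst (h j u) = 0} * m j ^ (i + 1) \<le> 2 ^ (i + 1) * \<Delta> j"
      "card (bin j b (nbrs j v \<inter> U j)) * m j ^ 3 \<le> 5 * \<Delta> j"
      "\<And>a. \<Delta> j \<le> (2 * m j) ^ i * (a + card (nbrs j v \<inter> U j)) \<Longrightarrow>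
        \<Delta> j \<le> (2 * m j) ^ (i + 1) * (a + card {u \<in> nbrs j v \<inter> U j. fst (h j u) = 0})"
      "card (bin j b (nbrs j v \<inter> U j)) < card {x \<in> SP j v. snd (h j (nodes j + x)) = b}"
      unfolding bin_def using rs SP(4,5) by (blast intro: less_imp_le)+
  qed
  have hm: "snd (h j v) < m j ^ (3 - i)" if "j \<in> instances" "v \<in> U j" for j v
  proof -
    have "v < nodes j" using U_sub that by blast
    then have "h j v \<in> {..<m j} \<times> {..<m j ^ (3 - i)}"
      using PiE_mem[of "h j" _ "\<lambda>_. {..<m j} \<times> {..<m j ^ (3 - i)}" v] hZ(4)[OF that(1)] that(2)
      unfolding hash_space_def by fastforce
    then show ?thesis by (simp add: mem_Times_iff)
  qed
  have same_bin: "{u \<in> X j. u \<in> nbrs j v \<and> l j u = l j v} \<subseteq> bin j (snd (h j v)) (nbrs j v \<inter> U j)"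
    if "v \<in> X j" for j v
    using that by (auto simp: X_def l_def bin_def)
  have same_bin_le: "card {u \<in> X j. u \<in> nbrs j v \<and> l j u = l j v} \<le> card (bin j (snd (h j v)) (nbrs j v \<inter> U j))"
    if "j \<in> instances" "v \<in> X j" for j v
    using same_bin[OF that(2)] finite_nbrs[OF that(1), of v] by (intro card_mono) (auto simp: bin_def)
  have XU: "X j \<subseteq> U j - Z j" for j by (auto simp: X_def)
  obtain f where f: "common (\<lambda>j. (G j, f j))" "\<And>j. j \<in> instances \<Longrightarrow>
      partial_coloring j (\<lambda>v. if v \<in> X j then f j v else \<phi> j v) ((U j \<union> B j) - X j)"
  proof (rule extend_coloring[of G X l P \<phi> "\<lambda>j. U j \<union> B j" 8704])
    show "common G" unfolding G_def by (rule hZ(1))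
    show "common_from G X" by (rule common_fromI) (simp add: X_def G_def)
    show "common_from G l" by (rule common_fromI) (simp add: X_def l_def G_def fun_eq_iff)
    show "local_from (\<lambda>j v. G j) P"
    proof (rule local_fromI)
      fix j j' v
      assume *: "nodes j = nodes j'" "input j v = input j' v" "G j = G j'"
      then have "\<Delta> j = \<Delta> j'" "\<phi> j = \<phi> j'" "U j = U j'" "B j = B j'" "h j = h j'" "Z j = Z j'"
        by (simp_all add: G_def)
      note eqs = this *(1) input_eqD[OF *(2)]
      show "P j v = P j' v"
        unfolding P_def SP_def stage_palette_def residual_def l_def X_def eqs ..
    qed
    fix j assume j: "j \<in> instances"
    show "partial_coloring j (\<phi> j) (U j \<union> B j)" by (rule I(1)[OF j])
    show "X j \<subseteq> U j \<union> B j" by (auto simp: X_def)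
    have k_less: "m j ^ (3 - i) < nodes j" if "U j \<noteq> {}"
    proof -
      have "m j ^ (3 - i) \<le> m j ^ 6" using m1[OF j that] by (intro power_increasing) auto
      then show ?thesis using m6(1)[of j] \<Delta>_less[OF j] by linarith
    qed
    show "l j v < nodes j" for v
    proof (cases "v \<in> X j")
      case True
      then have "v \<in> U j" by (auto simp: X_def)
      then have "snd (h j v) < m j ^ (3 - i)" "m j ^ (3 - i) < nodes j" using hm[OF j] k_less by auto
      then show ?thesis using True by (simp add: l_def)
    qed (use size_pos[OF j] in \<open>simp add: l_def\<close>)
    show "P j v \<subseteq> residual j (\<phi> j) (U j \<union> B j) v" if "v \<in> X j" for v
      using stage_palette(1)[OF j inv[OF j] _ i, of v] that by (auto simp: P_def SP_def X_def)
    show "P j u \<inter> P j v = {}" if "l j u \<noteq> l j v" for u v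
      using that by (auto simp: P_def)
    show "card {u \<in> X j. u \<in> nbrs j v \<and> l j u = l j v} < card (P j v)" if v: "v \<in> X j" for v
    proof -
      have "v \<in> U j - Z j" using XU v by blast
      moreover from this have "snd (h j v) < m j ^ (3 - i)" using hm[OF j] by blast
      ultimately have "card (bin j (snd (h j v)) (nbrs j v \<inter> U j)) <
          card {x \<in> SP j v. snd (h j (nodes j + x)) = snd (h j v)}" by (rule regular(6)[OF j])
      then show ?thesis using same_bin_le[OF j v] v by (simp add: P_def l_def)
    qed
    fix b assume "b < nodes j"
    let ?X = "{v. v \<in> X j \<and> l j v = b}"
    show "(\<Sum>v | v \<in> X j \<and> l j v = b. 2 * card {u \<in> X j. u \<in> nbrs j v \<and> l j u = l j v} + 1) \<le> 8704 * nodes j"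
    proof (cases "?X = {}")
      case True
      then show ?thesis by (simp only: sum.empty)
    next
      case False
      then obtain v where v: "v \<in> X j" "l j v = b" by blast
      have b: "b < m j ^ (3 - i)" using v hm[OF j, of v] by (auto simp: l_def X_def)
      have vU: "v \<in> U j - Z j" using XU v by blast
      have finU: "finite (U j)" using U_sub[OF j] finite_subset by blast
      show ?thesis
      proof (rule bin_words_bound)
        show "m j \<ge> 1" using m1[OF j] vU by blast
        show "m j ^ 6 \<le> \<Delta> j" "\<Delta> j < (m j + 1) ^ 6" by (rule m6)+
        have sub: "?X \<subseteq> bin j b (U j)" by (auto simp: X_def bin_def l_def)
        have fin: "finite (bin j b (U j))" using finU by (simp add: bin_def)
        show "finite ?X" using sub fin by (rule finite_subset)
        have "card ?X * m j ^ 3 \<le> card (bin j b (U j)) * m j ^ 3"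
          using card_mono[OF fin sub] by (rule mult_right_mono) simp
        then show "card ?X * m j ^ 3 \<le> 8 * nodes j" using regular(2)[OF j vU b] by linarith
        fix u assume u: "u \<in> ?X"
        then have "u \<in> U j - Z j" "u \<in> X j" "snd (h j u) < m j ^ (3 - i)" using XU hm[OF j] by blast+
        then have "card (bin j (snd (h j u)) (nbrs j u \<inter> U j)) * m j ^ 3 \<le> 5 * \<Delta> j"
          using regular(4)[OF j] by blast
        moreover have "card {w \<in> X j. w \<in> nbrs j u \<and> l j w = l j u} * m j ^ 3 \<le>
            card (bin j (snd (h j u)) (nbrs j u \<inter> U j)) * m j ^ 3"
          using same_bin_le[OF j \<open>u \<in> X j\<close>] by (rule mult_right_mono) simp
        ultimately show "card {w \<in> X j. w \<in> nbrs j u \<and> l j w = l j u} * m j ^ 3 \<le> 8 * \<Delta> j" by linarith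
      qed
    qed
  qed ((rule that; assumption) | simp)+
  define \<phi>' where "\<phi>' j = (\<lambda>v. if v \<in> X j then f j v else \<phi> j v)" for j
  define U' where "U' j = {v \<in> U j. fst (h j v) = 0 \<and> v \<notin> Z j}" for j
  define B' where "B' j = B j \<union> Z j" for j
  show thesis
  proof (rule that[of \<phi>' U' B'])
    show "common (\<lambda>j. (\<phi>' j, U' j, B' j))"
    proof (rule common_map[OF f(1)], rule common_fromI)
      fix j j' assume "(G j, f j) = (G j', f j')"
      then have eqs: "f j = f j'" "\<phi> j = \<phi> j'" "U j = U j'" "B j = B j'" "h j = h j'" "Z j = Z j'"
        by (simp_all add: G_def)
      show "(\<phi>' j, U' j, B' j) = (\<phi>' j', U' j', B' j')"
        unfolding \<phi>'_def U'_def B'_def X_def eqs ..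
    qed
    fix j assume j: "j \<in> instances"
    have finU: "finite (U j)" using U_sub[OF j] finite_subset by blast
    have R: "(U j \<union> B j) - X j = U' j \<union> B' j"
      using I(2)[OF j] hZ(3)[OF j] by (auto simp: X_def U'_def B'_def)
    show "stage_invariant (i + 1) j (\<phi>' j) (U' j) (B' j)"
      unfolding stage_invariant_def Let_def m_def[symmetric]
    proof (intro conjI impI ballI)
      show "partial_coloring j (\<phi>' j) (U' j \<union> B' j)"
        using f(2)[OF j] unfolding R \<phi>'_def .
      show "U' j \<inter> B' j = {}" using I(2)[OF j] by (auto simp: U'_def B'_def)
      have "card (B' j) * (\<Delta> j + 1) \<le> (card (B j) + card (Z j)) * (\<Delta> j + 1)"
        unfolding B'_def by (intro mult_right_mono card_Un_le) simp
      also have "\<dots> \<le> (large_root ^ 6 + i) * nodes j + nodes j"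
        using add_mono[OF I(3)[OF j] hZ(2)[OF j]]
        by (simp only: add_mult_distrib[of "card (B j)"] mult.commute[of "card (Z j)"])
      finally show "card (B' j) * (\<Delta> j + 1) \<le> (large_root ^ 6 + (i + 1)) * nodes j"
        by (simp add: algebra_simps)
      show "U' j = {}" if "m j < large_root" using I(4)[OF j that] by (simp add: U'_def)
      have k0: "0 < m j ^ (3 - i)" if "v \<in> U j" for v using hm[OF j that] by linarith
      show "card (U' j) * m j ^ (i + 1) \<le> 2 ^ (i + 1) * nodes j"
      proof (cases "U' j = {}")
        case False
        then obtain v where v: "v \<in> U j - Z j" and vU: "v \<in> U j" by (auto simp: U'_def)
        have "card (U' j) \<le> card {u \<in> U j. fst (h j u) = 0}"
          using finU by (intro card_mono) (auto simp: U'_def)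
        then have "card (U' j) * m j ^ (i + 1) \<le> card {u \<in> U j. fst (h j u) = 0} * m j ^ (i + 1)"
          by (rule mult_right_mono) simp
        from this regular(1)[OF j v k0[OF vU]] show ?thesis by (rule order_trans)
      qed simp
      fix v assume "v \<in> U' j"
      then have v: "v \<in> U j - Z j" by (auto simp: U'_def)
      then have vU: "v \<in> U j" by blast
      let ?L = "{u \<in> nbrs j v \<inter> U j. fst (h j u) = 0}"
      have finN: "finite (nbrs j v)" using finite_nbrs[OF j] .
      have "card (nbrs j v \<inter> U' j) \<le> card ?L"
        using finN by (intro card_mono) (auto simp: U'_def)
      then have "card (nbrs j v \<inter> U' j) * m j ^ (i + 1) \<le> card ?L * m j ^ (i + 1)"
        by (rule mult_right_mono) simp
      then show "card (nbrs j v \<inter> U' j) * m j ^ (i + 1) \<le> 2 ^ (i + 1) * \<Delta> j"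
        using regular(3)[OF j v k0[OF vU]] by linarith
      \<comment> \<open>\<open>?a\<close> is untouched by the stage, as the nodes of
        \<open>B\<close> remain uncolored. Bad leftover neighbors leave \<open>U\<close> but enter
        \<open>B'\<close>, so all of \<open>?L\<close> still counts.\<close>
      let ?a = "\<Delta> j - card (nbrs j v) + card (nbrs j v \<inter> B j)"
      have "card (nbrs j v \<inter> (U j \<union> B j)) = card (nbrs j v \<inter> B j) + card (nbrs j v \<inter> U j)"
        using finN I(2)[OF j] by (subst card_Un_disjoint[symmetric]) (auto intro: arg_cong[where f = card])
      then have "\<Delta> j \<le> (2 * m j) ^ i * (?a + card (nbrs j v \<inter> U j))"
        using I(7)[OF j vU] by (simp add: add.assoc)
      then have "\<Delta> j \<le> (2 * m j) ^ (i + 1) * (?a + card ?L)"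
        by (rule regular(5)[OF j v k0[OF vU]])
      also have "?a + card ?L \<le> \<Delta> j - card (nbrs j v) + card (nbrs j v \<inter> (U' j \<union> B' j))"
      proof -
        have "card (nbrs j v \<inter> B j) + card ?L = card ((nbrs j v \<inter> B j) \<union> ?L)"
          using finN I(2)[OF j] by (intro card_Un_disjoint[symmetric]) auto
        also have "\<dots> \<le> card (nbrs j v \<inter> (U' j \<union> B' j))"
          using finN by (intro card_mono) (auto simp: U'_def B'_def)
        finally show ?thesis by simp
      qed
      finally show "\<Delta> j \<le> (2 * m j) ^ (i + 1) * (\<Delta> j - card (nbrs j v) + card (nbrs j v \<inter> (U' j \<union> B' j)))"
        by simp
    qed
  qed
qed

lemma common_list_coloring:
  obtains \<phi> where "common \<phi>" "\<And>j. j \<in> instances \<Longrightarrow> partial_coloring j (\<phi> j) {}"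
proof -
  define big where "big j \<longleftrightarrow> large_root \<le> root6 (\<Delta> j)" for j
  define U0 where "U0 j = (if big j then {..<nodes j} else {})" for j
  define B0 where "B0 j = (if big j then {} else {..<nodes j})" for j
  \<comment> \<open>The constant 0 is a placeholder: no node counts as colored yet.\<close>
  have start: "common (\<lambda>j. (\<lambda>v::nat. 0::nat, U0 j, B0 j))"
    by (rule common_map[OF common_\<Delta>], rule common_fromI) (simp only: U0_def B0_def big_def)
  have inv: "stage_invariant 0 j (\<lambda>v. 0) (U0 j) (B0 j)" if j: "j \<in> instances" for j
  proof (cases "big j")
    case True
    have "nbrs j v \<inter> {..<nodes j} = nbrs j v" for v using nbrs_subset[OF j, of v] by auto
    then show ?thesis using True card_nbrs_le[OF j]
      by (auto simp: stage_invariant_def Let_def partial_coloring_def U0_def B0_def big_def)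
  next
    case False
    have "\<Delta> j + 1 \<le> (root6 (\<Delta> j) + 1) ^ 6" using root6(2)[of "\<Delta> j"] by simp
    also have "\<dots> \<le> large_root ^ 6" using False by (intro power_mono) (auto simp: big_def)
    finally have "nodes j * (\<Delta> j + 1) \<le> nodes j * large_root ^ 6" by (rule mult_le_mono2)
    then show ?thesis using False
      by (simp add: stage_invariant_def Let_def partial_coloring_def U0_def B0_def mult.commute)
  qed
  obtain \<phi>1 U1 B1 where 1: "common (\<lambda>j. (\<phi>1 j, U1 j, B1 j))"
    "\<And>j. j \<in> instances \<Longrightarrow> stage_invariant (0 + 1) j (\<phi>1 j) (U1 j) (B1 j)"
    by (rule stage[OF _ start inv], simp, assumption) (rule that; assumption)
  obtain \<phi>2 U2 B2 where 2: "common (\<lambda>j. (\<phi>2 j, U2 j, B2 j))"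
    "\<And>j. j \<in> instances \<Longrightarrow> stage_invariant (0 + 1 + 1) j (\<phi>2 j) (U2 j) (B2 j)"
    by (rule stage[OF _ 1], simp, assumption) (rule that; assumption)
  obtain \<phi> U B where 3: "common (\<lambda>j. (\<phi> j, U j, B j))"
    "\<And>j. j \<in> instances \<Longrightarrow> stage_invariant (0 + 1 + 1 + 1) j (\<phi> j) (U j) (B j)"
    by (rule stage[OF _ 2], simp, assumption) (rule that; assumption)
  have I: "partial_coloring j (\<phi> j) (U j \<union> B j)" "U j \<inter> B j = {}"
    "card (B j) * (\<Delta> j + 1) \<le> (large_root ^ 6 + 3) * nodes j"
    "root6 (\<Delta> j) < large_root \<Longrightarrow> U j = {}" "card (U j) * root6 (\<Delta> j) ^ 3 \<le> 8 * nodes j"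
    "\<And>v. v \<in> U j \<Longrightarrow> card (nbrs j v \<inter> U j) * root6 (\<Delta> j) ^ 3 \<le> 8 * \<Delta> j"
    if "j \<in> instances" for j
    using 3(2)[OF that] unfolding stage_invariant_def Let_def
    by (simp_all add: numeral_3_eq_3 del: One_nat_def)
  have sub: "U j \<union> B j \<subseteq> {..<nodes j}" if "j \<in> instances" for j
    using I(1)[OF that] by (auto simp: partial_coloring_def)
  let ?G = "\<lambda>j. (\<phi> j, U j, B j)"
  \<comment> \<open>With \<open>2 ^ 3 = 8\<close> the invariant after three stages gives
    \<open>U\<close> the bounds of a single bin, so \<open>bin_words_bound\<close> applies and one
    leader suffices.\<close>
  obtain f where f: "common (\<lambda>j. (?G j, f j))" "\<And>j. j \<in> instances \<Longrightarrow>
      partial_coloring j (\<lambda>v. if v \<in> U j then f j v else \<phi> j v) (U j \<union> B j - U j)"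
  proof (rule extend_coloring_at_leader[OF 3(1), of U \<phi> "\<lambda>j. U j \<union> B j" 8704])
    show "(\<Sum>v\<in>U j. 2 * card (nbrs j v \<inter> U j) + 1) \<le> 8704 * nodes j" if j: "j \<in> instances" for j
    proof (cases "U j = {}")
      case False
      then have "1 \<le> root6 (\<Delta> j)" using I(4)[OF j] by (cases "root6 (\<Delta> j)") (auto simp: large_root_def)
      then show ?thesis
        using sub[OF j] by (intro bin_words_bound[OF _ _ root6 I(5)[OF j] I(6)[OF j]])
          (auto intro: finite_subset)
    qed simp
  qed ((rule that; assumption) | auto intro: common_fromI I(1))+
  define \<psi> where "\<psi> j = (\<lambda>v. if v \<in> U j then f j v else \<phi> j v)" for j
  have \<psi>: "partial_coloring j (\<psi> j) (B j)" if "j \<in> instances" for j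
    using f(2)[OF that] I(2)[OF that] by (simp add: \<psi>_def Un_Diff Diff_triv Int_commute)
  obtain g where g: "common (\<lambda>j. ((?G j, f j), g j))" "\<And>j. j \<in> instances \<Longrightarrow>
      partial_coloring j (\<lambda>v. if v \<in> B j then g j v else \<psi> j v) (B j - B j)"
  proof (rule extend_coloring_at_leader[OF f(1), of B \<psi> B "2 * (large_root ^ 6 + 3)"])
    show "common_from (\<lambda>j. (?G j, f j)) \<psi>" by (rule common_fromI) (simp add: \<psi>_def fun_eq_iff)
    \<comment> \<open>A node contributes at most \<open>2 * \<Delta> + 1\<close> words, which is
      less than \<open>2 * (\<Delta> + 1)\<close>; hence twice the constant of the
      invariant.\<close>
    show "(\<Sum>v\<in>B j. 2 * card (nbrs j v \<inter> B j) + 1) \<le> 2 * (large_root ^ 6 + 3) * nodes j"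
      if j: "j \<in> instances" for j
    proof -
      have "(\<Sum>v\<in>B j. 2 * card (nbrs j v \<inter> B j) + 1) \<le> of_nat (card (B j)) * (2 * (\<Delta> j + 1))"
      proof (rule sum_bounded_above)
        fix v assume "v \<in> B j"
        then have "v < nodes j" using sub[OF j] by blast
        from card_nbrs_le[OF j this] have "card (nbrs j v) \<le> \<Delta> j" .
        moreover have "card (nbrs j v \<inter> B j) \<le> card (nbrs j v)"
          using finite_nbrs[OF j] by (intro card_mono) auto
        ultimately have "card (nbrs j v \<inter> B j) \<le> \<Delta> j" by (rule order_trans[rotated])
        then show "2 * card (nbrs j v \<inter> B j) + 1 \<le> 2 * (\<Delta> j + 1)" by simp
      qed
      also have "\<dots> = 2 * (card (B j) * (\<Delta> j + 1))" by simp
      also have "\<dots> \<le> 2 * ((large_root ^ 6 + 3) * nodes j)" using I(3)[OF j] by (rule mult_le_mono2)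
      finally show ?thesis by (simp only: mult.assoc)
    qed
  qed ((rule that; assumption) | auto intro: common_fromI \<psi>)+
  show thesis
  proof (rule that[of "\<lambda>j v. if v \<in> B j then g j v else \<psi> j v"])
    show "common (\<lambda>j v. if v \<in> B j then g j v else \<psi> j v)"
      by (rule common_map[OF g(1)], rule common_fromI) (simp add: \<psi>_def fun_eq_iff)
    show "partial_coloring j (\<lambda>v. if v \<in> B j then g j v else \<psi> j v) {}" if "j \<in> instances" for j
      using g(2)[OF that] by simp
  qed
qed

end

theorem theorem1p1:
  fixes c :: nat
  shows "\<exists>(A :: (nat set set \<times> nat set, nat) cc_algorithm) (R :: nat) (b :: nat).
           \<forall>n\<ge>1. \<forall>E \<Psi>. delta_plus_one_instance c n E \<Psi> \<longrightarrow>
             respects_bandwidth A n (node_input E \<Psi>) R b \<and>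
             list_coloring {..<n} E \<Psi> (cc_result A n (node_input E \<Psi>) R)"
proof -
  interpret list_coloring_problem c .
  obtain \<phi> where \<phi>: "common \<phi>" "\<And>j. j \<in> instances \<Longrightarrow> partial_coloring j (\<phi> j) {}"
    by (rule common_list_coloring) (rule that; assumption)
  \<comment> \<open>Every node knows the whole coloring and outputs its own entry.\<close>
  have "knows \<phi>" using \<phi>(1) by (rule knows_localI[where f = "\<lambda>n v i x. x v"]) simp
  then obtain A :: "(nat set set \<times> nat set, nat) cc_algorithm" and R b where A: "\<forall>j\<in>instances.
     respects_bandwidth A (nodes j) (input j) R b \<and> (\<forall>v<nodes j. cc_result A (nodes j) (input j) R v = \<phi> j v)"
    unfolding knows_def by blast
  have "respects_bandwidth A n (node_input E \<Psi>) R b \<and>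
      list_coloring {..<n} E \<Psi> (cc_result A n (node_input E \<Psi>) R)"
    if "1 \<le> n" "delta_plus_one_instance c n E \<Psi>" for n E \<Psi>
  proof -
    define j where "j = (n, E, \<Psi>)"
    have j: "j \<in> instances" using that by (simp add: j_def instances_def)
    have proj: "nodes j = n" "input j = node_input E \<Psi>" "edges j = E" "palette j = \<Psi>"
      by (simp_all add: j_def nodes_def input_def edges_def palette_def)
    have A': "respects_bandwidth A n (node_input E \<Psi>) R b"
      "\<forall>v<n. cc_result A n (node_input E \<Psi>) R v = \<phi> j v"
      using bspec[OF A j] unfolding proj(1,2) by blast+
    have "\<phi> j v \<in> \<Psi> v" if "v < n" for v
      using \<phi>(2)[OF j] that by (simp add: partial_coloring_def proj)
    moreover have "\<phi> j u \<noteq> \<phi> j v" and "u < n" and "v < n" if "{u, v} \<in> E" for u v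
    proof -
      have uv: "u \<in> nbrs j v" "v \<in> nbrs j u" using that by (auto simp: nbrs_def proj insert_commute)
      then show "u < n" "v < n" using nbrs_subset[OF j] by (auto simp: proj)
      then show "\<phi> j u \<noteq> \<phi> j v" using uv \<phi>(2)[OF j] by (auto simp: partial_coloring_def proj)
    qed
    ultimately have "list_coloring {..<n} E \<Psi> (cc_result A n (node_input E \<Psi>) R)"
      using A'(2) unfolding list_coloring_def proper_coloring_def by (metis lessThan_iff)
    with A'(1) show ?thesis ..
  qed
  then show ?thesis by blast
qed

end
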